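(* Let $\mathfrak g$ be a simple Lie algebra and $\alpha\in\Pi$ a simple root. For the $(\mathbb Z,\alpha)$-grading of $\mathfrak g$ with $d=d_\alpha$ one has $$\gamma_\alpha(1)=\frac{q_\alpha}{2h^*r_\alpha}\qquad\text{and}\qquad \gamma_\alpha(d)=1-\frac{d\,q_\alpha}{2h^*r_\alpha}.$$
   Context: The ground field $\Bbbk$ is algebraically closed of characteristic $0$. $\mathfrak g$ is a simple Lie algebra with Killing form $\Phi$, Cartan subalgebra $\mathfrak t$, root system $\Delta$, positive roots $\Delta^+$, simple roots $\Pi$, highest root $\theta$. $(\ ,\ )$ is the bilinear form on $\mathfrak t^*$ induced by $\Phi|_{\mathfrak t}$. $\varphi_\alpha$ is the fundamental weight corresponding to $\alpha\in\Pi$. $h^*$ is the dual Coxeter number of $\mathfrak g$ (so $(\theta,\theta)=1/h^*$), and $r_\alpha=(\theta,\theta)/(\alpha,\alpha)$. For $\gamma=\sum_{\beta\in\Pi}n_\beta\beta$ put $\mathsf{ht}_\alpha(\gamma)=n_\alpha$; $\Delta_\alpha(i)=\{\gamma\in\Delta\mid \mathsf{ht}_\alpha(\gamma)=i\}$; $d_\alpha=\mathsf{ht}_\alpha(\theta)$. The $(\mathbb Z,\alpha)$-grading is $\mathfrak g=\bigoplus_{i=-d_\alpha}^{d_\alpha}\mathfrak g_\alpha(i)$ with $\mathfrak g_\alpha(0)=\mathfrak t\oplus\bigoplus_{\gamma\in\Delta_\alpha(0)}\mathfrak g^\gamma$ and $\mathfrak g_\alpha(i)=\bigoplus_{\gamma\in\Delta_\alpha(i)}\mathfrak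 g^\gamma$ for $i\ne0$, where $\mathfrak g^\gamma$ is the root space. Each nonzero $\mathfrak g_\alpha(i)$, $i\neq 0$, is a simple $\mathfrak g_\alpha(0)$-module. $\mathcal C_\alpha(0)=\sum_j e_j'e_j\in\mathcal U(\mathfrak g_\alpha(0))$ is the Casimir element, where $\{e_j\},\{e'_j\}$ are bases of $\mathfrak g_\alpha(0)$ dual with respect to $\Phi|_{\mathfrak g_\alpha(0)}$; $\gamma_\alpha(i)$ is the scalar by which it acts on $\mathfrak g_\alpha(i)$. The number $q_\alpha$ is the positive integer defined by $\sum_{i\ge1}\sum_{\gamma\in\Delta_\alpha(i)}\gamma=q_\alpha\varphi_\alpha$. *)

theory Defs
  imports
    "HOL-Library.Function_Algebras"
    "HOL-Computational_Algebra.Computational_Algebra"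
begin

section \<open>Finite-dimensional Lie algebras and the Killing form\<close>

locale lie_algebra = vector_space scale
  for scale :: "'k::field \<Rightarrow> 'g::ab_group_add \<Rightarrow> 'g" +
  fixes bracket :: "'g \<Rightarrow> 'g \<Rightarrow> 'g"
  assumes finite_dim: "\<exists>B. finite B \<and> span B = UNIV"
    and bracket_linear_right: "Vector_Spaces.linear scale scale (bracket x)"
    and bracket_linear_left: "Vector_Spaces.linear scale scale (\<lambda>x. bracket x y)"
    and bracket_alternating: "bracket x x = 0"
    and jacobi: "bracket x (bracket y z) + bracket y (bracket z x) + bracket z (bracket x y) = 0"
begin

definition basis_of :: "'g set \<Rightarrow> 'g set \<Rightarrow> bool" where
  "basis_of B S \<longleftrightarrow> independent B \<and> span B = S"

text \<open>The trace of an endomorphism does not depend on the basis in which it is computed.\<close>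

definition trace :: "('g \<Rightarrow> 'g) \<Rightarrow> 'k" where
  "trace f = (let B = (SOME B. basis_of B UNIV) in \<Sum>b\<in>B. representation B (f b) b)"

definition killing :: "'g \<Rightarrow> 'g \<Rightarrow> 'k" where
  "killing x y = trace (bracket x \<circ> bracket y)"

definition subalgebra :: "'g set \<Rightarrow> bool" where
  "subalgebra S \<longleftrightarrow> subspace S \<and> (\<forall>x\<in>S. \<forall>y\<in>S. bracket x y \<in> S)"

definition lie_ideal :: "'g set \<Rightarrow> bool" where
  "lie_ideal I \<longleftrightarrow> subspace I \<and> (\<forall>x. \<forall>y\<in>I. bracket x y \<in> I)"

primrec lower_central :: "'g set \<Rightarrow> nat \<Rightarrow> 'g set" where
  "lower_central S 0 = S"
| "lower_central S (Suc n) = span {bracket x y | x y. x \<in> S \<and> y \<in> lower_central S n}"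

definition normalizer :: "'g set \<Rightarrow> 'g set" where
  "normalizer S = {x. \<forall>y\<in>S. bracket x y \<in> S}"

definition cartan_subalgebra :: "'g set \<Rightarrow> bool" where
  "cartan_subalgebra S \<longleftrightarrow>
     subalgebra S \<and> (\<exists>n. lower_central S n = {0}) \<and> normalizer S = S"

text \<open>The operator by which the Casimir element \<open>\<Sum>\<^sub>j e'\<^sub>j e\<^sub>j\<close> of the subalgebra \<open>S\<close> acts in the
  adjoint representation, for bases \<open>e\<close>, \<open>e'\<close> of \<open>S\<close> dual to each other with respect to the
  restriction of the Killing form of the whole algebra. The operator is the same for
  every pair of dual bases; such pairs exist when this restriction is non-degenerate.\<close>

definition dual_bases :: "'g set \<Rightarrow> nat \<Rightarrow> (nat \<Rightarrow> 'g) \<Rightarrow> (nat \<Rightarrow> 'g) \<Rightarrow> bool" where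
  "dual_bases S n e e' \<longleftrightarrow>
     inj_on e {..<n} \<and> basis_of (e ` {..<n}) S \<and>
     inj_on e' {..<n} \<and> basis_of (e' ` {..<n}) S \<and>
     (\<forall>i<n. \<forall>j<n. killing (e i) (e' j) = (if i = j then 1 else 0))"

definition casimir :: "'g set \<Rightarrow> 'g \<Rightarrow> 'g" where
  "casimir S = (THE C. \<exists>n e e'. dual_bases S n e e' \<and>
                  C = (\<lambda>x. \<Sum>j<n. bracket (e' j) (bracket (e j) x)))"

end

locale simple_lie_algebra = lie_algebra scale bracket
  for scale :: "'k::{alg_closed_field, field_char_0} \<Rightarrow> 'g::ab_group_add \<Rightarrow> 'g"
  and bracket :: "'g \<Rightarrow> 'g \<Rightarrow> 'g" +
  assumes non_abelian: "\<exists>x y. bracket x y \<noteq> 0"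
    and ideal_trivial: "lie_ideal I \<Longrightarrow> I = {0} \<or> I = UNIV"


section \<open>Roots\<close>

text \<open>An element of the dual of a subspace \<open>T\<close> is encoded as a function on the whole
  algebra that is linear on \<open>T\<close> and zero outside \<open>T\<close>, so that equal functionals are
  equal functions. Sums of functionals are the pointwise ones of
  \<^theory>\<open>HOL-Library.Function_Algebras\<close>.\<close>

definition fscale :: "'k::field \<Rightarrow> ('g \<Rightarrow> 'k) \<Rightarrow> 'g \<Rightarrow> 'k" where
  "fscale c f = (\<lambda>x. c * f x)"

interpretation functional: vector_space "fscale :: 'k::field \<Rightarrow> ('g \<Rightarrow> 'k) \<Rightarrow> 'g \<Rightarrow> 'k"
  by unfold_locales (auto simp: fscale_def fun_eq_iff algebra_simps)

locale cartan_simple_lie_algebra = simple_lie_algebra scale bracket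
  for scale :: "'k::{alg_closed_field, field_char_0} \<Rightarrow> 'g::ab_group_add \<Rightarrow> 'g"
  and bracket :: "'g \<Rightarrow> 'g \<Rightarrow> 'g" +
  fixes T :: "'g set"
  assumes cartan: "cartan_subalgebra T"
begin

definition dual :: "('g \<Rightarrow> 'k) set" where
  "dual = {f. (\<forall>x\<in>T. \<forall>y\<in>T. f (x + y) = f x + f y) \<and>
              (\<forall>c. \<forall>x\<in>T. f (scale c x) = c * f x) \<and>
              (\<forall>x. x \<notin> T \<longrightarrow> f x = 0)}"

text \<open>The form on the dual induced by the Killing form on \<open>T\<close>, via the isomorphism
  that sends \<open>f\<close> to the element of \<open>T\<close> representing it.\<close>

definition representer :: "('g \<Rightarrow> 'k) \<Rightarrow> 'g" where
  "representer f = (THE h. h \<in> T \<and> (\<forall>x\<in>T. killing h x = f x))"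

definition form :: "('g \<Rightarrow> 'k) \<Rightarrow> ('g \<Rightarrow> 'k) \<Rightarrow> 'k" where
  "form f g = killing (representer f) (representer g)"

definition root_space :: "('g \<Rightarrow> 'k) \<Rightarrow> 'g set" where
  "root_space \<gamma> = {x. \<forall>h\<in>T. bracket h x = scale (\<gamma> h) x}"

definition roots :: "('g \<Rightarrow> 'k) set" where
  "roots = {\<gamma> \<in> dual. \<gamma> \<noteq> 0 \<and> root_space \<gamma> \<noteq> {0}}"

definition nonneg_comb :: "('g \<Rightarrow> 'k) set \<Rightarrow> ('g \<Rightarrow> 'k) set" where
  "nonneg_comb P = {\<Sum>\<beta>\<in>P. fscale (of_nat (n \<beta>)) \<beta> | n. True}"

definition simple_system :: "('g \<Rightarrow> 'k) set \<Rightarrow> bool" where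
  "simple_system P \<longleftrightarrow> P \<subseteq> roots \<and>
     functional.independent P \<and> functional.span P = dual \<and>
     (\<forall>\<gamma>\<in>roots. \<gamma> \<in> nonneg_comb P \<or> - \<gamma> \<in> nonneg_comb P)"

end

locale based_simple_lie_algebra = cartan_simple_lie_algebra scale bracket T
  for scale :: "'k::{alg_closed_field, field_char_0} \<Rightarrow> 'g::ab_group_add \<Rightarrow> 'g"
  and bracket :: "'g \<Rightarrow> 'g \<Rightarrow> 'g"
  and T :: "'g set" +
  fixes simples :: "('g \<Rightarrow> 'k) set"
  assumes simple_system: "simple_system simples"
begin

definition pos_roots :: "('g \<Rightarrow> 'k) set" where
  "pos_roots = roots \<inter> nonneg_comb simples"

definition highest_root :: "'g \<Rightarrow> 'k" where
  "highest_root = (THE \<theta>. \<theta> \<in> roots \<and> (\<forall>\<gamma>\<in>roots. \<theta> - \<gamma> \<in> nonneg_comb simples))"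

definition fundamental_weight :: "('g \<Rightarrow> 'k) \<Rightarrow> 'g \<Rightarrow> 'k" where
  "fundamental_weight \<alpha> = (THE \<phi>. \<phi> \<in> dual \<and>
     (\<forall>\<beta>\<in>simples. 2 * form \<phi> \<beta> / form \<beta> \<beta> = (if \<beta> = \<alpha> then 1 else 0)))"

text \<open>With \<open>\<rho>\<close> the half-sum of the positive roots and \<open>\<theta>\<close> the highest root, the dual
  Coxeter number is \<open>1 + (\<rho>, \<theta>\<^sup>\<or>)\<close>, where \<open>\<theta>\<^sup>\<or> = 2\<theta>/(\<theta>, \<theta>)\<close>.\<close>

definition weyl_vector :: "'g \<Rightarrow> 'k" where
  "weyl_vector = fscale (1 / 2) (\<Sum>\<gamma>\<in>pos_roots. \<gamma>)"

definition dual_coxeter_number :: 'k where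
  "dual_coxeter_number =
     1 + 2 * form weyl_vector highest_root / form highest_root highest_root"

definition length_ratio :: "('g \<Rightarrow> 'k) \<Rightarrow> 'k" where
  "length_ratio \<alpha> = form highest_root highest_root / form \<alpha> \<alpha>"


section \<open>The grading attached to a simple root\<close>

definition ht :: "('g \<Rightarrow> 'k) \<Rightarrow> ('g \<Rightarrow> 'k) \<Rightarrow> int" where
  "ht \<alpha> \<gamma> = (THE m. \<exists>n :: ('g \<Rightarrow> 'k) \<Rightarrow> int.
               \<gamma> = (\<Sum>\<beta>\<in>simples. fscale (of_int (n \<beta>)) \<beta>) \<and> m = n \<alpha>)"

definition roots_of_ht :: "('g \<Rightarrow> 'k) \<Rightarrow> int \<Rightarrow> ('g \<Rightarrow> 'k) set" where
  "roots_of_ht \<alpha> i = {\<gamma> \<in> roots. ht \<alpha> \<gamma> = i}"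

definition depth :: "('g \<Rightarrow> 'k) \<Rightarrow> int" where
  "depth \<alpha> = ht \<alpha> highest_root"

definition graded_part :: "('g \<Rightarrow> 'k) \<Rightarrow> int \<Rightarrow> 'g set" where
  "graded_part \<alpha> i =
     span ((if i = 0 then T else {}) \<union> (\<Union>\<gamma>\<in>roots_of_ht \<alpha> i. root_space \<gamma>))"

text \<open>The scalar by which the Casimir element of the degree-zero part acts on the part of
  degree \<open>i\<close>.\<close>

definition casimir_scalar :: "('g \<Rightarrow> 'k) \<Rightarrow> int \<Rightarrow> 'k" where
  "casimir_scalar \<alpha> i =
     (THE c. \<forall>x\<in>graded_part \<alpha> i. casimir (graded_part \<alpha> 0) x = scale c x)"

definition q_number :: "('g \<Rightarrow> 'k) \<Rightarrow> nat" where
  "q_number \<alpha> = (THE q. 0 < q \<and>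
     (\<Sum>\<gamma>\<in>(\<Union>i\<in>{1..}. roots_of_ht \<alpha> i). \<gamma>) = fscale (of_nat q) (fundamental_weight \<alpha>))"

end

end

theory Submission
  imports Defs
begin

text \<open>
The proof evaluates Casimir operators on two extremal root vectors. Let \<open>R\<close> be a
symmetric set of roots with a chosen half \<open>P\<close>, and consider the Casimir element of
\<open>T\<close> plus the root spaces of \<open>R\<close>, written with an orthonormal basis of
\<open>T\<close> and opposite root vectors. On a root vector of weight \<open>\<mu>\<close> that is
killed by the root spaces of \<open>P\<close> it acts as \<open>(\<mu>, \<mu>) +
\<Sum>\<^sub>\<gamma>\<^sub>\<in>\<^sub>P (\<mu>, \<gamma>)\<close>; this is
\<open>Levi_casimir_extremal\<close>. It is used three times.

\<^item> For all roots and \<open>\<mu> = \<theta>\<close>, the Casimir element of the whole algebra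
  acts as the identity, because the Killing form is the trace form of the adjoint representation
  (\<open>killing_casimir_UNIV\<close>). So \<open>(\<theta>, \<theta>) + (\<theta>, 2\<rho>) =
  1\<close>, which says \<open>(\<theta>, \<theta>) = 1/h\<^sup>*\<close>.
\<^item> For the roots of \<open>\<alpha>\<close>-height \<open>0\<close> and the lowest weight
  \<open>\<mu> = \<alpha>\<close> of degree \<open>1\<close>, the scalar is \<open>(\<alpha>,
  \<alpha>) - (\<alpha>, 2\<rho>\<^sub>0)\<close>, with \<open>2\<rho>\<^sub>0\<close> the sum of
  the positive roots of \<open>\<alpha>\<close>-height \<open>0\<close>. Since \<open>2\<rho> =
  2\<rho>\<^sub>0 + q \<phi>\<^sub>\<alpha>\<close> and \<open>(\<alpha>, 2\<rho>) = (\<alpha>,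
  \<alpha>)\<close>, it equals \<open>q (\<alpha>, \<alpha>)/2 = q/(2 h\<^sup>* r)\<close>.
\<^item> For the same roots and the highest weight \<open>\<mu> = \<theta>\<close> of degree
  \<open>d\<close>, it is \<open>(\<theta>, \<theta>) + (\<theta>, 2\<rho>\<^sub>0) = 1 - (\<theta>,
  q \<phi>\<^sub>\<alpha>) = 1 - d q (\<alpha>, \<alpha>)/2\<close>.

The sum of the roots of positive \<open>\<alpha>\<close>-height is a multiple of
\<open>\<phi>\<^sub>\<alpha>\<close> because reflections in the other simple roots permute these
roots. The Casimir element commutes with the degree-zero part, and all root vectors of degree
\<open>1\<close> and \<open>d\<close> are linked to the extremal ones by brackets with degree-zero
root vectors (\<open>Cas_level_1\<close>, \<open>Cas_level_depth\<close>), so its eigenvalue is the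
same on the whole graded part.

The structure theory behind this starts from a nilpotent self-normalizing \<open>T\<close>. The
algebra is a direct sum of generalized weight spaces, and a theorem of Engel type
(\<open>weight_vector_modulo\<close>) shows that \<open>T\<close> is the one of weight zero and that
\<open>T\<close> acts triangularly in a basis of weight vectors. Traces over strings of weights show
that on \<open>[\<gg>\<^sup>\<alpha>, \<gg>\<^sup>-\<^sup>\<alpha>]\<close> all weights are rational
multiples of \<open>\<alpha>\<close>. If the Killing form vanished, all weights would then vanish on
\<open>T\<close> and the algebra would be nilpotent; so the form is non-degenerate
(\<open>killing_nondegenerate\<close>). Then \<open>T\<close> is abelian and acts diagonalizably
(\<open>gws_eigen\<close>), and representations of \<open>\<ss>\<ll>\<^sub>2\<close> give the usual
properties of roots. Existence of the highest root uses simplicity once more: a vector killed by all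
simple root vectors generates an ideal, whose weights lie below that of the vector
(\<open>highest_weight_root_dominates\<close>).
\<close>

section \<open>Brackets, traces and the Killing form\<close>

context lie_algebra
begin

text \<open>A fixed finite basis makes the dimension theory of
  \<^locale>\<open>finite_dimensional_vector_space\<close> available, which is used for choosing
  subspaces of minimal dimension.\<close>

definition some_basis :: "'g set" where
  "some_basis = (SOME B. finite B \<and> independent B \<and> span B = UNIV)"

lemma some_basis: "finite some_basis \<and> independent some_basis \<and> span some_basis = UNIV"
proof -
  obtain B where B: "finite B" "span B = UNIV" using finite_dim by blast
  obtain C where C: "C \<subseteq> B" "independent C" "B \<subseteq> span C"
    using maximal_independent_subset[of B] by blast
  have "finite C" using B C finite_subset by blast
  moreover have "span C = UNIV" using B C span_mono[of B "span C"] span_span by auto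
  ultimately have "\<exists>B. finite B \<and> independent B \<and> span B = UNIV" using C by blast
  then show ?thesis unfolding some_basis_def by (rule someI_ex)
qed

sublocale finite_dimensional_vector_space scale some_basis
  using some_basis by unfold_locales auto

lemma bracket_add_right: "bracket x (y + z) = bracket x y + bracket x z"
  using bracket_linear_right[of x] by (simp add: Vector_Spaces.linear_iff vector_space_axioms)
lemma bracket_scale_right: "bracket x (scale c y) = scale c (bracket x y)"
  using bracket_linear_right[of x] by (simp add: Vector_Spaces.linear_iff vector_space_axioms)
lemma bracket_add_left: "bracket (x + y) z = bracket x z + bracket y z"
  using bracket_linear_left[of z] by (simp add: Vector_Spaces.linear_iff vector_space_axioms)
lemma bracket_scale_left: "bracket (scale c x) y = scale c (bracket x y)"
  using bracket_linear_left[of y] by (simp add: Vector_Spaces.linear_iff vector_space_axioms)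

lemma bracket_zero_right [simp]: "bracket x 0 = 0"
  using bracket_scale_right[of x 0 0] by simp
lemma bracket_zero_left [simp]: "bracket 0 x = 0"
  using bracket_scale_left[of 0 0 x] by simp
lemma bracket_minus_right: "bracket x (- y) = - bracket x y"
  using bracket_add_right[of x y "- y"] by (simp add: eq_neg_iff_add_eq_0 add.commute)
lemma bracket_minus_left: "bracket (- x) y = - bracket x y"
  using bracket_add_left[of x "- x" y] by (simp add: eq_neg_iff_add_eq_0 add.commute)
lemma bracket_diff_right: "bracket x (y - z) = bracket x y - bracket x z"
  using bracket_add_right[of x y "- z"] by (simp add: bracket_minus_right)
lemma bracket_diff_left: "bracket (x - y) z = bracket x z - bracket y z"
  using bracket_add_left[of x "- y" z] by (simp add: bracket_minus_left)
lemma bracket_sum_right: "bracket x (sum f A) = (\<Sum>a\<in>A. bracket x (f a))"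
  by (induction A rule: infinite_finite_induct) (auto simp: bracket_add_right)
lemma bracket_sum_left: "bracket (sum f A) x = (\<Sum>a\<in>A. bracket (f a) x)"
  by (induction A rule: infinite_finite_induct) (auto simp: bracket_add_left)

lemma bracket_anti: "bracket y x = - bracket x y"
proof -
  have "0 = bracket (x + y) (x + y)" by (simp add: bracket_alternating)
  also have "\<dots> = bracket x y + bracket y x"
    unfolding bracket_add_left bracket_add_right by (simp add: bracket_alternating)
  finally show ?thesis by (metis add.commute eq_neg_iff_add_eq_0)
qed

text \<open>The Jacobi identity in the form used throughout: \<open>ad x\<close> is a derivation.\<close>

lemma bracket_derivation: "bracket x (bracket y z) = bracket (bracket x y) z + bracket y (bracket x z)"
proof -
  have "bracket x (bracket y z) = - (bracket y (bracket z x) + bracket z (bracket x y))"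
    using jacobi[of x y z] by (metis add.assoc eq_neg_iff_add_eq_0)
  also have "\<dots> = - bracket y (bracket z x) - bracket z (bracket x y)"
    by simp
  also have "\<dots> = bracket (bracket x y) z + bracket y (bracket x z)"
    unfolding bracket_anti[of x z] bracket_anti[of "bracket x y" z] by (simp add: bracket_minus_right)
  finally show ?thesis .
qed

lemma bracket_bracket_left: "bracket (bracket x y) z = bracket x (bracket y z) - bracket y (bracket x z)"
  using bracket_derivation[of x y z] by simp

subsection \<open>Traces\<close>

lemma basis_of_finite: "basis_of B S \<Longrightarrow> finite B"
  unfolding basis_of_def using finiteI_independent by blast

lemma rep_add: "basis_of B UNIV \<Longrightarrow> representation B (x + y) b = representation B x b + representation B y b"
  by (simp add: basis_of_def representation_add)
lemma rep_diff: "basis_of B UNIV \<Longrightarrow> representation B (x - y) b = representation B x b - representation B y b"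
  by (simp add: basis_of_def representation_diff)
lemma rep_scale: "basis_of B UNIV \<Longrightarrow> representation B (scale c x) b = c * representation B x b"
  by (simp add: basis_of_def representation_scale)
lemma rep_sum: "basis_of B UNIV \<Longrightarrow> representation B (sum f A) b = (\<Sum>a\<in>A. representation B (f a) b)"
  by (simp add: basis_of_def representation_sum)
lemma rep_expand: "basis_of B UNIV \<Longrightarrow> (\<Sum>b\<in>B. scale (representation B x b) b) = x"
  using basis_of_finite by (simp add: basis_of_def sum_representation_eq)
lemma rep_basis: "basis_of B UNIV \<Longrightarrow> b \<in> B \<Longrightarrow> representation B b c = (if c = b then 1 else 0)"
  by (simp add: basis_of_def representation_basis)

abbreviation lin :: "('g \<Rightarrow> 'g) \<Rightarrow> bool" where
  "lin \<equiv> Vector_Spaces.linear scale scale"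

lemma lin_scale: "lin f \<Longrightarrow> f (scale c x) = scale c (f x)"
  by (simp add: Vector_Spaces.linear_iff vector_space_axioms)

lemma lin_add: "lin f \<Longrightarrow> f (x + y) = f x + f y"
  by (simp add: Vector_Spaces.linear_iff vector_space_axioms)

lemma lin_zero: "lin f \<Longrightarrow> f 0 = 0"
  using lin_scale[of f 0 0] by simp

lemma lin_sum: "lin f \<Longrightarrow> f (sum g A) = (\<Sum>a\<in>A. f (g a))"
  by (induction A rule: infinite_finite_induct) (simp_all add: lin_add lin_zero)

lemma matrix_comp:
  assumes f: "lin f" and B: "basis_of B UNIV"
  shows "representation B (f (g b)) a = (\<Sum>c\<in>B. representation B (f c) a * representation B (g b) c)"
proof -
  have "f (g b) = f (\<Sum>c\<in>B. scale (representation B (g b) c) c)"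
    using rep_expand[OF B] by simp
  also have "\<dots> = (\<Sum>c\<in>B. scale (representation B (g b) c) (f c))"
    by (simp add: lin_sum[OF f] lin_scale[OF f])
  finally show ?thesis by (simp add: rep_sum[OF B] rep_scale[OF B] mult.commute)
qed

lemma trace_comp_commute_on:
  assumes f: "lin f" and g: "lin g" and B: "basis_of B UNIV"
  shows "(\<Sum>b\<in>B. representation B (f (g b)) b) = (\<Sum>b\<in>B. representation B (g (f b)) b)"
proof -
  have "(\<Sum>b\<in>B. representation B (f (g b)) b)
      = (\<Sum>b\<in>B. \<Sum>c\<in>B. representation B (f c) b * representation B (g b) c)"
    by (rule sum.cong[OF refl], rule matrix_comp[OF f B])
  also have "\<dots> = (\<Sum>c\<in>B. \<Sum>b\<in>B. representation B (g b) c * representation B (f c) b)"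
    by (subst sum.swap) (simp add: mult.commute)
  also have "\<dots> = (\<Sum>c\<in>B. representation B (g (f c)) c)"
    by (rule sum.cong[OF refl], rule matrix_comp[OF g B, symmetric])
  finally show ?thesis .
qed

text \<open>Both diagonal sums expand to the same double sum over the two bases.\<close>

lemma trace_basis:
  assumes f: "lin f" and B: "basis_of B UNIV"
  shows "trace f = (\<Sum>b\<in>B. representation B (f b) b)"
proof -
  define C where "C = (SOME C. basis_of C UNIV)"
  have C: "basis_of C UNIV" unfolding C_def by (rule someI[of _ B]) (rule B)
  have "trace f = (\<Sum>c\<in>C. representation C (f c) c)" by (simp add: trace_def C_def Let_def)
  also have "\<dots> = (\<Sum>c\<in>C. \<Sum>b\<in>B. representation B c b * representation C (f b) c)"
  proof (rule sum.cong[OF refl])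
    fix c
    have "f c = f (\<Sum>b\<in>B. scale (representation B c b) b)" using rep_expand[OF B] by simp
    then show "representation C (f c) c = (\<Sum>b\<in>B. representation B c b * representation C (f b) c)"
      by (simp add: lin_sum[OF f] lin_scale[OF f] rep_sum[OF C] rep_scale[OF C])
  qed
  also have "\<dots> = (\<Sum>b\<in>B. \<Sum>c\<in>C. representation B c b * representation C (f b) c)"
    by (rule sum.swap)
  also have "\<dots> = (\<Sum>b\<in>B. representation B (f b) b)"
  proof (rule sum.cong[OF refl])
    fix b
    have "representation B (f b) b = representation B (\<Sum>c\<in>C. scale (representation C (f b) c) c) b"
      using rep_expand[OF C] by simp
    then show "(\<Sum>c\<in>C. representation B c b * representation C (f b) c) = representation B (f b) b"
      by (simp add: rep_sum[OF B] rep_scale[OF B] mult.commute)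
  qed
  finally show ?thesis .
qed

lemma basis_exists_UNIV: "basis_of some_basis UNIV"
  using some_basis by (simp add: basis_of_def)

lemma lin_comp: "lin f \<Longrightarrow> lin g \<Longrightarrow> lin (\<lambda>x. f (g x))"
  by (simp add: Vector_Spaces.linear_iff vector_space_axioms)
lemma lin_bracket: "lin (bracket x)" by (rule bracket_linear_right)
lemma lin_minus: "lin f \<Longrightarrow> lin g \<Longrightarrow> lin (\<lambda>x. f x - g x)"
  by (simp add: Vector_Spaces.linear_iff vector_space_axioms scale_right_diff_distrib algebra_simps)
lemma killing_basis:
  assumes "basis_of B UNIV"
  shows "killing x y = (\<Sum>b\<in>B. representation B (bracket x (bracket y b)) b)"
  unfolding killing_def o_def
  by (rule trace_basis[OF lin_comp[OF lin_bracket lin_bracket] assms])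

subsection \<open>The Killing form\<close>

lemma killing_add_left: "killing (x + y) z = killing x z + killing y z"
  by (simp add: killing_basis[OF basis_exists_UNIV] bracket_add_left rep_add[OF basis_exists_UNIV] sum.distrib)
lemma killing_add_right: "killing z (x + y) = killing z x + killing z y"
  by (simp add: killing_basis[OF basis_exists_UNIV] bracket_add_left bracket_add_right rep_add[OF basis_exists_UNIV] sum.distrib)
lemma killing_scale_left: "killing (scale c x) z = c * killing x z"
  by (simp add: killing_basis[OF basis_exists_UNIV] bracket_scale_left rep_scale[OF basis_exists_UNIV] sum_distrib_left)
lemma killing_scale_right: "killing z (scale c x) = c * killing z x"
  by (simp add: killing_basis[OF basis_exists_UNIV] bracket_scale_left bracket_scale_right rep_scale[OF basis_exists_UNIV] sum_distrib_left)
lemma killing_zero_left [simp]: "killing 0 x = 0"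
  using killing_scale_left[of 0 0 x] by simp
lemma killing_zero_right [simp]: "killing x 0 = 0"
  using killing_scale_right[of x 0 0] by simp
lemma killing_minus_left: "killing (- x) y = - killing x y"
  using killing_scale_left[of "-1" x y] by simp
lemma killing_minus_right: "killing x (- y) = - killing x y"
  using killing_scale_right[of x "-1" y] by simp
lemma killing_diff_left: "killing (x - y) z = killing x z - killing y z"
  using killing_add_left[of x "- y" z] by (simp add: killing_minus_left)
lemma killing_diff_right: "killing z (x - y) = killing z x - killing z y"
  using killing_add_right[of z x "- y"] by (simp add: killing_minus_right)
lemma killing_sum_left: "killing (sum f A) x = (\<Sum>a\<in>A. killing (f a) x)"
  by (induction A rule: infinite_finite_induct) (auto simp: killing_add_left)
lemma killing_sum_right: "killing x (sum f A) = (\<Sum>a\<in>A. killing x (f a))"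
  by (induction A rule: infinite_finite_induct) (auto simp: killing_add_right)

lemma killing_commute: "killing x y = killing y x"
  unfolding killing_basis[OF basis_exists_UNIV]
  by (rule trace_comp_commute_on[OF lin_bracket lin_bracket basis_exists_UNIV])

text \<open>Expanding both brackets, the two sides differ by the trace of \<open>ad y (ad x ad z)\<close> minus
  that of \<open>(ad x ad z) ad y\<close>, which is zero.\<close>

lemma killing_invariant: "killing (bracket x y) z = killing x (bracket y z)"
proof -
  have "(\<Sum>b\<in>some_basis. representation some_basis (bracket y (bracket x (bracket z b))) b)
      = (\<Sum>b\<in>some_basis. representation some_basis (bracket x (bracket z (bracket y b))) b)"
    by (rule trace_comp_commute_on[OF lin_bracket lin_comp[OF lin_bracket lin_bracket] basis_exists_UNIV])
  then show ?thesis
    by (simp add: killing_basis[OF basis_exists_UNIV] bracket_bracket_left bracket_diff_right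
        rep_diff[OF basis_exists_UNIV] sum_subtractf)
qed

end

section \<open>Generalized eigenspaces\<close>

context simple_lie_algebra
begin

definition shift :: "('g \<Rightarrow> 'g) \<Rightarrow> 'k \<Rightarrow> 'g \<Rightarrow> 'g" where
  "shift f c x = f x - scale c x"

definition geneig :: "('g \<Rightarrow> 'g) \<Rightarrow> 'k \<Rightarrow> 'g set" where
  "geneig f c = {x. \<exists>n. (shift f c ^^ n) x = 0}"

lemma lin_shift: "lin f \<Longrightarrow> lin (shift f c)"
  unfolding shift_def
  by (rule lin_minus) (auto simp: Vector_Spaces.linear_iff vector_space_axioms scale_right_distrib mult.commute)

lemma lin_funpow: "lin f \<Longrightarrow> lin (f ^^ n)"
  by (induction n) (auto simp: Vector_Spaces.linear_iff vector_space_axioms)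

lemma funpow_zero_mono:
  assumes "lin f" "(f ^^ n) x = 0" "n \<le> m"
  shows "(f ^^ m) x = 0"
proof -
  have "(f ^^ m) x = (f ^^ (m - n)) ((f ^^ n) x)"
    using assms(3) by (metis funpow_add le_add_diff_inverse2 o_apply)
  then show ?thesis using assms by (simp add: lin_zero[OF lin_funpow])
qed

lemma subspace_geneig:
  assumes "lin f"
  shows "subspace (geneig f c)"
proof (rule subspaceI)
  show "0 \<in> geneig f c" unfolding geneig_def by (auto intro: exI[of _ 0])
next
  fix x y assume "x \<in> geneig f c" "y \<in> geneig f c"
  then obtain n m where nm: "(shift f c ^^ n) x = 0" "(shift f c ^^ m) y = 0"
    unfolding geneig_def by auto
  note l = lin_shift[OF assms, of c]
  have "(shift f c ^^ (max n m)) (x + y) = 0"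
    using funpow_zero_mono[OF l nm(1), of "max n m"] funpow_zero_mono[OF l nm(2), of "max n m"]
    by (simp add: lin_add[OF lin_funpow[OF l]])
  then show "x + y \<in> geneig f c" unfolding geneig_def by blast
next
  fix a x assume "x \<in> geneig f c"
  then show "scale a x \<in> geneig f c"
    unfolding geneig_def by (auto simp: lin_scale[OF lin_funpow[OF lin_shift[OF assms]]])
qed

lemma geneig_shiftD: "shift f c x \<in> geneig f c \<Longrightarrow> x \<in> geneig f c"
proof -
  assume "shift f c x \<in> geneig f c"
  then obtain n where "(shift f c ^^ n) (shift f c x) = 0" unfolding geneig_def by auto
  then have "(shift f c ^^ Suc n) x = 0" by (simp add: funpow_swap1)
  then show "x \<in> geneig f c" unfolding geneig_def by blast
qed

text \<open>On a generalized eigenspace for \<open>d\<close> the operator \<open>f - c\<close> is \<open>(d -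
  c)\<close> plus a nilpotent operator; the preimage is built by recursion on the order of
  nilpotency, which keeps it inside \<open>W\<close>.\<close>

lemma shift_shift_surj:
  assumes f: "lin f" and W: "subspace W" "\<And>x. x \<in> W \<Longrightarrow> f x \<in> W" and cd: "c \<noteq> d"
  shows "(shift f d ^^ n) v = 0 \<Longrightarrow> v \<in> W \<Longrightarrow>
    \<exists>u. u \<in> W \<and> u \<in> geneig f d \<and> shift f c u = v"
proof (induction n arbitrary: v)
  case 0
  then have "v = 0" by simp
  then show ?case
    using subspace_0[OF W(1)] subspace_0[OF subspace_geneig[OF f]] lin_zero[OF lin_shift[OF f]]
    by (auto intro: exI[of _ 0])
next
  case (Suc n)
  have v': "shift f d v \<in> W" using W Suc.prems by (simp add: shift_def subspace_diff subspace_scale)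
  have "(shift f d ^^ n) (shift f d v) = 0" using Suc.prems by (simp add: funpow_swap1)
  from Suc.IH[OF this v'] obtain u where u: "u \<in> W" "u \<in> geneig f d" "shift f c u = shift f d v"
    by blast
  define w where "w = scale (inverse (d - c)) (v - u)"
  have v: "v \<in> geneig f d" using Suc.prems unfolding geneig_def by blast
  have "w \<in> W" using u Suc.prems W by (simp add: w_def subspace_diff subspace_scale)
  moreover have "w \<in> geneig f d"
    using u v subspace_geneig[OF f] by (simp add: w_def subspace_diff subspace_scale)
  moreover have "shift f c w = v"
  proof -
    have "shift f c (v - u) = shift f c v - shift f d v"
      using lin_add[OF lin_shift[OF f], of c "v - u" u] u(3) by (simp add: algebra_simps)
    also have "\<dots> = scale (d - c) v" by (simp add: shift_def scale_left_diff_distrib)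
    finally show ?thesis using cd by (simp add: w_def lin_scale[OF lin_shift[OF f]])
  qed
  ultimately show ?case by blast
qed

text \<open>If \<open>(f - c) w\<close> is a sum of generalized eigenvectors, then the components with
  eigenvalue other than \<open>c\<close> have preimages under \<open>f - c\<close>; subtracting
  these from \<open>w\<close> leaves a generalized eigenvector for \<open>c\<close>.\<close>

lemma split_geneig_aux:
  assumes f: "lin f" and W: "subspace W" "\<And>x. x \<in> W \<Longrightarrow> f x \<in> W"
  shows "foldr (shift f) cs w = 0 \<Longrightarrow> w \<in> W \<Longrightarrow> w \<in> span (\<Union>c. W \<inter> geneig f c)"
proof (induction cs arbitrary: w rule: rev_induct)
  case Nil
  then show ?case by (simp add: span_zero)
next
  case (snoc c cs)
  let ?S = "span (\<Union>c. W \<inter> geneig f c)"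
  note l = lin_shift[OF f]
  have WS: "shift f c x \<in> W" if "x \<in> W" for x
    using that W by (simp add: shift_def subspace_diff subspace_scale)
  have "foldr (shift f) cs (shift f c w) = 0" using snoc.prems by simp
  from snoc.IH[OF this WS[OF snoc.prems(2)]] have *: "shift f c w \<in> ?S" .
  have sub: "subspace (W \<inter> geneig f c)" using W subspace_geneig[OF f] by (simp add: subspace_inter)
  have SW: "?S \<subseteq> W" by (rule span_minimal) (use W in auto)
  have "\<exists>u\<in>?S. v - shift f c u \<in> W \<inter> geneig f c" if "v \<in> ?S" for v
    using that
  proof (induction rule: span_induct_alt)
    case base
    then show ?case using sub subspace_0 by (intro bexI[of _ 0]) (auto simp: lin_zero[OF l] span_zero)
  next
    case (step a x y)
    obtain u where u: "u \<in> ?S" "y - shift f c u \<in> W \<inter> geneig f c" using step.IH by blast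
    obtain d where d: "x \<in> W" "x \<in> geneig f d" using step.hyps by blast
    obtain t where t: "t \<in> ?S" "x - shift f c t \<in> W \<inter> geneig f c"
    proof (cases "d = c")
      case True
      then show ?thesis using d by (intro that[of 0]) (auto simp: span_zero lin_zero[OF l])
    next
      case False
      obtain n where "(shift f d ^^ n) x = 0" using d unfolding geneig_def by auto
      from shift_shift_surj[OF f W _ this d(1), of c] False
      obtain t where "t \<in> W" "t \<in> geneig f d" "shift f c t = x" by auto
      then show ?thesis using subspace_0[OF sub] by (intro that[of t]) (auto intro: span_base)
    qed
    have "scale a x + y - shift f c (scale a t + u) = scale a (x - shift f c t) + (y - shift f c u)"
      by (simp add: lin_add[OF l] lin_scale[OF l] scale_right_diff_distrib)
    also have "\<dots> \<in> W \<inter> geneig f c" using t u sub by (simp add: subspace_add subspace_scale del: Int_iff)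
    finally show ?case using t u by (intro bexI[of _ "scale a t + u"]) (auto simp: span_add span_scale)
  qed
  from this[OF *] obtain u where u: "u \<in> ?S" "shift f c w - shift f c u \<in> W \<inter> geneig f c" by blast
  have "shift f c (w - u) = shift f c w - shift f c u"
    using lin_add[OF l, of c "w - u" u] by (simp add: algebra_simps)
  then have "shift f c (w - u) \<in> geneig f c" using u by simp
  then have "w - u \<in> geneig f c" by (rule geneig_shiftD)
  moreover have "w - u \<in> W" using u SW snoc.prems W by (auto simp: subspace_diff)
  ultimately have "w - u \<in> ?S" by (auto intro: span_base)
  then show ?case using u span_add[of "w - u" _ u] by simp
qed

text \<open>The vector \<open>p(f) w\<close>, by the scheme of Horner.\<close>

definition polyact :: "('g \<Rightarrow> 'g) \<Rightarrow> 'k poly \<Rightarrow> 'g \<Rightarrow> 'g" where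
  "polyact f p w = fold_coeffs (\<lambda>a y. scale a w + f y) p 0"

lemma polyact_pCons: "lin f \<Longrightarrow> polyact f (pCons a p) w = scale a w + f (polyact f p w)"
  by (cases "a = 0 \<and> p = 0") (auto simp: polyact_def lin_zero)

lemma polyact_0 [simp]: "polyact f 0 w = 0"
  by (simp add: polyact_def)

lemma polyact_add: "lin f \<Longrightarrow> polyact f (p + q) w = polyact f p w + polyact f q w"
  by (induction p q rule: poly_induct2) (simp_all add: polyact_pCons scale_left_distrib lin_add)

lemma polyact_smult: "lin f \<Longrightarrow> polyact f (smult a p) w = scale a (polyact f p w)"
  by (induction p) (simp_all add: polyact_pCons scale_right_distrib lin_scale)

lemma polyact_sum: "lin f \<Longrightarrow> polyact f (sum g A) w = (\<Sum>a\<in>A. polyact f (g a) w)"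
  by (induction A rule: infinite_finite_induct) (simp_all add: polyact_add)

lemma polyact_monom: "lin f \<Longrightarrow> polyact f (monom a n) w = scale a ((f ^^ n) w)"
  by (induction n) (simp_all add: monom_0 monom_Suc polyact_pCons lin_scale lin_zero)

lemma polyact_linear_factor: "lin f \<Longrightarrow> polyact f ([:- c, 1:] * p) w = shift f c (polyact f p w)"
  using polyact_add[of f "smult (- c) p" "pCons 0 p" w]
  by (simp add: polyact_pCons polyact_smult shift_def del: smult_minus_left)

text \<open>The vectors \<open>w, f w, f\<^sup>2 w, \<dots>\<close> cannot all be different and linearly
  independent.\<close>

lemma polyact_annihilates:
  assumes f: "lin f"
  shows "\<exists>p. p \<noteq> 0 \<and> polyact f p w = 0"
proof -
  let ?N = "card some_basis"
  let ?v = "\<lambda>i. (f ^^ i) w"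
  show ?thesis
  proof (cases "inj_on ?v {..?N}")
    case False
    then obtain i j where ij: "i \<noteq> j" "?v i = ?v j" by (auto simp: inj_on_def)
    let ?p = "monom 1 i + monom (-1) j :: 'k poly"
    have "coeff ?p i = 1" using ij by simp
    then have "?p \<noteq> 0" by (metis coeff_0 zero_neq_one)
    moreover have "polyact f ?p w = 0" using ij by (simp add: polyact_add[OF f] polyact_monom[OF f])
    ultimately show ?thesis by blast
  next
    case True
    have "card (?v ` {..?N}) > ?N" using True by (simp add: card_image)
    then have "dependent (?v ` {..?N})"
      using independent_card_le_dim[of "?v ` {..?N}" UNIV] by (auto simp: dim_UNIV)
    then obtain u where u: "\<exists>v\<in>?v ` {..?N}. u v \<noteq> 0" "(\<Sum>v\<in>?v ` {..?N}. scale (u v) v) = 0"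
      using dependent_finite[of "?v ` {..?N}"] by auto
    then obtain k where k: "k \<le> ?N" "u (?v k) \<noteq> 0" by auto
    let ?p = "\<Sum>i\<le>?N. monom (u (?v i)) i"
    have "coeff ?p k = u (?v k)" using k by (simp add: coeff_sum)
    then have "?p \<noteq> 0" using k by (metis coeff_0)
    moreover have "polyact f ?p w = (\<Sum>i\<le>?N. scale (u (?v i)) (?v i))"
      by (simp add: polyact_sum[OF f] polyact_monom[OF f])
    moreover have "\<dots> = 0" using u(2) by (simp add: sum.reindex[OF True] o_def)
    ultimately show ?thesis by metis
  qed
qed

text \<open>The annihilating polynomial splits into linear factors over an algebraically closed field.\<close>

lemma shifts_annihilate:
  assumes f: "lin f"
  shows "\<exists>cs. foldr (shift f) cs w = 0"
proof -
  obtain p where p: "p \<noteq> 0" "polyact f p w = 0" using polyact_annihilates[OF f] by blast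
  obtain A where A: "p = smult (lead_coeff p) (\<Prod>x\<in>#A. [:-x, 1:])"
    using alg_closed_imp_factorization[OF p(1)] by blast
  have "\<exists>cs. polyact f (\<Prod>x\<in>#A. [:-x, 1:]) w = foldr (shift f) cs w"
  proof (induction A)
    case empty
    show ?case using polyact_monom[OF f, of 1 0 w] by (intro exI[of _ "[]"]) (simp add: monom_0 one_pCons)
  next
    case (add x A)
    then obtain cs where cs: "polyact f (\<Prod>x\<in>#A. [:-x, 1:]) w = foldr (shift f) cs w" by blast
    have "polyact f (\<Prod>x\<in>#add_mset x A. [:-x, 1:]) w = foldr (shift f) (x # cs) w"
      using polyact_linear_factor[OF f, of x "\<Prod>x\<in>#A. [:-x, 1:]" w] cs by simp
    then show ?case by blast
  qed
  then obtain cs where "polyact f (\<Prod>x\<in>#A. [:-x, 1:]) w = foldr (shift f) cs w" by blast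
  moreover have "scale (lead_coeff p) (polyact f (\<Prod>x\<in>#A. [:-x, 1:]) w) = 0"
    using p(2) A polyact_smult[OF f] by metis
  ultimately have "foldr (shift f) cs w = 0" using p(1) by simp
  then show ?thesis by blast
qed

lemma split_geneig:
  assumes "lin f" "subspace W" "\<And>x. x \<in> W \<Longrightarrow> f x \<in> W"
  shows "W \<subseteq> span (\<Union>c. W \<inter> geneig f c)"
  using split_geneig_aux[OF assms] shifts_annihilate[OF assms(1)] by blast

text \<open>The operator \<open>ad h - (c + d)\<close> acts on \<open>[x, y]\<close> as \<open>ad h - c\<close>
  on \<open>x\<close> plus \<open>ad h - d\<close> on \<open>y\<close>, so a sufficiently high power
  of it kills the bracket.\<close>

lemma bracket_geneig:
  assumes "x \<in> geneig (bracket h) c" "y \<in> geneig (bracket h) d"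
  shows "bracket x y \<in> geneig (bracket h) (c + d)"
proof -
  let ?s = "shift (bracket h)"
  note l = lin_shift[OF lin_bracket]
  have "(?s c ^^ n) x = 0 \<Longrightarrow> (?s d ^^ m) y = 0 \<Longrightarrow> (?s (c + d) ^^ (n + m)) (bracket x y) = 0" for n m
  proof (induction "n + m" arbitrary: n m x y)
    case 0
    then show ?case by simp
  next
    case (Suc k)
    have eq: "?s (c + d) (bracket x y) = bracket (?s c x) y + bracket x (?s d y)"
      by (simp add: shift_def bracket_derivation[of h x y] bracket_diff_left bracket_diff_right
          bracket_scale_left bracket_scale_right scale_left_distrib)
    have 1: "(?s (c + d) ^^ k) (bracket (?s c x) y) = 0"
    proof (cases n)
      case 0
      then have "x = 0" using Suc.prems by simp
      then show ?thesis by (simp add: shift_def lin_zero[OF lin_funpow[OF l]])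
    next
      case (Suc n')
      show ?thesis
        using Suc.hyps(1)[of n' m "?s c x" y] Suc.hyps(2) Suc.prems Suc by (simp add: funpow_swap1)
    qed
    have 2: "(?s (c + d) ^^ k) (bracket x (?s d y)) = 0"
    proof (cases m)
      case 0
      then have "y = 0" using Suc.prems by simp
      then show ?thesis by (simp add: shift_def lin_zero[OF lin_funpow[OF l]])
    next
      case (Suc m')
      show ?thesis
        using Suc.hyps(1)[of n m' x "?s d y"] Suc.hyps(2) Suc.prems Suc by (simp add: funpow_swap1)
    qed
    have "(?s (c + d) ^^ (n + m)) (bracket x y) = (?s (c + d) ^^ k) (?s (c + d) (bracket x y))"
      by (simp add: Suc.hyps(2)[symmetric] funpow_swap1)
    then show ?case using 1 2 by (simp add: eq lin_add[OF lin_funpow[OF l]])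
  qed
  then show ?thesis using assms unfolding geneig_def by blast
qed

end

section \<open>Weights of a Cartan subalgebra\<close>

context cartan_simple_lie_algebra
begin

lemma T_subspace: "subspace T"
  using cartan by (simp add: cartan_subalgebra_def subalgebra_def)
lemma T_bracket: "x \<in> T \<Longrightarrow> y \<in> T \<Longrightarrow> bracket x y \<in> T"
  using cartan by (simp add: cartan_subalgebra_def subalgebra_def)
lemma T_selfnormalizing: "(\<And>y. y \<in> T \<Longrightarrow> bracket x y \<in> T) \<Longrightarrow> x \<in> T"
  using cartan by (auto simp: cartan_subalgebra_def normalizer_def)
lemma T_nilpotent: "\<exists>n. lower_central T n = {0}"
  using cartan by (simp add: cartan_subalgebra_def)

lemma lower_central_subset: "lower_central T n \<subseteq> T"
proof (induction n)
  case (Suc n)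
  then have "{bracket x y |x y. x \<in> T \<and> y \<in> lower_central T n} \<subseteq> T" by (auto intro: T_bracket)
  then show ?case using span_minimal[OF _ T_subspace] by simp
qed simp

definition T_invariant :: "'g set \<Rightarrow> bool" where
  "T_invariant W \<longleftrightarrow> subspace W \<and> (\<forall>h\<in>T. \<forall>x\<in>W. bracket h x \<in> W)"

lemma T_invariant_shift: "T_invariant W \<Longrightarrow> h \<in> T \<Longrightarrow> x \<in> W \<Longrightarrow> (shift (bracket h) c ^^ n) x \<in> W"
  by (induction n) (auto simp: T_invariant_def shift_def subspace_diff subspace_scale)

lemma T_invariant_T: "T_invariant T"
  by (simp add: T_invariant_def T_subspace T_bracket)

lemma T_geneig_0:
  assumes "h \<in> T" "t \<in> T"
  shows "t \<in> geneig (bracket h) 0"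
proof -
  have "(bracket h ^^ n) t \<in> lower_central T n" for n
  proof (induction n)
    case (Suc n)
    then show ?case using assms by (auto intro!: span_base)
  qed (use assms in simp)
  moreover have "shift (bracket h) 0 = bracket h" by (simp add: shift_def fun_eq_iff)
  moreover obtain n where "lower_central T n = {0}" using T_nilpotent by blast
  ultimately have "\<exists>n. (shift (bracket h) 0 ^^ n) t = 0" by (metis singletonD)
  then show ?thesis by (simp add: geneig_def)
qed

lemma T_invariant_geneig:
  assumes "h \<in> T" "T_invariant W"
  shows "T_invariant (W \<inter> geneig (bracket h) c)"
  using assms bracket_geneig[OF T_geneig_0, of h _ _ c]
  by (auto simp: T_invariant_def subspace_geneig[OF lin_bracket] subspace_inter)

text \<open>The generalized weight space: every \<open>h\<close> in \<open>T\<close> has the single generalized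
  eigenvalue \<open>\<xi> h\<close>. Weights are normalised to vanish outside \<open>T\<close>
  (\<open>supported\<close>), in accordance with the encoding of the dual space.\<close>

definition gws :: "('g \<Rightarrow> 'k) \<Rightarrow> 'g set" where
  "gws \<xi> = {x. \<forall>h\<in>T. x \<in> geneig (bracket h) (\<xi> h)}"

definition supported :: "('g \<Rightarrow> 'k) \<Rightarrow> bool" where
  "supported \<xi> \<longleftrightarrow> (\<forall>x. x \<notin> T \<longrightarrow> \<xi> x = 0)"

lemma subspace_gws: "subspace (gws \<xi>)"
proof -
  have "gws \<xi> = (\<Inter>h\<in>T. geneig (bracket h) (\<xi> h))" by (auto simp: gws_def)
  then show ?thesis using subspace_Int[of T "\<lambda>h. geneig (bracket h) (\<xi> h)"]
    by (simp add: subspace_geneig[OF lin_bracket])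
qed

lemma gws_bracket: "x \<in> gws \<xi> \<Longrightarrow> y \<in> gws \<mu> \<Longrightarrow> bracket x y \<in> gws (\<xi> + \<mu>)"
  unfolding gws_def by (auto intro: bracket_geneig)

lemma T_gws_0: "T \<subseteq> gws 0"
  unfolding gws_def using T_geneig_0 by auto

lemma T_invariant_gws: "T_invariant (gws \<xi>)"
  unfolding T_invariant_def using gws_bracket[of _ 0 _ \<xi>] T_gws_0 subspace_gws by auto

lemma gws_nilpotent: "x \<in> gws \<xi> \<Longrightarrow> h \<in> T \<Longrightarrow> \<exists>n. (shift (bracket h) (\<xi> h) ^^ n) x = 0"
  unfolding gws_def geneig_def by blast

text \<open>An invariant subspace on which some \<open>h\<close> has two eigenvalues is the sum of its smaller
  generalized eigenspaces, which are again invariant because \<open>T\<close> is nilpotent; if every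
  \<open>h\<close> has just one eigenvalue, the subspace lies in a weight space.\<close>

lemma gws_decomposition_invariant:
  "T_invariant W \<Longrightarrow> W \<subseteq> span (\<Union>\<xi>\<in>Collect supported. W \<inter> gws \<xi>)"
proof (induction "dim W" arbitrary: W rule: less_induct)
  case less
  show ?case
  proof (cases "\<forall>h\<in>T. \<exists>c. W \<subseteq> geneig (bracket h) c")
    case True
    then obtain c where c: "\<And>h. h \<in> T \<Longrightarrow> W \<subseteq> geneig (bracket h) (c h)" by metis
    define \<xi> where "\<xi> = (\<lambda>h. if h \<in> T then c h else 0)"
    have "supported \<xi>" by (simp add: supported_def \<xi>_def)
    moreover have "W \<subseteq> gws \<xi>" using c by (auto simp: gws_def \<xi>_def)
    ultimately show ?thesis by (auto intro!: span_base)
  next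
    case False
    then obtain h where h: "h \<in> T" "\<And>c. \<not> W \<subseteq> geneig (bracket h) c" by blast
    have W: "subspace W" using less.prems by (simp add: T_invariant_def)
    let ?R = "span (\<Union>\<xi>\<in>Collect supported. W \<inter> gws \<xi>)"
    have "W \<inter> geneig (bracket h) c \<subseteq> ?R" for c
    proof -
      let ?V = "W \<inter> geneig (bracket h) c"
      have V: "T_invariant ?V" by (rule T_invariant_geneig[OF h(1) less.prems])
      have "?V \<subset> W" using h(2)[of c] by blast
      moreover have "span ?V = ?V" "span W = W" using V W by (simp_all add: T_invariant_def)
      ultimately have "dim ?V < dim W" by (metis dim_psubset)
      from less.hyps[OF this V]
      have "?V \<subseteq> span (\<Union>\<xi>\<in>Collect supported. ?V \<inter> gws \<xi>)" .
      also have "\<dots> \<subseteq> ?R" by (rule span_mono) blast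
      finally show ?thesis .
    qed
    then have "span (\<Union>c. W \<inter> geneig (bracket h) c) \<subseteq> ?R" by (intro span_minimal) auto
    moreover have "W \<subseteq> span (\<Union>c. W \<inter> geneig (bracket h) c)"
      by (rule split_geneig[OF lin_bracket W]) (use less.prems h in \<open>auto simp: T_invariant_def\<close>)
    ultimately show ?thesis by blast
  qed
qed

lemma gws_decomposition: "span (\<Union>\<xi>\<in>Collect supported. gws \<xi>) = UNIV"
  using gws_decomposition_invariant[of UNIV] by (auto simp: T_invariant_def)

text \<open>Two different weights differ at some \<open>h\<close>, and a power of \<open>ad h - \<mu> h\<close>
  removes the \<open>\<mu>\<close> component of a vanishing sum while being injective on the other
  weight space.\<close>

lemma gws_direct:
  assumes "finite F"
  shows "F \<subseteq> Collect supported \<Longrightarrow> (\<And>\<xi>. \<xi> \<in> F \<Longrightarrow> x \<xi> \<in> gws \<xi>) \<Longrightarrow> (\<Sum>\<xi>\<in>F. x \<xi>) = 0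
    \<Longrightarrow> \<forall>\<xi>\<in>F. x \<xi> = 0"
  using assms
proof (induction F arbitrary: x rule: finite_induct)
  case empty
  then show ?case by simp
next
  case (insert \<mu> F)
  have "x \<xi> = 0" if xiF: "\<xi> \<in> F" for \<xi>
  proof -
    have "\<xi> \<noteq> \<mu>" using that insert.hyps by auto
    then obtain h where h: "\<xi> h \<noteq> \<mu> h" by (auto simp: fun_eq_iff)
    have "supported \<xi>" "supported \<mu>" using insert.prems(1) that by auto
    then have hT: "h \<in> T" using h by (metis supported_def)
    let ?s = "shift (bracket h) (\<mu> h)"
    obtain n where n: "(?s ^^ n) (x \<mu>) = 0"
      using gws_nilpotent[OF insert.prems(2)[of \<mu>] hT] by auto
    note l = lin_funpow[OF lin_shift[OF lin_bracket[of h]]]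
    have "(\<Sum>\<nu>\<in>F. (?s ^^ n) (x \<nu>)) = (?s ^^ n) (\<Sum>\<nu>\<in>insert \<mu> F. x \<nu>)"
      using insert.hyps n by (simp add: lin_add[OF l] lin_sum[OF l])
    also have "\<dots> = 0" using insert.prems(3) by (simp add: lin_zero[OF l])
    finally have "\<forall>\<nu>\<in>F. (?s ^^ n) (x \<nu>) = 0"
      using insert.IH[of "\<lambda>\<nu>. (?s ^^ n) (x \<nu>)"] insert.prems(1,2)
        T_invariant_shift[OF T_invariant_gws hT] by auto
    then have 1: "(?s ^^ n) (x \<xi>) = 0" using that by blast
    obtain m where 2: "(shift (bracket h) (\<xi> h) ^^ m) (x \<xi>) = 0"
      using gws_nilpotent[OF insert.prems(2)[of \<xi>] hT] xiF by auto
    have inj: "y = 0" if "?s y = 0" "(shift (bracket h) (\<xi> h) ^^ k) y = 0" for y k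
      using that(2)
    proof (induction k)
      case (Suc k)
      have "bracket h y = scale (\<mu> h) y" using that(1) by (simp add: shift_def)
      then have e: "shift (bracket h) (\<xi> h) y = scale (\<mu> h - \<xi> h) y"
        by (simp add: shift_def scale_left_diff_distrib)
      have "(shift (bracket h) (\<xi> h) ^^ k) (shift (bracket h) (\<xi> h) y) = 0"
        using Suc.prems by (simp add: funpow_swap1)
      then have "(shift (bracket h) (\<xi> h) ^^ k) y = 0"
        unfolding e using h by (simp add: lin_scale[OF lin_funpow[OF lin_shift[OF lin_bracket[of h]]]])
      then show ?case by (rule Suc.IH)
    qed simp
    show ?thesis
      using 1
    proof (induction n)
      case (Suc n)
      have "shift (bracket h) (\<xi> h) (?s y) = ?s (shift (bracket h) (\<xi> h) y)" for y
        by (simp add: shift_def bracket_diff_right bracket_scale_right scale_right_diff_distrib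
            mult.commute algebra_simps)
      then have comm: "(shift (bracket h) (\<xi> h) ^^ m) (?s y) = ?s ((shift (bracket h) (\<xi> h) ^^ m) y)" for y m
        by (induction m) simp_all
      have comm': "(shift (bracket h) (\<xi> h) ^^ m) ((?s ^^ n) y) = (?s ^^ n) ((shift (bracket h) (\<xi> h) ^^ m) y)" for y n
        by (induction n) (simp_all add: comm)
      have "(?s ^^ n) (x \<xi>) = 0"
        by (rule inj[of _ m]) (use Suc.prems 2 in \<open>simp_all add: comm' lin_zero[OF lin_funpow[OF lin_shift[OF lin_bracket[of h]]]]\<close>)
      then show ?case by (rule Suc.IH)
    qed simp
  qed
  moreover from this have "x \<mu> = 0" using insert.prems(3) insert.hyps by simp
  ultimately show ?case by blast
qed

text \<open>A form of the theorems of Engel and Lie for the nilpotent algebra \<open>T\<close>: if each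
  \<open>h\<close> acts on \<open>W/A\<close> with the single generalized eigenvalue \<open>\<xi>
  h\<close>, then \<open>W/A\<close> contains a common eigenvector. On a minimal invariant
  \<open>U\<close> between \<open>A\<close> and \<open>W\<close> all of \<open>T\<close> acts by
  scalars modulo \<open>A\<close>. This is shown for the terms of the lower central series, the last
  one first: the vectors of \<open>U\<close> on which \<open>c\<close> acts as \<open>\<xi>
  c\<close> modulo \<open>A\<close> form an invariant subspace strictly above \<open>A\<close>,
  hence all of \<open>U\<close>.\<close>

lemma weight_vector_modulo:
  assumes A: "T_invariant A" and W: "T_invariant W" and AW: "A \<subset> W"
    and nil: "\<And>h x. h \<in> T \<Longrightarrow> x \<in> W \<Longrightarrow> \<exists>n. (shift (bracket h) (\<xi> h) ^^ n) x \<in> A"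
  shows "\<exists>u\<in>W - A. \<forall>h\<in>T. bracket h u - scale (\<xi> h) u \<in> A"
proof -
  let ?s = "\<lambda>h. shift (bracket h) (\<xi> h)"
  define Q where "Q U \<longleftrightarrow> T_invariant U \<and> A \<subset> U \<and> U \<subseteq> W" for U
  obtain U where U: "Q U" and min: "\<And>V. Q V \<Longrightarrow> dim U \<le> dim V"
    using ex_has_least_nat[of Q W dim] W AW by (auto simp: Q_def)
  have Us: "subspace U" and UT: "T_invariant U" and AU: "A \<subset> U" and UW: "U \<subseteq> W"
    using U by (auto simp: Q_def T_invariant_def)
  have As: "subspace A" using A by (simp add: T_invariant_def)
  note sU = T_invariant_shift[OF UT] and sA = T_invariant_shift[OF A]
  have sU1: "?s h x \<in> U" if "h \<in> T" "x \<in> U" for h x using sU[OF that, where n=1] by simp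
  have sA1: "?s h x \<in> A" if "h \<in> T" "x \<in> A" for h x using sA[OF that, where n=1] by simp
  have ex_last: "\<exists>v\<in>U - A. ?s h v \<in> A" if hT: "h \<in> T" for h
  proof -
    obtain u where u: "u \<in> U" "u \<notin> A" using AU by blast
    then obtain n where "(?s h ^^ n) u \<in> A" using nil[OF hT] UW by blast
    then have n: "(?s h ^^ (LEAST n. (?s h ^^ n) u \<in> A)) u \<in> A" by (rule LeastI)
    obtain m where m: "(LEAST n. (?s h ^^ n) u \<in> A) = Suc m" using n u by (cases "LEAST n. (?s h ^^ n) u \<in> A") auto
    have "(?s h ^^ m) u \<notin> A" using not_less_Least[of m "\<lambda>n. (?s h ^^ n) u \<in> A"] m by simp
    then show ?thesis using n m sU[OF hT u(1)] by (intro bexI[of _ "(?s h ^^ m) u"]) auto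
  qed
  obtain N where N: "lower_central T N = {0}" using T_nilpotent by blast
  define P where "P k \<longleftrightarrow> (\<forall>c\<in>lower_central T k. \<forall>u\<in>U. ?s c u \<in> A)" for k
  have PN: "P N"
  proof -
    have "0 \<in> T" using T_subspace subspace_0 by blast
    from ex_last[OF this] obtain v where v: "v \<in> U" "v \<notin> A" "?s 0 v \<in> A" by auto
    have "\<xi> 0 = 0"
    proof (rule ccontr)
      assume ne: "\<xi> 0 \<noteq> 0"
      have "scale (- inverse (\<xi> 0)) (?s 0 v) \<in> A" by (rule subspace_scale[OF As v(3)])
      then show False using v ne by (simp add: shift_def)
    qed
    then show ?thesis using N As by (simp add: P_def shift_def subspace_0)
  qed
  have step: "P k" if Pk: "P (Suc k)" for k
    unfolding P_def
  proof
    fix c assume c: "c \<in> lower_central T k"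
    then have cT: "c \<in> T" using lower_central_subset by blast
    \<comment> \<open>if the scalar by which \<open>[t, c]\<close> acts were nonzero, the powers of \<open>t - \<xi> t\<close> would never carry \<open>v\<close> into \<open>A\<close>\<close>
    have eps: "\<xi> (bracket t c) = 0" and zU: "\<And>y. y \<in> U \<Longrightarrow> ?s (bracket t c) y \<in> A" if tT: "t \<in> T" for t
    proof -
      define z where "z = bracket t c"
      have z: "z \<in> lower_central T (Suc k)" using c tT by (auto simp: z_def intro!: span_base)
      show zU: "\<And>y. y \<in> U \<Longrightarrow> ?s (bracket t c) y \<in> A" using Pk z by (auto simp: P_def z_def)
      obtain v where v: "v \<in> U" "v \<notin> A" "?s c v \<in> A" using ex_last[OF cT] by auto
      have comm: "?s c (?s t y) = ?s t (?s c y) - ?s z y - scale (\<xi> z) y" for y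
        unfolding z_def shift_def bracket_bracket_left
        by (simp add: bracket_diff_right bracket_scale_right scale_right_diff_distrib mult.commute algebra_simps)
      have cl: "?s c (?s t ((?s t ^^ j) v)) + scale (of_nat (Suc j) * \<xi> z) ((?s t ^^ j) v) \<in> A" for j
      proof (induction j)
        case 0
        have "?s t (?s c v) - ?s z v \<in> A" using v zU sA1[OF tT v(3)] As by (simp add: z_def subspace_diff)
        then show ?case by (simp add: comm)
      next
        case (Suc j)
        let ?y = "(?s t ^^ Suc j) v"
        have yU: "?y \<in> U" by (rule sU[OF tT v(1)])
        have 1: "?s t (?s c ?y + scale (of_nat (Suc j) * \<xi> z) ((?s t ^^ j) v)) \<in> A"
          using sA1[OF tT Suc.IH] by simp
        have "?s c (?s t ?y) + scale (of_nat (Suc (Suc j)) * \<xi> z) ?y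
            = ?s t (?s c ?y + scale (of_nat (Suc j) * \<xi> z) ((?s t ^^ j) v)) - ?s z ?y"
        proof -
          have "of_nat (Suc (Suc j)) * \<xi> z = of_nat (Suc j) * \<xi> z + \<xi> z" by (simp add: algebra_simps)
          then show ?thesis
            unfolding comm
            by (simp add: lin_add[OF lin_shift[OF lin_bracket]] lin_scale[OF lin_shift[OF lin_bracket]]
                scale_left_distrib del: of_nat_Suc)
        qed
        also have "\<dots> \<in> A" using 1 zU[OF yU] As by (simp only: z_def subspace_diff)
        finally show ?case .
      qed
      show "\<xi> (bracket t c) = 0"
      proof (rule ccontr)
        assume ne: "\<xi> (bracket t c) \<noteq> 0"
        have "(?s t ^^ j) v \<notin> A" for j
        proof (induction j)
          case (Suc j)
          show ?case
          proof
            assume a: "(?s t ^^ Suc j) v \<in> A"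
            from sA1[OF cT this] have "?s c (?s t ((?s t ^^ j) v)) \<in> A" by simp
            from subspace_diff[OF As cl[of j] this]
            have "scale (of_nat (Suc j) * \<xi> z) ((?s t ^^ j) v) \<in> A" by simp
            from subspace_scale[OF As this, of "inverse (of_nat (Suc j) * \<xi> z)"]
            moreover have "of_nat (Suc j) * \<xi> z \<noteq> 0" using ne by (simp add: z_def del: of_nat_Suc)
            ultimately have "(?s t ^^ j) v \<in> A"
              by (metis scale_scale left_inverse scale_one)
            then show False using Suc.IH by simp
          qed
        qed (use v in simp)
        moreover obtain n where "(?s t ^^ n) v \<in> A" using nil[OF tT] v UW by blast
        ultimately show False by blast
      qed
    qed
    define U' where "U' = {u \<in> U. ?s c u \<in> A}"
    note lc = lin_shift[OF lin_bracket[of c], of "\<xi> c"]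
    have U's: "subspace U'"
      unfolding U'_def
      by (rule subspaceI) (simp_all add: lin_zero[OF lc] lin_add[OF lc] lin_scale[OF lc] subspace_0[OF As]
          subspace_0[OF Us] subspace_add[OF As] subspace_add[OF Us] subspace_scale[OF As] subspace_scale[OF Us])
    have "bracket t u \<in> U'" if t: "t \<in> T" and u: "u \<in> U'" for t u
    proof -
      have uU: "u \<in> U" and cu: "?s c u \<in> A" using u by (auto simp: U'_def)
      have "?s c (bracket t u) = bracket t (?s c u) - ?s (bracket t c) u"
        using eps[OF t] unfolding shift_def bracket_bracket_left
        by (simp add: bracket_diff_right bracket_scale_right)
      also have "\<dots> \<in> A" using A t cu zU[OF t uU] by (simp add: T_invariant_def subspace_diff)
      finally show ?thesis using UT t uU by (simp add: U'_def T_invariant_def)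
    qed
    then have "T_invariant U'" using U's by (simp add: T_invariant_def)
    moreover have "A \<subseteq> U'" using AU sA1[OF cT] by (auto simp: U'_def)
    moreover have "A \<noteq> U'" using ex_last[OF cT] by (auto simp: U'_def)
    moreover have "U' \<subseteq> U" by (auto simp: U'_def)
    ultimately have "Q U'" using UW by (auto simp: Q_def)
    from min[OF this] have "\<not> dim U' < dim U" by simp
    then have "U' = U" using \<open>U' \<subseteq> U\<close> U's Us dim_psubset[of U' U] by (auto simp: span_eq_iff[THEN iffD2])
    then show "\<forall>u\<in>U. ?s c u \<in> A" by (auto simp: U'_def)
  qed
  have "P 0" using PN step by (induction N) auto
  moreover obtain u where "u \<in> U" "u \<notin> A" using AU by blast
  ultimately show ?thesis using UW by (auto simp: P_def shift_def)
qed

text \<open>Otherwise \<open>T\<close> would annihilate a nonzero vector of \<open>gws 0\<close> modulo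
  \<open>T\<close>, and this vector would normalize \<open>T\<close>.\<close>

lemma gws_0: "gws 0 = T"
proof (rule ccontr)
  assume "gws 0 \<noteq> T"
  then have "T \<subset> gws 0" using T_gws_0 by blast
  moreover have "\<exists>n. (shift (bracket h) (0 h) ^^ n) x \<in> T" if "h \<in> T" "x \<in> gws 0" for h x
    using gws_nilpotent[OF that(2,1)] subspace_0[OF T_subspace] by metis
  ultimately have "\<exists>u\<in>gws 0 - T. \<forall>h\<in>T. bracket h u - scale (0 h) u \<in> T"
    by (intro weight_vector_modulo T_invariant_T T_invariant_gws)
  then obtain u where u: "u \<notin> T" "\<And>h. h \<in> T \<Longrightarrow> bracket h u \<in> T"
    by auto
  have "bracket u y \<in> T" if "y \<in> T" for y
    using u(2)[OF that] bracket_anti[of u y] subspace_neg[OF T_subspace] by simp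
  then show False using u(1) T_selfnormalizing by blast
qed

text \<open>Read off from a common eigenvector in the weight space.\<close>

lemma weight_linear:
  assumes "gws \<xi> \<noteq> {0}"
  shows "h \<in> T \<Longrightarrow> h' \<in> T \<Longrightarrow> \<xi> (h + h') = \<xi> h + \<xi> h'"
    and "h \<in> T \<Longrightarrow> \<xi> (scale c h) = c * \<xi> h"
    and "h \<in> T \<Longrightarrow> h' \<in> T \<Longrightarrow> \<xi> (bracket h h') = 0"
proof -
  have "{0} \<subset> gws \<xi>" using assms subspace_0[OF subspace_gws] by auto
  from weight_vector_modulo[OF _ T_invariant_gws this, of \<xi>] gws_nilpotent[of _ \<xi>]
  obtain u where u: "u \<noteq> 0" "\<And>h. h \<in> T \<Longrightarrow> bracket h u = scale (\<xi> h) u"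
    by (auto simp: T_invariant_def)
  show "\<xi> (h + h') = \<xi> h + \<xi> h'" if "h \<in> T" "h' \<in> T"
  proof -
    have "scale (\<xi> (h + h')) u = scale (\<xi> h + \<xi> h') u"
      using that u(2)[of "h + h'"] by (simp add: subspace_add[OF T_subspace] bracket_add_left u(2) scale_left_distrib)
    then show ?thesis using u(1) by simp
  qed
  show "\<xi> (scale c h) = c * \<xi> h" if "h \<in> T"
  proof -
    have "scale (\<xi> (scale c h)) u = scale (c * \<xi> h) u"
      using that u(2)[of "scale c h", symmetric] by (simp add: subspace_scale[OF T_subspace] bracket_scale_left u(2))
    then show ?thesis using u(1) by (simp only: scale_cancel_right) simp
  qed
  show "\<xi> (bracket h h') = 0" if "h \<in> T" "h' \<in> T"
  proof -
    have "scale (\<xi> (bracket h h')) u = 0"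
      using that u(2)[of "bracket h h'"]
      by (simp add: T_bracket bracket_bracket_left u(2) bracket_scale_right mult.commute)
    then show ?thesis using u(1) by simp
  qed
qed

lemma bracket_span_invariant:
  assumes "\<And>b. b \<in> S \<Longrightarrow> bracket h b \<in> span S" "x \<in> span S"
  shows "bracket h x \<in> span S"
  using assms(2)
  by (induction rule: span_induct_alt)
    (auto simp: bracket_add_right bracket_scale_right span_zero span_add span_scale assms(1))

text \<open>A basis of weight vectors on which \<open>T\<close> acts triangularly. Instead of an ordering, each
  basis vector carries a set \<open>S\<close> of further basis vectors with invariant span, modulo
  which it is an eigenvector of \<open>T\<close>. Diagonal entries of products of elements of
  \<open>T\<close> are then products of weights.\<close>

definition weight_basis :: "'g set \<Rightarrow> ('g \<Rightarrow> 'g \<Rightarrow> 'k) \<Rightarrow> bool" where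
  "weight_basis B w \<longleftrightarrow> basis_of B UNIV \<and> (\<forall>b\<in>B. supported (w b) \<and> b \<in> gws (w b) \<and>
     (\<exists>S\<subseteq>B - {b}. T_invariant (span S) \<and> (\<forall>h\<in>T. bracket h b - scale (w b h) b \<in> span S)))"

text \<open>A triangular family of maximal size spans everything: if a weight space were not contained in its
  span, an eigenvector modulo the span would extend it.\<close>

lemma weight_basis_exists: "\<exists>B w. weight_basis B w"
proof -
  define good where "good B \<longleftrightarrow> independent B \<and> T_invariant (span B) \<and>
    (\<forall>b\<in>B. \<exists>\<xi>. supported \<xi> \<and> b \<in> gws \<xi> \<and>
     (\<exists>S\<subseteq>B - {b}. T_invariant (span S) \<and> (\<forall>h\<in>T. bracket h b - scale (\<xi> h) b \<in> span S)))" for B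
  have "good {}" by (auto simp: good_def T_invariant_def independent_empty)
  moreover have "card B < Suc (card some_basis)" if "good B" for B
    using that independent_card_le_dim[of B UNIV] by (auto simp: good_def dim_UNIV)
  ultimately obtain B where B: "good B" and max: "\<And>C. good C \<Longrightarrow> card C \<le> card B"
    using ex_has_greatest_nat[of good "{}" card] by blast
  have sB: "T_invariant (span B)" and iB: "independent B" using B by (auto simp: good_def)
  have "gws \<xi> \<subseteq> span B" if s: "supported \<xi>" for \<xi>
  proof (rule ccontr)
    assume "\<not> gws \<xi> \<subseteq> span B"
    then have "gws \<xi> \<inter> span B \<subset> gws \<xi>" by blast
    moreover have inv: "T_invariant (gws \<xi> \<inter> span B)"
      using sB T_invariant_gws[of \<xi>] by (auto simp: T_invariant_def subspace_inter)
    moreover have "\<exists>n. (shift (bracket h) (\<xi> h) ^^ n) x \<in> gws \<xi> \<inter> span B" if "h \<in> T" "x \<in> gws \<xi>" for h x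
      using gws_nilpotent[OF that(2,1)] subspace_0[OF subspace_gws, of \<xi>] span_zero[of B] by (metis IntI)
    ultimately have "\<exists>u\<in>gws \<xi> - (gws \<xi> \<inter> span B). \<forall>h\<in>T. bracket h u - scale (\<xi> h) u \<in> gws \<xi> \<inter> span B"
      by (intro weight_vector_modulo T_invariant_gws)
    then obtain u where u: "u \<in> gws \<xi>" "u \<notin> span B"
      "\<And>h. h \<in> T \<Longrightarrow> bracket h u - scale (\<xi> h) u \<in> span B"
      by blast
    have uB: "u \<notin> B" using u(2) span_base by blast
    have "good (insert u B)"
      unfolding good_def
    proof (intro conjI ballI)
      show "independent (insert u B)" using iB u(2) by (rule independent_insertI[rotated])
      have sub: "span B \<subseteq> span (insert u B)" by (rule span_mono) blast
      have "bracket h b \<in> span (insert u B)" if h: "h \<in> T" and b: "b \<in> insert u B" for h b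
      proof (cases "b = u")
        case True
        have "bracket h u = (bracket h u - scale (\<xi> h) u) + scale (\<xi> h) u" by simp
        also have "\<dots> \<in> span (insert u B)"
          using u(3)[OF h] sub by (intro span_add span_scale) (auto intro: span_base)
        finally show ?thesis using True by simp
      next
        case False
        then have "b \<in> span B" using b by (auto intro: span_base)
        then have "bracket h b \<in> span B" using sB h unfolding T_invariant_def by blast
        then show ?thesis using sub by blast
      qed
      then show "T_invariant (span (insert u B))"
        unfolding T_invariant_def using bracket_span_invariant[of "insert u B"] by auto
    next
      fix b assume b: "b \<in> insert u B"
      show "\<exists>\<xi>. supported \<xi> \<and> b \<in> gws \<xi> \<and> (\<exists>S\<subseteq>insert u B - {b}. T_invariant (span S) \<and>
          (\<forall>h\<in>T. bracket h b - scale (\<xi> h) b \<in> span S))"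
      proof (cases "b = u")
        case True
        then show ?thesis using s u sB uB by (intro exI[of _ \<xi>]) (auto intro!: exI[of _ B])
      next
        case False
        then have "b \<in> B" using b by simp
        then obtain \<mu> S where "supported \<mu>" "b \<in> gws \<mu>" "S \<subseteq> B - {b}" "T_invariant (span S)"
          "\<forall>h\<in>T. bracket h b - scale (\<mu> h) b \<in> span S"
          using B unfolding good_def by blast
        then show ?thesis by (intro exI[of _ \<mu>] conjI exI[of _ S]) auto
      qed
    qed
    from max[OF this] show False
      using uB iB finiteI_independent by simp
  qed
  then have "span (\<Union>\<xi>\<in>Collect supported. gws \<xi>) \<subseteq> span B" by (intro span_minimal) auto
  then have "basis_of B UNIV" using iB gws_decomposition by (auto simp: basis_of_def)
  moreover obtain w where "\<forall>b\<in>B. supported (w b) \<and> b \<in> gws (w b) \<and>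
     (\<exists>S\<subseteq>B - {b}. T_invariant (span S) \<and> (\<forall>h\<in>T. bracket h b - scale (w b h) b \<in> span S))"
    using B unfolding good_def by metis
  ultimately show ?thesis unfolding weight_basis_def by blast
qed

end

section \<open>Non-degeneracy of the Killing form and the root space decomposition\<close>

context cartan_simple_lie_algebra
begin

text \<open>A fixed triangular basis of weight vectors, with \<open>wt b\<close> the weight of the basis vector
  \<open>b\<close>.\<close>

definition wB :: "'g set" where
  "wB = fst (SOME p. weight_basis (fst p) (snd p))"
definition wt :: "'g \<Rightarrow> 'g \<Rightarrow> 'k" where
  "wt = snd (SOME p. weight_basis (fst p) (snd p))"

lemma weight_basis_wB: "weight_basis wB wt"
proof -
  obtain B w where "weight_basis (fst (B, w)) (snd (B, w))" using weight_basis_exists by auto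
  then show ?thesis unfolding wB_def wt_def by (rule someI)
qed

lemma wB: "basis_of wB UNIV"
  using weight_basis_wB by (simp add: weight_basis_def)
lemma finite_wB: "finite wB"
  using wB by (rule basis_of_finite)
lemma wt_supported: "b \<in> wB \<Longrightarrow> supported (wt b)"
  using weight_basis_wB by (simp add: weight_basis_def)
lemma wB_gws: "b \<in> wB \<Longrightarrow> b \<in> gws (wt b)"
  using weight_basis_wB by (simp add: weight_basis_def)
lemma wB_nonzero: "b \<in> wB \<Longrightarrow> b \<noteq> 0"
  using wB dependent_zero[of wB] by (auto simp: basis_of_def)
lemma wt_gws: "b \<in> wB \<Longrightarrow> gws (wt b) \<noteq> {0}"
  using wB_gws wB_nonzero by blast

lemma rep_outside: "S \<subseteq> wB - {b} \<Longrightarrow> x \<in> span S \<Longrightarrow> representation wB x b = 0"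
proof -
  assume S: "S \<subseteq> wB - {b}" and x: "x \<in> span S"
  have "representation wB x = representation S x"
    using S x wB by (intro representation_extend) (auto simp: basis_of_def)
  moreover have "representation S x b = 0" using representation_ne_zero[of S x b] S by blast
  ultimately show ?thesis by simp
qed

lemma rep_T_diagonal:
  assumes b: "b \<in> wB" and h: "h \<in> T"
  shows "representation wB (bracket h b) b = wt b h"
    and "h' \<in> T \<Longrightarrow> representation wB (bracket h' (bracket h b)) b = wt b h' * wt b h"
proof -
  obtain S where S: "S \<subseteq> wB - {b}" "T_invariant (span S)"
      "\<And>h. h \<in> T \<Longrightarrow> bracket h b - scale (wt b h) b \<in> span S"
    using weight_basis_wB b unfolding weight_basis_def by meson
  have 1: "representation wB (bracket h b) b = wt b h" if "h \<in> T" for h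
    using rep_outside[OF S(1) S(3)[OF that]] b
    by (simp add: rep_diff[OF wB] rep_scale[OF wB] rep_basis[OF wB])
  show "representation wB (bracket h b) b = wt b h" by (rule 1[OF h])
  assume h': "h' \<in> T"
  have "bracket h' (bracket h b - scale (wt b h) b) \<in> span S"
    using S(2) S(3)[OF h] h' by (auto simp: T_invariant_def)
  from rep_outside[OF S(1) this]
  show "representation wB (bracket h' (bracket h b)) b = wt b h' * wt b h"
    by (simp add: bracket_diff_right bracket_scale_right rep_diff[OF wB] rep_scale[OF wB] 1[OF h'])
qed

lemma killing_T:
  assumes "h \<in> T" "h' \<in> T"
  shows "killing h h' = (\<Sum>b\<in>wB. wt b h * wt b h')"
  unfolding killing_basis[OF wB] using rep_T_diagonal(2) assms by (intro sum.cong) auto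

text \<open>Since the weight spaces are independent, a weight vector is a combination of basis vectors of its
  own weight only.\<close>

lemma rep_gws:
  assumes s: "supported \<xi>" and x: "x \<in> gws \<xi>" and r: "representation wB x b \<noteq> 0"
  shows "b \<in> wB \<and> wt b = \<xi>"
proof -
  have bB: "b \<in> wB" using r by (rule representation_ne_zero)
  let ?r = "representation wB x"
  define p where "p \<mu> = (\<Sum>b\<in>{b\<in>wB. wt b = \<mu>}. scale (?r b) b)" for \<mu>
  define F where "F = insert \<xi> (wt ` wB)"
  \<comment> \<open>the components of \<open>x\<close> minus \<open>x\<close> itself, a family of weight vectors with sum zero\<close>
  define z where "z \<mu> = p \<mu> - (if \<mu> = \<xi> then x else 0)" for \<mu>
  have finF: "finite F" using finite_wB by (simp add: F_def)
  have pz: "p \<mu> \<in> gws \<mu>" for \<mu>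
    unfolding p_def by (intro subspace_sum[OF subspace_gws] subspace_scale[OF subspace_gws]) (use wB_gws in auto)
  have "(\<Sum>\<mu>\<in>F. p \<mu>) = (\<Sum>b\<in>wB. scale (?r b) b)"
    unfolding p_def by (rule sum.group) (use finite_wB finF in \<open>auto simp: F_def\<close>)
  then have "(\<Sum>\<mu>\<in>F. p \<mu>) = x" by (simp add: rep_expand[OF wB])
  then have sum0: "(\<Sum>\<mu>\<in>F. z \<mu>) = 0"
    unfolding z_def sum_subtractf using finF by (simp add: F_def)
  have zin: "z \<mu> \<in> gws \<mu>" for \<mu>
    using pz[of \<mu>] x subspace_diff[OF subspace_gws, of "p \<mu>" \<mu> x] by (auto simp: z_def)
  have "F \<subseteq> Collect supported" using s wt_supported by (auto simp: F_def)
  from gws_direct[OF finF this zin sum0] have z0: "\<forall>\<mu>\<in>F. z \<mu> = 0" .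
  have "wt b = \<xi>"
  proof (rule ccontr)
    assume ne: "wt b \<noteq> \<xi>"
    have "z (wt b) = 0" using z0 bB by (simp add: F_def)
    then have "(\<Sum>c\<in>{c\<in>wB. wt c = wt b}. scale (?r c) c) = 0" using ne by (simp add: z_def p_def)
    then have "?r b = 0"
      using wB bB finite_wB by (intro independentD[of wB "{c\<in>wB. wt c = wt b}" ?r]) (auto simp: basis_of_def)
    then show False using r by simp
  qed
  then show ?thesis using bB by simp
qed

lemma wt_linear:
  assumes "b \<in> wB"
  shows "h \<in> T \<Longrightarrow> h' \<in> T \<Longrightarrow> wt b (h + h') = wt b h + wt b h'"
    and "h \<in> T \<Longrightarrow> wt b (scale c h) = c * wt b h"
    and "h \<in> T \<Longrightarrow> h' \<in> T \<Longrightarrow> wt b (bracket h h') = 0"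
  using weight_linear[OF wt_gws[OF assms]] by auto

lemma supported_add: "supported \<xi> \<Longrightarrow> supported \<mu> \<Longrightarrow> supported (\<xi> + \<mu>)"
  by (simp add: supported_def)
lemma supported_minus: "supported \<xi> \<Longrightarrow> supported (- \<xi>)"
  by (simp add: supported_def)
lemma supported_0: "supported 0"
  by (simp add: supported_def)

lemma rep_bracket_gws:
  assumes "supported \<xi>" "x \<in> gws \<xi>" "c \<in> wB" "representation wB (bracket x c) b \<noteq> 0"
  shows "b \<in> wB \<and> wt b = \<xi> + wt c"
  using rep_gws[OF supported_add gws_bracket, of \<xi> "wt c" x c b] assms wt_supported wB_gws by simp

text \<open>At an \<open>h\<close> with \<open>(\<xi> + \<mu>) h \<noteq> 0\<close>, invariance moves the
  nilpotent parts of \<open>ad h\<close> from \<open>\<kappa>(x, y)\<close> to its arguments, where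
  they eventually vanish.\<close>

lemma killing_gws_orthogonal:
  assumes s: "supported \<xi>" "supported \<mu>" and ne: "\<xi> + \<mu> \<noteq> 0"
    and x: "x \<in> gws \<xi>" and y: "y \<in> gws \<mu>"
  shows "killing x y = 0"
proof -
  obtain h where h: "\<xi> h + \<mu> h \<noteq> 0" using ne by (auto simp: fun_eq_iff)
  then have hT: "h \<in> T" using s by (metis supported_def add.right_neutral)
  let ?s = "shift (bracket h)"
  have key: "(?s (\<xi> h) ^^ n) x = 0 \<Longrightarrow> (?s (\<mu> h) ^^ m) y = 0 \<Longrightarrow> killing x y = 0" for n m
  proof (induction "n + m" arbitrary: n m x y rule: less_induct)
    case less
    have eq: "(\<xi> h + \<mu> h) * killing x y = - killing (?s (\<xi> h) x) y - killing x (?s (\<mu> h) y)"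
      unfolding shift_def killing_diff_left killing_diff_right killing_scale_left killing_scale_right
        bracket_anti[of h x] killing_minus_left killing_invariant by (simp add: algebra_simps)
    have 1: "killing (?s (\<xi> h) x) y = 0"
    proof (cases n)
      case 0
      then show ?thesis using less.prems by (simp add: shift_def)
    next
      case (Suc k)
      then show ?thesis using less.hyps[of k m "?s (\<xi> h) x" y] less.prems by (simp add: funpow_swap1)
    qed
    have 2: "killing x (?s (\<mu> h) y) = 0"
    proof (cases m)
      case 0
      then show ?thesis using less.prems by (simp add: shift_def)
    next
      case (Suc k)
      then show ?thesis using less.hyps[of n k x "?s (\<mu> h) y"] less.prems by (simp add: funpow_swap1)
    qed
    show ?case using eq 1 2 h by simp
  qed
  show ?thesis using key gws_nilpotent[OF x hT] gws_nilpotent[OF y hT] by blast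
qed

text \<open>The basis vectors with weights in the string \<open>wt b + \<int>\<alpha>\<close> span a subspace
  stable under \<open>x\<close> and \<open>y\<close>, on which the commutator \<open>h = [x,
  y]\<close> has trace zero. This trace is the sum of the weights \<open>wt b h + k \<alpha>
  h\<close>, so \<open>wt b h\<close> is a rational multiple of \<open>\<alpha> h\<close>.\<close>

lemma weights_rational_on_bracket:
  assumes s: "supported \<alpha>" and x: "x \<in> gws \<alpha>" and y: "y \<in> gws (- \<alpha>)" and b: "b \<in> wB"
  shows "\<exists>r. wt b (bracket x y) = of_rat r * \<alpha> (bracket x y)"
proof -
  define h where "h = bracket x y"
  have hT: "h \<in> T" using gws_bracket[OF x y] gws_0 by (simp add: h_def)
  \<comment> \<open>the basis vectors in the \<open>\<alpha>\<close>-string through \<open>wt b\<close>\<close>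
  define W where "W = {c \<in> wB. \<exists>k::int. wt c = wt b + fscale (of_int k) \<alpha>}"
  have finW: "finite W" and WB: "W \<subseteq> wB" using finite_wB by (auto simp: W_def)
  have bW: "b \<in> W" using b by (auto simp: W_def fscale_def intro!: exI[of _ 0])
  have up: "d \<in> W" if c: "c \<in> W" and r: "representation wB (bracket x c) d \<noteq> 0" for c d
  proof -
    obtain k :: int where k: "wt c = wt b + fscale (of_int k) \<alpha>" using c by (auto simp: W_def)
    have "d \<in> wB" "wt d = \<alpha> + wt c" using rep_bracket_gws[OF s x _ r] c WB by auto
    then show ?thesis
      using k by (auto simp: W_def fscale_def fun_eq_iff algebra_simps intro!: exI[of _ "k + 1"])
  qed
  have down: "d \<in> W" if c: "c \<in> W" and r: "representation wB (bracket y c) d \<noteq> 0" for c d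
  proof -
    obtain k :: int where k: "wt c = wt b + fscale (of_int k) \<alpha>" using c by (auto simp: W_def)
    have "d \<in> wB" "wt d = - \<alpha> + wt c" using rep_bracket_gws[OF supported_minus[OF s] y _ r] c WB by auto
    then show ?thesis
      using k by (auto simp: W_def fscale_def fun_eq_iff algebra_simps intro!: exI[of _ "k - 1"])
  qed
  have comp: "(\<Sum>c\<in>W. representation wB (bracket u (bracket v c)) c)
      = (\<Sum>c\<in>W. \<Sum>d\<in>W. representation wB (bracket u d) c * representation wB (bracket v c) d)"
    if "\<And>c d. c \<in> W \<Longrightarrow> representation wB (bracket v c) d \<noteq> 0 \<Longrightarrow> d \<in> W" for u v
  proof (rule sum.cong[OF refl])
    fix c assume c: "c \<in> W"
    have "representation wB (bracket u (bracket v c)) c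
      = (\<Sum>d\<in>wB. representation wB (bracket u d) c * representation wB (bracket v c) d)"
      by (rule matrix_comp[OF lin_bracket wB])
    also have "\<dots> = (\<Sum>d\<in>W. representation wB (bracket u d) c * representation wB (bracket v c) d)"
      by (rule sum.mono_neutral_right) (use finite_wB WB that[OF c] in auto)
    finally show "representation wB (bracket u (bracket v c)) c
      = (\<Sum>d\<in>W. representation wB (bracket u d) c * representation wB (bracket v c) d)" .
  qed
  have eq: "(\<Sum>c\<in>W. representation wB (bracket x (bracket y c)) c)
     = (\<Sum>c\<in>W. representation wB (bracket y (bracket x c)) c)"
  proof -
    have "(\<Sum>c\<in>W. representation wB (bracket x (bracket y c)) c)
        = (\<Sum>c\<in>W. \<Sum>d\<in>W. representation wB (bracket x d) c * representation wB (bracket y c) d)"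
      by (rule comp) (rule down)
    moreover have "(\<Sum>c\<in>W. representation wB (bracket y (bracket x c)) c)
        = (\<Sum>c\<in>W. \<Sum>d\<in>W. representation wB (bracket y d) c * representation wB (bracket x c) d)"
      by (rule comp) (rule up)
    ultimately show ?thesis by (simp only:) (subst sum.swap, simp add: mult.commute)
  qed
  have "(\<Sum>c\<in>W. wt c h) = (\<Sum>c\<in>W. representation wB (bracket h c) c)"
    using WB by (intro sum.cong) (auto simp: rep_T_diagonal(1)[OF _ hT])
  also have "\<dots> = 0"
    by (simp add: h_def bracket_bracket_left rep_diff[OF wB] sum_subtractf eq)
  finally have 0: "(\<Sum>c\<in>W. wt c h) = 0" .
  obtain k where k: "\<And>c. c \<in> W \<Longrightarrow> wt c = wt b + fscale (of_int (k c)) \<alpha>"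
  proof -
    have "\<forall>c\<in>W. \<exists>k::int. wt c = wt b + fscale (of_int k) \<alpha>" by (auto simp: W_def)
    then show ?thesis using that by metis
  qed
  define K where "K = (\<Sum>c\<in>W. k c)"
  have "(\<Sum>c\<in>W. wt c h) = (\<Sum>c\<in>W. wt b h + of_int (k c) * \<alpha> h)"
    by (intro sum.cong) (auto simp: k fscale_def)
  also have "\<dots> = of_nat (card W) * wt b h + of_int K * \<alpha> h"
    by (simp add: K_def sum.distrib sum_distrib_right)
  finally have "of_nat (card W) * wt b h = - (of_int K * \<alpha> h)"
    using 0 by (simp add: eq_neg_iff_add_eq_0)
  moreover have "card W > 0" using finW bW by (auto simp: card_gt_0_iff)
  ultimately have "wt b h = of_rat (- of_int K / of_nat (card W)) * \<alpha> h"
    by (simp add: of_rat_divide of_rat_minus field_simps)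
  then show ?thesis unfolding h_def by blast
qed

text \<open>\<open>\<kappa>(h, h)\<close> is a sum of squares of weights, that is, \<open>(\<alpha>
  h)\<^sup>2\<close> times a sum of squares of rationals. It vanishes only if all of these rationals
  vanish or \<open>\<alpha> h = 0\<close>; either way all weights vanish at \<open>h\<close>.\<close>

lemma weights_vanish_if_isotropic:
  assumes s: "supported \<alpha>" and x: "x \<in> gws \<alpha>" and y: "y \<in> gws (- \<alpha>)" and "b \<in> wB"
    and z: "killing (bracket x y) (bracket x y) = 0 \<or> \<alpha> (bracket x y) = 0"
  shows "wt b (bracket x y) = 0"
proof -
  define h where "h = bracket x y"
  have hT: "h \<in> T" using gws_bracket[OF x y] gws_0 by (simp add: h_def)
  obtain r where r: "\<And>b. b \<in> wB \<Longrightarrow> wt b h = of_rat (r b) * \<alpha> h"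
    using weights_rational_on_bracket[OF s x y] unfolding h_def by metis
  show ?thesis
  proof (cases "\<alpha> h = 0")
    case True
    then show ?thesis using r[OF assms(4)] by (simp add: h_def)
  next
    case False
    then have "killing h h = 0" using z by (simp add: h_def)
    moreover have "killing h h = of_rat (\<Sum>b\<in>wB. r b * r b) * (\<alpha> h * \<alpha> h)"
      unfolding killing_T[OF hT hT] of_rat_sum sum_distrib_right
      by (intro sum.cong) (auto simp: r of_rat_mult)
    ultimately have "(\<Sum>b\<in>wB. r b * r b) = 0" using False by simp
    then have "\<forall>b\<in>wB. r b * r b = 0"
      using finite_wB by (subst (asm) sum_nonneg_eq_0_iff) auto
    then show ?thesis using r[OF assms(4)] assms(4) by (simp add: h_def)
  qed
qed

lemma span_brackets: "span {bracket x y | x y. True} = UNIV"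
proof -
  let ?D = "span {bracket x y | x y. True}"
  have "lie_ideal ?D" unfolding lie_ideal_def by (auto intro: span_base)
  then have "?D = {0} \<or> ?D = UNIV" by (rule ideal_trivial)
  moreover have "?D \<noteq> {0}"
  proof
    assume "?D = {0}"
    then have "bracket x y = 0" for x y using span_base[of "bracket x y" "{bracket x y | x y. True}"] by blast
    then show False using non_abelian by blast
  qed
  ultimately show ?thesis by blast
qed

text \<open>This is where Cartan's criterion enters. If the Killing form were zero, every bracket of opposite
  weight vectors would lie in the common kernel \<open>N\<close> of the weights. As \<open>\<gg> =
  [\<gg>, \<gg>]\<close>, this forces \<open>T = N\<close>, so the only weight is \<open>0\<close>
  and \<open>\<gg> = T\<close> is nilpotent, which contradicts \<open>\<gg> = [\<gg>,
  \<gg>]\<close>.\<close>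

lemma killing_nonzero: "\<exists>x y. killing x y \<noteq> 0"
proof (rule ccontr)
  assume "\<not> ?thesis"
  then have k0: "killing x y = 0" for x y by blast
  \<comment> \<open>the common kernel of the weights\<close>
  define N where "N = {h\<in>T. \<forall>b\<in>wB. wt b h = 0}"
  have N: "subspace N"
  proof (rule subspaceI)
    show "0 \<in> N" using wt_linear(2)[of _ 0 0] subspace_0[OF T_subspace] by (auto simp: N_def)
  qed (auto simp: N_def wt_linear subspace_add[OF T_subspace] subspace_scale[OF T_subspace])
  define G where "G = (\<Union>\<xi>\<in>{\<xi>. supported \<xi> \<and> \<xi> \<noteq> 0}. gws \<xi>)"
  have b: "bracket b c \<in> span (N \<union> G)" if bc: "b \<in> wB" "c \<in> wB" for b c
  proof (cases "wt b + wt c = 0")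
    case False
    then have "bracket b c \<in> G"
      unfolding G_def using gws_bracket[OF wB_gws wB_gws, OF bc] supported_add[OF wt_supported wt_supported, OF bc] by blast
    then show ?thesis by (simp add: span_base)
  next
    case True
    then have "wt c = - wt b" by (simp add: eq_neg_iff_add_eq_0 add.commute)
    then have c: "c \<in> gws (- wt b)" using wB_gws[OF bc(2)] by simp
    have "bracket b c \<in> N"
      unfolding N_def using gws_bracket[OF wB_gws[OF bc(1)] c] gws_0
        weights_vanish_if_isotropic[OF wt_supported wB_gws c, OF bc(1) bc(1)] k0 by auto
    then show ?thesis by (simp add: span_base)
  qed
  have "bracket x y \<in> span (N \<union> G)" for x y
  proof -
    have "bracket x y = (\<Sum>b\<in>wB. \<Sum>c\<in>wB. scale (representation wB x b) (scale (representation wB y c) (bracket b c)))"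
    proof -
      have "bracket x y = bracket (\<Sum>b\<in>wB. scale (representation wB x b) b) (\<Sum>c\<in>wB. scale (representation wB y c) c)"
        by (simp only: rep_expand[OF wB])
      also have "\<dots> = (\<Sum>b\<in>wB. scale (representation wB x b) (bracket b (\<Sum>c\<in>wB. scale (representation wB y c) c)))"
        by (simp only: bracket_sum_left bracket_scale_left)
      finally show ?thesis
        by (simp only: bracket_sum_right bracket_scale_right scale_sum_right)
    qed
    also have "\<dots> \<in> span (N \<union> G)" using b by (intro span_sum span_scale)
    finally show ?thesis .
  qed
  then have "span {bracket x y | x y. True} \<subseteq> span (N \<union> G)" by (intro span_minimal) auto
  then have full: "span (N \<union> G) = UNIV" using span_brackets by auto
  have repG: "representation wB x b = 0" if x: "x \<in> span G" and b: "wt b = 0" for x b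
    using x
  proof (induction rule: span_induct_alt)
    case base
    then show ?case by (simp add: representation_zero)
  next
    case (step c x y)
    then obtain \<xi> where "supported \<xi>" "\<xi> \<noteq> 0" "x \<in> gws \<xi>" by (auto simp: G_def)
    then have "representation wB x b = 0" using rep_gws[of \<xi> x b] b by auto
    then show ?case using step by (simp add: rep_add[OF wB] rep_scale[OF wB])
  qed
  have TN: "T \<subseteq> N"
  proof
    fix t assume t: "t \<in> T"
    have "t \<in> span (N \<union> G)" using full by simp
    then obtain n m where nm: "n \<in> N" "m \<in> span G" "t = n + m"
      unfolding span_Un using span_eq_iff[THEN iffD2, OF N] by auto
    have "m = t - n" using nm by simp
    moreover have "n \<in> T" using nm by (simp add: N_def)
    ultimately have "m \<in> gws 0" using t T_subspace gws_0 by (simp add: subspace_diff)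
    then have "representation wB m b = 0" for b
      using rep_gws[OF supported_0, of m b] repG[OF nm(2)] by auto
    then have "m = 0" using rep_expand[OF wB, of m] by simp
    then show "t \<in> N" using nm by simp
  qed
  have "b \<in> T" if b: "b \<in> wB" for b
  proof -
    have "wt b = 0" using TN wt_supported[OF b] b by (auto simp: fun_eq_iff N_def supported_def)
    then show ?thesis using wB_gws[OF b] gws_0 by simp
  qed
  then have "span wB \<subseteq> T" by (intro span_minimal T_subspace) auto
  then have T: "T = UNIV" using wB by (auto simp: basis_of_def)
  have "lower_central UNIV n = UNIV" for n
    by (induction n) (use span_brackets in simp_all)
  then have "(UNIV :: 'g set) = {0}" using T_nilpotent T by auto
  then have "\<And>x y. bracket x y = 0" by blast
  then show False using non_abelian by blast
qed

text \<open>The radical of the Killing form is an ideal.\<close>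

lemma killing_nondegenerate:
  assumes "\<And>y. killing x y = 0"
  shows "x = 0"
proof -
  let ?R = "{x. \<forall>y. killing x y = 0}"
  have "lie_ideal ?R"
    unfolding lie_ideal_def
  proof (intro conjI allI ballI)
    show "subspace ?R" by (rule subspaceI) (auto simp: killing_add_left killing_scale_left)
  next
    fix x y assume "y \<in> ?R"
    then show "bracket x y \<in> ?R"
      using bracket_anti[of x y] by (simp add: killing_minus_left killing_invariant)
  qed
  then have "?R = {0} \<or> ?R = UNIV" by (rule ideal_trivial)
  moreover have "?R \<noteq> UNIV" using killing_nonzero by blast
  ultimately show ?thesis using assms by auto
qed

lemma killing_zero_if_gws:
  assumes "\<And>\<mu> y. supported \<mu> \<Longrightarrow> y \<in> gws \<mu> \<Longrightarrow> killing x y = 0"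
  shows "x = 0"
proof (rule killing_nondegenerate)
  fix y
  have "subspace {y. killing x y = 0}" by (rule subspaceI) (auto simp: killing_add_right killing_scale_right)
  then have "span (\<Union>\<xi>\<in>Collect supported. gws \<xi>) \<subseteq> {y. killing x y = 0}"
    by (intro span_minimal) (use assms in auto)
  then show "killing x y = 0" using gws_decomposition by auto
qed

lemma killing_gws_nondegenerate:
  assumes s: "supported \<xi>" and x: "x \<in> gws \<xi>" and "\<And>y. y \<in> gws (- \<xi>) \<Longrightarrow> killing x y = 0"
  shows "x = 0"
proof (rule killing_zero_if_gws)
  fix \<mu> y assume m: "supported \<mu>" "y \<in> gws \<mu>"
  show "killing x y = 0"
  proof (cases "\<xi> + \<mu> = 0")
    case True
    then have "\<mu> = - \<xi>" by (simp add: eq_neg_iff_add_eq_0 add.commute)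
    then show ?thesis using assms(3) m by simp
  qed (rule killing_gws_orthogonal[OF s m(1) _ x m(2)])
qed

lemma killing_T_nondegenerate: "h \<in> T \<Longrightarrow> (\<And>h'. h' \<in> T \<Longrightarrow> killing h h' = 0) \<Longrightarrow> h = 0"
  using killing_gws_nondegenerate[OF supported_0, of h] gws_0 by simp

lemma T_abelian:
  assumes "h \<in> T" "h' \<in> T"
  shows "bracket h h' = 0"
  using assms by (intro killing_T_nondegenerate) (simp_all add: T_bracket killing_T wt_linear(3))

text \<open>For a genuine eigenvector \<open>x\<close> this is invariance. For generalized ones the proof
  replaces \<open>ad h\<close> by its semisimple part, the diagonal operator \<open>D\<close> with
  entries \<open>wt b h\<close>: it has the same trace against elements of \<open>T\<close>, and
  \<open>[D, ad x] = \<xi> h \<cdot> ad x\<close>.\<close>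

lemma killing_T_bracket:
  assumes s: "supported \<xi>" and x: "x \<in> gws \<xi>" and z: "z \<in> gws (- \<xi>)" and h: "h \<in> T"
  shows "killing h (bracket x z) = \<xi> h * killing x z"
proof -
  define t where "t = bracket x z"
  have tT: "t \<in> T" using gws_bracket[OF x z] gws_0 by (simp add: t_def)
  let ?X = "\<lambda>b c. representation wB (bracket x c) b" and ?Z = "\<lambda>b c. representation wB (bracket z c) b"
  have "killing h t = (\<Sum>b\<in>wB. wt b h * representation wB (bracket t b) b)"
    unfolding killing_T[OF h tT] by (intro sum.cong) (auto simp: rep_T_diagonal(1)[OF _ tT])
  also have "\<dots> = (\<Sum>b\<in>wB. wt b h * (\<Sum>c\<in>wB. ?X b c * ?Z c b)) - (\<Sum>b\<in>wB. wt b h * (\<Sum>c\<in>wB. ?Z b c * ?X c b))"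
    by (simp add: t_def bracket_bracket_left rep_diff[OF wB] matrix_comp[OF lin_bracket wB, where g = "bracket _"]
        right_diff_distrib sum_subtractf)
  also have "(\<Sum>b\<in>wB. wt b h * (\<Sum>c\<in>wB. ?Z b c * ?X c b)) = (\<Sum>b\<in>wB. \<Sum>c\<in>wB. wt c h * (?X b c * ?Z c b))"
    unfolding sum_distrib_left by (subst sum.swap) (simp add: mult.commute)
  also have "(\<Sum>b\<in>wB. wt b h * (\<Sum>c\<in>wB. ?X b c * ?Z c b)) - \<dots>
      = (\<Sum>b\<in>wB. \<Sum>c\<in>wB. (wt b h - wt c h) * (?X b c * ?Z c b))"
    by (simp add: sum_distrib_left sum_subtractf left_diff_distrib)
  also have "\<dots> = (\<Sum>b\<in>wB. \<Sum>c\<in>wB. \<xi> h * (?X b c * ?Z c b))"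
  proof (intro sum.cong refl)
    fix b c assume "b \<in> wB" "c \<in> wB"
    then show "(wt b h - wt c h) * (?X b c * ?Z c b) = \<xi> h * (?X b c * ?Z c b)"
      using rep_bracket_gws[OF s x, of c b] by (cases "?X b c = 0") auto
  qed
  also have "\<dots> = \<xi> h * killing x z"
    by (simp add: killing_basis[OF wB] matrix_comp[OF lin_bracket wB, where g = "bracket _"] sum_distrib_left)
  finally show ?thesis by (simp add: t_def)
qed

text \<open>By the previous lemma \<open>[h, x] - \<xi> h x\<close> is orthogonal to \<open>gws (-
  \<xi>)\<close>, hence zero: the Cartan subalgebra acts diagonalizably.\<close>

lemma gws_eigen:
  assumes s: "supported \<xi>" and x: "x \<in> gws \<xi>" and h: "h \<in> T"
  shows "bracket h x = scale (\<xi> h) x"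
proof -
  have "bracket h x - scale (\<xi> h) x = 0"
  proof (rule killing_gws_nondegenerate[OF s])
    show "bracket h x - scale (\<xi> h) x \<in> gws \<xi>"
      using T_invariant_gws[of \<xi>] x h by (simp add: T_invariant_def subspace_diff subspace_scale)
  next
    fix z assume "z \<in> gws (- \<xi>)"
    then show "killing (bracket h x - scale (\<xi> h) x) z = 0"
      using killing_T_bracket[OF s x _ h] by (simp add: killing_diff_left killing_invariant killing_scale_left)
  qed
  then show ?thesis by simp
qed

subsection \<open>Root spaces\<close>

lemma root_space_subspace: "subspace (root_space \<gamma>)"
  unfolding root_space_def
  by (rule subspaceI) (auto simp: bracket_add_right bracket_scale_right scale_right_distrib scale_left_commute)

lemma root_space_bracket:
  "x \<in> root_space \<gamma> \<Longrightarrow> y \<in> root_space \<delta> \<Longrightarrow> bracket x y \<in> root_space (\<gamma> + \<delta>)"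
  unfolding root_space_def
  by (auto simp: bracket_derivation[of _ x y] bracket_scale_left bracket_scale_right scale_left_distrib)

lemma root_space_eigen: "x \<in> root_space \<gamma> \<Longrightarrow> h \<in> T \<Longrightarrow> bracket h x = scale (\<gamma> h) x"
  by (simp add: root_space_def)

lemma root_space_gws: "supported \<gamma> \<Longrightarrow> root_space \<gamma> = gws \<gamma>"
proof
  assume s: "supported \<gamma>"
  then show "gws \<gamma> \<subseteq> root_space \<gamma>" by (auto simp: root_space_def gws_eigen)
  show "root_space \<gamma> \<subseteq> gws \<gamma>"
    unfolding root_space_def gws_def geneig_def by (auto simp: shift_def intro!: exI[of _ 1])
qed

lemma root_space_0: "root_space 0 = T"
  using root_space_gws[OF supported_0] gws_0 by simp

lemma dual_supported: "f \<in> dual \<Longrightarrow> supported f"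
  by (simp add: dual_def supported_def)

lemma dual_subspace: "functional.subspace dual"
  by (rule functional.subspaceI)
    (auto simp: dual_def fscale_def algebra_simps subspace_add[OF T_subspace] subspace_scale[OF T_subspace])

lemmas dual_closed = functional.subspace_add[OF dual_subspace] functional.subspace_scale[OF dual_subspace]
  functional.subspace_neg[OF dual_subspace] functional.subspace_diff[OF dual_subspace]
  functional.subspace_0[OF dual_subspace] functional.subspace_sum[OF dual_subspace]

lemma weight_dual: "supported \<xi> \<Longrightarrow> gws \<xi> \<noteq> {0} \<Longrightarrow> \<xi> \<in> dual"
  using weight_linear[of \<xi>] by (auto simp: dual_def supported_def)

lemma wt_root: "b \<in> wB \<Longrightarrow> wt b = 0 \<or> wt b \<in> roots"
  using weight_dual[OF wt_supported wt_gws] root_space_gws[OF wt_supported] wt_gws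
  by (auto simp: roots_def)

lemma root_dual: "\<gamma> \<in> roots \<Longrightarrow> \<gamma> \<in> dual" and root_nonzero: "\<gamma> \<in> roots \<Longrightarrow> \<gamma> \<noteq> 0"
  and root_space_nonzero: "\<gamma> \<in> roots \<Longrightarrow> root_space \<gamma> \<noteq> {0}"
  by (simp_all add: roots_def)

lemma not_root_space: "\<gamma> \<in> dual \<Longrightarrow> \<gamma> \<noteq> 0 \<Longrightarrow> \<gamma> \<notin> roots \<Longrightarrow> root_space \<gamma> = {0}"
  by (simp add: roots_def)

lemma root_supported: "\<gamma> \<in> roots \<Longrightarrow> supported \<gamma>"
  using root_dual dual_supported by blast

lemma root_wt: "\<gamma> \<in> roots \<Longrightarrow> \<exists>b\<in>wB. wt b = \<gamma>"
proof -
  assume g: "\<gamma> \<in> roots"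
  obtain x where x: "x \<in> root_space \<gamma>" "x \<noteq> 0"
    using root_space_nonzero[OF g] subspace_0[OF root_space_subspace] by blast
  have "\<exists>b. representation wB x b \<noteq> 0"
  proof (rule ccontr)
    assume "\<not> ?thesis"
    then show False using rep_expand[OF wB, of x] x by simp
  qed
  then show ?thesis using rep_gws[OF root_supported[OF g]] x root_space_gws[OF root_supported[OF g]] by blast
qed

lemma finite_roots: "finite roots"
  using finite_subset[of roots "wt ` wB"] root_wt finite_wB by blast

lemma killing_root_space_orthogonal:
  assumes "\<gamma> \<in> dual" "\<delta> \<in> dual" "\<gamma> + \<delta> \<noteq> 0" "x \<in> root_space \<gamma>" "y \<in> root_space \<delta>"
  shows "killing x y = 0"
  using killing_gws_orthogonal[OF dual_supported dual_supported] assms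
  by (simp add: root_space_gws dual_supported)

lemma root_space_pairing:
  assumes g: "\<gamma> \<in> dual" and x: "x \<in> root_space \<gamma>" "x \<noteq> 0"
  shows "\<exists>y\<in>root_space (- \<gamma>). killing x y = 1"
proof -
  note s = dual_supported[OF g]
  obtain y where y: "y \<in> gws (- \<gamma>)" "killing x y \<noteq> 0"
    using killing_gws_nondegenerate[OF s] x root_space_gws[OF s] by metis
  then show ?thesis
    using root_space_gws[OF supported_minus[OF s]] subspace_gws[of "- \<gamma>"]
    by (intro bexI[of _ "scale (inverse (killing x y)) y"]) (auto simp: killing_scale_right subspace_scale)
qed

lemma root_minus: "\<gamma> \<in> roots \<Longrightarrow> - \<gamma> \<in> roots"
proof -
  assume g: "\<gamma> \<in> roots"
  obtain x where x: "x \<in> root_space \<gamma>" "x \<noteq> 0"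
    using root_space_nonzero[OF g] subspace_0[OF root_space_subspace] by blast
  obtain y where "y \<in> root_space (- \<gamma>)" "killing x y = 1"
    using root_space_pairing[OF root_dual[OF g] x] by blast
  then have "y \<in> root_space (- \<gamma>)" "y \<noteq> 0" by auto
  then show ?thesis using dual_closed(3)[OF root_dual[OF g]] root_nonzero[OF g] by (auto simp: roots_def)
qed

lemma root_decomposition: "span (T \<union> (\<Union>\<gamma>\<in>roots. root_space \<gamma>)) = UNIV"
proof -
  have "b \<in> T \<union> (\<Union>\<gamma>\<in>roots. root_space \<gamma>)" if b: "b \<in> wB" for b
    using wt_root[OF b] wB_gws[OF b] gws_0 root_space_gws[OF wt_supported[OF b]] by auto
  then have "span wB \<subseteq> span (T \<union> (\<Union>\<gamma>\<in>roots. root_space \<gamma>))" by (intro span_mono) blast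
  then show ?thesis using wB by (auto simp: basis_of_def)
qed

text \<open>Relational form of \<open>representer\<close>, so that linear combinations can be represented
  without knowing beforehand that every functional has a representing element.\<close>

definition represents :: "'g \<Rightarrow> ('g \<Rightarrow> 'k) \<Rightarrow> bool" where
  "represents h f \<longleftrightarrow> h \<in> T \<and> (\<forall>x\<in>T. killing h x = f x)"

lemma representer_eqI:
  assumes "represents h f"
  shows "representer f = h"
  unfolding representer_def
proof (rule the_equality)
  show "h \<in> T \<and> (\<forall>x\<in>T. killing h x = f x)" using assms by (simp add: represents_def)
next
  fix h' assume h': "h' \<in> T \<and> (\<forall>x\<in>T. killing h' x = f x)"
  have "h' - h = 0"
    using assms h' by (intro killing_T_nondegenerate) (auto simp: represents_def subspace_diff[OF T_subspace] killing_diff_left)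
  then show "h' = h" by simp
qed

text \<open>The familiar \<open>[x, y] = \<kappa>(x, y) t\<^sub>\<gamma>\<close>.\<close>

lemma bracket_opposite_represents:
  assumes "\<gamma> \<in> dual" "x \<in> root_space \<gamma>" "y \<in> root_space (- \<gamma>)"
  shows "represents (bracket x y) (fscale (killing x y) \<gamma>)"
proof -
  note s = dual_supported[OF assms(1)]
  have "bracket x y \<in> root_space (\<gamma> + - \<gamma>)" using assms by (intro root_space_bracket)
  then have "bracket x y \<in> T" by (simp add: root_space_0)
  moreover have "killing (bracket x y) h = killing x y * \<gamma> h" if "h \<in> T" for h
    using killing_T_bracket[OF s _ _ that, of x y] assms(2,3) root_space_gws[OF s] root_space_gws[OF supported_minus[OF s]]
    by (simp add: killing_commute[of _ h] mult.commute)
  ultimately show ?thesis by (simp add: represents_def fscale_def)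
qed

lemma root_represented: "\<gamma> \<in> roots \<Longrightarrow> \<exists>h. represents h \<gamma>"
proof -
  assume g: "\<gamma> \<in> roots"
  obtain x where x: "x \<in> root_space \<gamma>" "x \<noteq> 0"
    using root_space_nonzero[OF g] subspace_0[OF root_space_subspace] by blast
  obtain y where y: "y \<in> root_space (- \<gamma>)" "killing x y = 1"
    using root_space_pairing[OF root_dual[OF g] x] by blast
  have "represents (bracket x y) \<gamma>"
    using bracket_opposite_represents[OF root_dual[OF g] x(1) y(1)] y(2) by (simp add: fscale_def)
  then show ?thesis by blast
qed

end

section \<open>Strings of roots\<close>

context cartan_simple_lie_algebra
begin

lemma representer: "\<gamma> \<in> roots \<Longrightarrow> represents (representer \<gamma>) \<gamma>"
  using root_represented representer_eqI by metis

lemma represents_add: "represents h f \<Longrightarrow> represents h' g \<Longrightarrow> represents (h + h') (f + g)"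
  by (simp add: represents_def subspace_add[OF T_subspace] killing_add_left)
lemma represents_scale: "represents h f \<Longrightarrow> represents (scale c h) (fscale c f)"
  by (simp add: represents_def fscale_def subspace_scale[OF T_subspace] killing_scale_left)
lemma represents_minus: "represents h f \<Longrightarrow> represents (- h) (- f)"
  by (simp add: represents_def subspace_neg[OF T_subspace] killing_minus_left)
lemma represents_0: "represents 0 0"
  by (simp add: represents_def subspace_0[OF T_subspace])

lemma form_represents: "represents h f \<Longrightarrow> represents h' g \<Longrightarrow> form f g = f h'"
  by (simp add: form_def representer_eqI represents_def)

lemma killing_representer: "represents h f \<Longrightarrow> h' \<in> T \<Longrightarrow> killing h h' = f h'"
  by (simp add: represents_def)

text \<open>Otherwise all weights would vanish on \<open>t\<^sub>\<gamma> = [x, y]\<close>, so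
  \<open>t\<^sub>\<gamma>\<close> would be orthogonal to \<open>T\<close>.\<close>

lemma form_root_self_nonzero:
  assumes g: "\<gamma> \<in> roots"
  shows "form \<gamma> \<gamma> \<noteq> 0"
proof
  assume 0: "form \<gamma> \<gamma> = 0"
  obtain x where x: "x \<in> root_space \<gamma>" "x \<noteq> 0"
    using root_space_nonzero[OF g] subspace_0[OF root_space_subspace] by blast
  obtain y where y: "y \<in> root_space (- \<gamma>)" "killing x y = 1"
    using root_space_pairing[OF root_dual[OF g] x] by blast
  define h where "h = bracket x y"
  have h: "represents h \<gamma>"
    using bracket_opposite_represents[OF root_dual[OF g] x(1) y(1)] y(2) by (simp add: fscale_def h_def)
  then have hT: "h \<in> T" by (simp add: represents_def)
  have "killing h h = 0" using 0 representer_eqI[OF h] by (simp add: form_def)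
  then have w: "wt b h = 0" if "b \<in> wB" for b
    using weights_vanish_if_isotropic[OF root_supported[OF g] _ _ that, of x y] x y
    by (simp add: h_def root_space_gws root_supported[OF g] supported_minus)
  have "h = 0" by (rule killing_T_nondegenerate[OF hT]) (simp add: killing_T[OF hT] w)
  then have "\<gamma> t = 0" for t
    using h root_supported[OF g] by (cases "t \<in> T") (auto simp: represents_def supported_def)
  then show False using root_nonzero[OF g] by (auto simp: fun_eq_iff)
qed

definition coroot :: "('g \<Rightarrow> 'k) \<Rightarrow> 'g" where
  "coroot \<beta> = scale (2 / form \<beta> \<beta>) (representer \<beta>)"

lemma coroot_T: "\<beta> \<in> roots \<Longrightarrow> coroot \<beta> \<in> T"
  using representer by (auto simp: coroot_def represents_def subspace_scale[OF T_subspace])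

lemma dual_scale: "f \<in> dual \<Longrightarrow> h \<in> T \<Longrightarrow> f (scale c h) = c * f h"
  by (simp add: dual_def)

lemma represents_coroot:
  "represents h f \<Longrightarrow> f \<in> dual \<Longrightarrow> \<beta> \<in> roots \<Longrightarrow> f (coroot \<beta>) = 2 * form f \<beta> / form \<beta> \<beta>"
  using representer[of \<beta>]
  by (simp add: form_represents coroot_def dual_scale represents_def)

lemma root_coroot: "\<gamma> \<in> roots \<Longrightarrow> \<beta> \<in> roots \<Longrightarrow> \<gamma> (coroot \<beta>) = 2 * form \<gamma> \<beta> / form \<beta> \<beta>"
  using represents_coroot[OF representer root_dual] .

lemma coroot_self: "\<beta> \<in> roots \<Longrightarrow> \<beta> (coroot \<beta>) = 2"
  using form_root_self_nonzero by (simp add: root_coroot)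

lemma coroot_minus: "\<beta> \<in> roots \<Longrightarrow> coroot (- \<beta>) = - coroot \<beta>"
proof -
  assume b: "\<beta> \<in> roots"
  have "representer (- \<beta>) = - representer \<beta>"
    by (rule representer_eqI[OF represents_minus[OF representer[OF b]]])
  then show ?thesis by (simp add: coroot_def form_def killing_minus_left killing_minus_right)
qed

lemma coroot_nonzero: "\<beta> \<in> roots \<Longrightarrow> coroot \<beta> \<noteq> 0"
  using coroot_self[of \<beta>] dual_scale[OF root_dual, of \<beta> 0 0] subspace_0[OF T_subspace] by auto

lemma opposite_root_vector:
  assumes b: "\<beta> \<in> roots" and x: "x \<in> root_space \<beta>" "x \<noteq> 0"
  shows "\<exists>y\<in>root_space (- \<beta>). bracket x y = coroot \<beta>"
proof -
  obtain y where y: "y \<in> root_space (- \<beta>)" "killing x y = 1"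
    using root_space_pairing[OF root_dual[OF b] x] by blast
  have "representer \<beta> = bracket x y"
    using bracket_opposite_represents[OF root_dual[OF b] x(1) y(1)] y(2)
    by (intro representer_eqI) (simp add: fscale_def)
  then show ?thesis
    using y(1) subspace_scale[OF root_space_subspace]
    by (intro bexI[of _ "scale (2 / form \<beta> \<beta>) y"]) (auto simp: coroot_def bracket_scale_right)
qed

lemma root_space_funpow:
  assumes "x \<in> root_space \<beta>" "v \<in> root_space \<delta>"
  shows "(bracket x ^^ j) v \<in> root_space (\<delta> + fscale (of_nat j) \<beta>)"
proof (induction j)
  case 0
  then show ?case using assms by (simp add: fscale_def zero_fun_def[symmetric] plus_fun_def)
next
  case (Suc j)
  have "bracket x ((bracket x ^^ j) v) \<in> root_space (\<beta> + (\<delta> + fscale (of_nat j) \<beta>))"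
    by (rule root_space_bracket[OF assms(1) Suc])
  moreover have "\<beta> + (\<delta> + fscale (of_nat j) \<beta>) = \<delta> + fscale (of_nat (Suc j)) \<beta>"
    by (simp add: fun_eq_iff fscale_def algebra_simps)
  ultimately show ?case by (metis funpow.simps(2) o_apply)
qed

lemma string_stops:
  assumes d: "\<delta> \<in> dual" and b: "\<beta> \<in> dual" "\<beta> \<noteq> 0" and x: "x \<in> root_space \<beta>" and v: "v \<in> root_space \<delta>"
  shows "\<exists>N. (bracket x ^^ N) v = 0"
proof (rule ccontr)
  assume ne: "\<not> ?thesis"
  let ?f = "\<lambda>j::nat. \<delta> + fscale (of_nat j) \<beta>"
  have "?f j \<in> insert 0 roots" for j
    using not_root_space[of "?f j"] root_space_funpow[OF x v, of j] ne dual_closed(1)[OF d dual_closed(2)[OF b(1)]]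
    by auto
  then have "finite (range ?f)" using finite_roots by (intro finite_subset[of "range ?f" "insert 0 roots"]) auto
  moreover have "inj ?f"
  proof (rule injI)
    fix i j assume "?f i = ?f j"
    then have "\<forall>t. of_nat i * \<beta> t = of_nat j * \<beta> t" by (auto simp: fun_eq_iff fscale_def)
    moreover obtain t where "\<beta> t \<noteq> 0" using b(2) by (auto simp: fun_eq_iff)
    ultimately show "i = j" by (metis mult_right_cancel of_nat_eq_iff)
  qed
  ultimately show False using finite_imageD[of ?f UNIV] by simp
qed

text \<open>The standard computation with an \<open>\<ss>\<ll>\<^sub>2\<close>-triple \<open>(e, h, f)\<close>
  and a highest weight vector \<open>v\<close> of weight \<open>m\<close>.\<close>

lemma sl2_ladder:
  assumes hf: "bracket h f = scale (- 2) f" and ef: "bracket e f = h"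
    and hv: "bracket h v = scale m v" and ev: "bracket e v = 0"
  shows "bracket h ((bracket f ^^ j) v) = scale (m - 2 * of_nat j) ((bracket f ^^ j) v)"
    and "bracket e ((bracket f ^^ Suc j) v) = scale (of_nat (Suc j) * (m - of_nat j)) ((bracket f ^^ j) v)"
proof -
  show 1: "bracket h ((bracket f ^^ j) v) = scale (m - 2 * of_nat j) ((bracket f ^^ j) v)" for j
  proof (induction j)
    case (Suc j)
    let ?y = "bracket f ((bracket f ^^ j) v)"
    have "bracket h ?y = scale (- 2) ?y + scale (m - 2 * of_nat j) ?y"
      by (simp only: bracket_derivation[of h f] hf Suc bracket_scale_left bracket_scale_right)
    also have "\<dots> = scale (m - 2 * of_nat (Suc j)) ?y"
      unfolding scale_left_distrib[symmetric] by (rule arg_cong[of _ _ "\<lambda>c. scale c ?y"]) simp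
    finally show ?case by simp
  qed (simp add: hv)
  show "bracket e ((bracket f ^^ Suc j) v) = scale (of_nat (Suc j) * (m - of_nat j)) ((bracket f ^^ j) v)"
  proof (induction j)
    case 0
    then show ?case by (simp add: bracket_derivation[of e f] ef hv ev)
  next
    case (Suc j)
    have "bracket e ((bracket f ^^ Suc (Suc j)) v)
        = scale (m - 2 * of_nat (Suc j)) ((bracket f ^^ Suc j) v)
          + scale (of_nat (Suc j) * (m - of_nat j)) ((bracket f ^^ Suc j) v)"
      using Suc 1[of "Suc j"] by (simp add: bracket_derivation[of e f] ef bracket_scale_right)
    also have "\<dots> = scale (of_nat (Suc (Suc j)) * (m - of_nat (Suc j))) ((bracket f ^^ Suc j) v)"
      unfolding scale_left_distrib[symmetric]
      by (rule arg_cong[of _ _ "\<lambda>c. scale c ((bracket f ^^ Suc j) v)"]) (simp add: algebra_simps)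
    finally show ?case .
  qed
qed

text \<open>If \<open>n + 1\<close> is the first power of \<open>f\<close> killing \<open>v\<close>, then the
  ladder formula for \<open>e f\<^sup>n\<^sup>+\<^sup>1 v = 0\<close> forces the weight to be
  \<open>n\<close>.\<close>

lemma highest_weight_natural:
  assumes b: "\<beta> \<in> roots" and d: "\<delta> \<in> dual"
    and e: "e \<in> root_space \<beta>" and f: "f \<in> root_space (- \<beta>)" and ef: "bracket e f = coroot \<beta>"
    and v: "v \<in> root_space \<delta>" "v \<noteq> 0" and ev: "bracket e v = 0"
  shows "\<exists>n. \<delta> (coroot \<beta>) = of_nat n \<and> (\<forall>j\<le>n. (bracket f ^^ j) v \<noteq> 0)"
proof -
  have hf: "bracket (coroot \<beta>) f = scale (- 2) f"
    using root_space_eigen[OF f coroot_T[OF b]] coroot_self[OF b] by simp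
  note l = sl2_ladder[OF hf ef root_space_eigen[OF v(1) coroot_T[OF b]] ev]
  have "- \<beta> \<noteq> 0" using root_nonzero[OF b] by (simp add: fun_eq_iff)
  then have "\<exists>N. (bracket f ^^ N) v = 0"
    by (intro string_stops[OF d dual_closed(3)[OF root_dual[OF b]] _ f v(1)])
  then have L: "(bracket f ^^ (LEAST N. (bracket f ^^ N) v = 0)) v = 0" by (rule LeastI_ex)
  then obtain n where n: "(LEAST N. (bracket f ^^ N) v = 0) = Suc n"
    using v(2) by (cases "LEAST N. (bracket f ^^ N) v = 0") auto
  have nz: "(bracket f ^^ j) v \<noteq> 0" if "j \<le> n" for j
    using not_less_Least[of j "\<lambda>N. (bracket f ^^ N) v = 0"] n that by simp
  have "scale (of_nat (Suc n) * (\<delta> (coroot \<beta>) - of_nat n)) ((bracket f ^^ n) v) = 0"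
    using l(2)[of n] L n by (metis bracket_zero_right)
  then have "\<delta> (coroot \<beta>) = of_nat n" using nz[of n] by (simp del: of_nat_Suc)
  then show ?thesis using nz by blast
qed

lemma string_top:
  assumes b: "\<beta> \<in> roots" and d: "\<delta> \<in> dual" and e: "e \<in> root_space \<beta>" and v: "v \<in> root_space \<delta>" "v \<noteq> 0"
  shows "\<exists>p w. w \<in> root_space (\<delta> + fscale (of_nat p) \<beta>) \<and> w \<noteq> 0 \<and> bracket e w = 0"
proof -
  have "\<exists>N. (bracket e ^^ N) v = 0" by (rule string_stops[OF d root_dual[OF b] root_nonzero[OF b] e v(1)])
  then have L: "(bracket e ^^ (LEAST N. (bracket e ^^ N) v = 0)) v = 0" by (rule LeastI_ex)
  then obtain p where p: "(LEAST N. (bracket e ^^ N) v = 0) = Suc p"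
    using v(2) by (cases "LEAST N. (bracket e ^^ N) v = 0") auto
  have "(bracket e ^^ p) v \<noteq> 0" using not_less_Least[of p "\<lambda>N. (bracket e ^^ N) v = 0"] p by simp
  then show ?thesis using L p root_space_funpow[OF e v(1), of p] by auto
qed

lemma root_vector_exists: "\<gamma> \<in> roots \<Longrightarrow> \<exists>x\<in>root_space \<gamma>. x \<noteq> 0"
  using root_space_nonzero subspace_0[OF root_space_subspace] by blast

lemma sl2_triple_exists:
  assumes "\<beta> \<in> roots"
  shows "\<exists>e\<in>root_space \<beta>. \<exists>f\<in>root_space (- \<beta>). e \<noteq> 0 \<and> bracket e f = coroot \<beta>"
  using root_vector_exists[OF assms] opposite_root_vector[OF assms] by blast

text \<open>Climb with \<open>e\<close> from the root space of \<open>\<gamma>\<close> to a highest weight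
  vector \<open>w\<close>, at \<open>\<gamma> + p\<beta>\<close> and of weight \<open>n\<close>.
  Then \<open>\<langle>\<gamma>, \<beta>\<rangle> = n - 2p\<close>. Descending from \<open>w\<close>
  by \<open>n - p\<close> steps, which is possible because \<open>n - p \<le> n\<close>, ends in the
  root space of the reflected root.\<close>

lemma cartan_integer:
  assumes g: "\<gamma> \<in> roots" and b: "\<beta> \<in> roots"
  shows "\<exists>m::int. \<gamma> (coroot \<beta>) = of_int m"
    and "\<gamma> (coroot \<beta>) = of_nat m \<Longrightarrow> \<gamma> - fscale (of_nat m) \<beta> \<in> roots"
proof -
  obtain e f where e: "e \<in> root_space \<beta>" and f: "f \<in> root_space (- \<beta>)" and ef: "bracket e f = coroot \<beta>"
    using sl2_triple_exists[OF b] by blast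
  obtain v where v: "v \<in> root_space \<gamma>" "v \<noteq> 0" using root_vector_exists[OF g] by blast
  obtain p w where w: "w \<in> root_space (\<gamma> + fscale (of_nat p) \<beta>)" "w \<noteq> 0" "bracket e w = 0"
    using string_top[OF b root_dual[OF g] e v] by blast
  obtain n where n: "(\<gamma> + fscale (of_nat p) \<beta>) (coroot \<beta>) = of_nat n"
      "\<And>j. j \<le> n \<Longrightarrow> (bracket f ^^ j) w \<noteq> 0"
    using highest_weight_natural[OF b dual_closed(1)[OF root_dual[OF g] dual_closed(2)[OF root_dual[OF b]]] e f ef w] by blast
  have c: "\<gamma> (coroot \<beta>) = of_nat n - 2 * of_nat p"
    using n(1) coroot_self[OF b] by (simp add: fscale_def eq_diff_eq mult.commute)
  then have "\<gamma> (coroot \<beta>) = of_int (int n - 2 * int p)" by simp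
  then show "\<exists>m::int. \<gamma> (coroot \<beta>) = of_int m" by blast
  show "\<gamma> - fscale (of_nat m) \<beta> \<in> roots" if m: "\<gamma> (coroot \<beta>) = of_nat m"
  proof -
    have "of_nat n - 2 * of_nat p = (of_nat m :: 'k)" using c m by simp
    then have "of_nat n = (of_nat (m + 2 * p) :: 'k)" by (simp only: diff_eq_eq of_nat_add of_nat_mult of_nat_numeral)
    then have nm: "n = m + 2 * p" by (simp only: of_nat_eq_iff)
    have "(bracket f ^^ (m + p)) w \<noteq> 0" using n(2) nm by simp
    moreover have "(bracket f ^^ (m + p)) w \<in> root_space (\<gamma> + fscale (of_nat p) \<beta> + fscale (of_nat (m + p)) (- \<beta>))"
      by (rule root_space_funpow[OF f w(1)])
    moreover have "\<gamma> + fscale (of_nat p) \<beta> + fscale (of_nat (m + p)) (- \<beta>) = \<gamma> - fscale (of_nat m) \<beta>"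
      by (simp add: fun_eq_iff fscale_def algebra_simps)
    ultimately have ne: "root_space (\<gamma> - fscale (of_nat m) \<beta>) \<noteq> {0}" by (metis singletonD)
    have "\<gamma> - fscale (of_nat m) \<beta> \<noteq> 0"
    proof
      assume "\<gamma> - fscale (of_nat m) \<beta> = 0"
      then have eq: "\<gamma> = fscale (of_nat m) \<beta>" by (simp add: fun_eq_iff)
      then have "\<gamma> (coroot \<beta>) = 2 * of_nat m" using coroot_self[OF b] by (simp add: fscale_def mult.commute)
      then have "m = 0" using m by simp
      then show False using eq root_nonzero[OF g] by (simp add: fscale_def fun_eq_iff)
    qed
    then show ?thesis
      using ne dual_closed(4)[OF root_dual[OF g] dual_closed(2)[OF root_dual[OF b]]] by (auto simp: roots_def)
  qed
qed

text \<open>The Cartan integer \<open>2(\<gamma>, \<beta>)/(\<beta>, \<beta>)\<close>, as an integer.\<close>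

definition cart :: "('g \<Rightarrow> 'k) \<Rightarrow> ('g \<Rightarrow> 'k) \<Rightarrow> int" where
  "cart \<gamma> \<beta> = (SOME m. \<gamma> (coroot \<beta>) = of_int m)"

lemma cart: "\<gamma> \<in> roots \<Longrightarrow> \<beta> \<in> roots \<Longrightarrow> \<gamma> (coroot \<beta>) = of_int (cart \<gamma> \<beta>)"
  unfolding cart_def by (rule someI_ex) (rule cartan_integer)

lemma reflection_root:
  assumes g: "\<gamma> \<in> roots" and b: "\<beta> \<in> roots"
  shows "\<gamma> - fscale (of_int (cart \<gamma> \<beta>)) \<beta> \<in> roots"
proof (cases "cart \<gamma> \<beta> \<ge> 0")
  case True
  then show ?thesis using cartan_integer(2)[OF g b, of "nat (cart \<gamma> \<beta>)"] cart[OF g b] by simp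
next
  case False
  have "\<gamma> (- coroot \<beta>) = - \<gamma> (coroot \<beta>)"
    using dual_scale[OF root_dual[OF g] coroot_T[OF b], of "-1"] by simp
  then have "\<gamma> (coroot (- \<beta>)) = of_nat (nat (- cart \<gamma> \<beta>))"
    using False by (simp add: coroot_minus[OF b] cart[OF g b])
  from cartan_integer(2)[OF g root_minus[OF b] this]
  have "\<gamma> - fscale (of_nat (nat (- cart \<gamma> \<beta>))) (- \<beta>) \<in> roots" .
  moreover have "\<gamma> - fscale (of_nat (nat (- cart \<gamma> \<beta>))) (- \<beta>) = \<gamma> - fscale (of_int (cart \<gamma> \<beta>)) \<beta>"
    using False by (simp add: fun_eq_iff fscale_def)
  ultimately show ?thesis by simp
qed

text \<open>A vector killed by \<open>e\<close> has a nonnegative weight.\<close>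

lemma negative_pairing_bracket:
  assumes b: "\<beta> \<in> roots" and d: "\<delta> \<in> roots" and c: "cart \<delta> \<beta> < 0"
    and e: "e \<in> root_space \<beta>" "e \<noteq> 0" and v: "v \<in> root_space \<delta>" "v \<noteq> 0"
  shows "bracket e v \<noteq> 0"
proof
  assume ev: "bracket e v = 0"
  obtain f where f: "f \<in> root_space (- \<beta>)" "bracket e f = coroot \<beta>"
    using opposite_root_vector[OF b e] by blast
  obtain n where "\<delta> (coroot \<beta>) = of_nat n"
    using highest_weight_natural[OF b root_dual[OF d] e(1) f v ev] by blast
  then have "of_int (cart \<delta> \<beta>) = (of_int (int n) :: 'k)" using cart[OF d b] by simp
  then show False using c by (simp only: of_int_eq_iff)
qed

lemma cart_self: "\<beta> \<in> roots \<Longrightarrow> cart \<beta> \<beta> = 2"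
  using cart[of \<beta> \<beta>] coroot_self[of \<beta>] by (metis of_int_eq_iff of_int_numeral)

lemma cart_minus_right: "\<gamma> \<in> roots \<Longrightarrow> \<beta> \<in> roots \<Longrightarrow> cart \<gamma> (- \<beta>) = - cart \<gamma> \<beta>"
proof -
  assume g: "\<gamma> \<in> roots" and b: "\<beta> \<in> roots"
  have "\<gamma> (- coroot \<beta>) = - \<gamma> (coroot \<beta>)"
    using dual_scale[OF root_dual[OF g] coroot_T[OF b], of "-1"] by simp
  then have "of_int (cart \<gamma> (- \<beta>)) = (of_int (- cart \<gamma> \<beta>) :: 'k)"
    using cart[OF g b] cart[OF g root_minus[OF b]] by (simp add: coroot_minus[OF b])
  then show ?thesis by (simp only: of_int_eq_iff)
qed

text \<open>A vector of \<open>root_space \<beta>\<close> orthogonal to \<open>f\<close> commutes with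
  \<open>f\<close>, and then it is a highest weight vector of weight \<open>-2\<close> for the root
  \<open>- \<beta>\<close>, hence zero.\<close>

lemma root_space_one_dim:
  assumes b: "\<beta> \<in> roots" and x: "x \<in> root_space \<beta>" "x \<noteq> 0" and y: "y \<in> root_space \<beta>"
  shows "\<exists>c. y = scale c x"
proof -
  obtain f where f: "f \<in> root_space (- \<beta>)" "bracket x f = coroot \<beta>"
    using opposite_root_vector[OF b x] by blast
  have f0: "f \<noteq> 0" using f(2) coroot_nonzero[OF b] by auto
  have kxf: "killing x f \<noteq> 0"
  proof
    assume "killing x f = 0"
    then have "representer (fscale 0 \<beta>) = coroot \<beta>"
      using representer_eqI[OF bracket_opposite_represents[OF root_dual[OF b] x(1) f(1)]] f(2) by simp
    moreover have "representer (fscale 0 \<beta>) = 0"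
      using representer_eqI[OF represents_0] by (simp add: fscale_def zero_fun_def)
    ultimately show False using coroot_nonzero[OF b] by simp
  qed
  \<comment> \<open>subtracting this multiple of \<open>x\<close> makes \<open>y\<close> orthogonal to \<open>f\<close>\<close>
  define c where "c = killing y f / killing x f"
  let ?v = "y - scale c x"
  have v: "?v \<in> root_space \<beta>"
    using x y by (simp add: subspace_diff[OF root_space_subspace] subspace_scale[OF root_space_subspace])
  have "killing ?v f = 0" using kxf by (simp add: c_def killing_diff_left killing_scale_left)
  then have "represents (bracket ?v f) 0"
    using bracket_opposite_represents[OF root_dual[OF b] v f(1)] by (simp add: fscale_def zero_fun_def)
  then have "bracket ?v f = 0" using representer_eqI represents_0 by metis
  then have fv: "bracket f ?v = 0" using bracket_anti[of f ?v] by simp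
  have "?v = 0"
  proof (rule ccontr)
    assume "?v \<noteq> 0"
    then show False
      using negative_pairing_bracket[OF root_minus[OF b] b _ f(1) f0 v] fv cart_minus_right[OF b b] cart_self[OF b] by simp
  qed
  then show ?thesis by auto
qed

text \<open>Take the largest \<open>K\<close> such that \<open>K\<beta>\<close> is a root. Its root vectors are
  highest weight vectors of weight \<open>2K\<close>. Descending \<open>K - 1\<close> steps gives a
  nonzero multiple of \<open>e\<close>, which \<open>e\<close> kills, although the ladder formula
  says that it does not.\<close>

lemma multiple_not_root:
  assumes b: "\<beta> \<in> roots" and k: "k \<ge> 2"
  shows "fscale (of_nat k) \<beta> \<notin> roots"
proof
  assume kr: "fscale (of_nat k) \<beta> \<in> roots"
  let ?A = "{k::nat. fscale (of_nat k) \<beta> \<in> roots}"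
  have inj: "inj (\<lambda>k::nat. fscale (of_nat k) \<beta>)"
    using root_nonzero[OF b] by (auto simp: inj_def fun_eq_iff fscale_def)
  have "finite ?A" using finite_vimageI[OF finite_roots inj] by (simp add: vimage_def)
  define K where "K = Max ?A"
  have "K \<in> ?A" unfolding K_def using \<open>finite ?A\<close> kr by (intro Max_in) auto
  have K2: "K \<ge> 2" using Max_ge[OF \<open>finite ?A\<close>, of k] kr k by (simp add: K_def)
  have "Suc K \<notin> ?A" using Max_ge[OF \<open>finite ?A\<close>, of "Suc K"] by (auto simp: K_def)
  obtain v where v: "v \<in> root_space (fscale (of_nat K) \<beta>)" "v \<noteq> 0"
    using root_vector_exists \<open>K \<in> ?A\<close> by blast
  obtain e f where e: "e \<in> root_space \<beta>" "e \<noteq> 0" and f: "f \<in> root_space (- \<beta>)" and ef: "bracket e f = coroot \<beta>"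
    using sl2_triple_exists[OF b] by blast
  have Sd: "fscale (of_nat (Suc K)) \<beta> \<in> dual" and Kd: "fscale (of_nat K) \<beta> \<in> dual"
    using dual_closed(2)[OF root_dual[OF b]] by auto
  have "fscale (of_nat (Suc K)) \<beta> \<noteq> 0" using root_nonzero[OF b] by (auto simp: fun_eq_iff fscale_def simp del: of_nat_Suc)
  then have "root_space (fscale (of_nat (Suc K)) \<beta>) = {0}" using not_root_space[OF Sd] \<open>Suc K \<notin> ?A\<close> by simp
  moreover have "bracket e v \<in> root_space (\<beta> + fscale (of_nat K) \<beta>)" by (rule root_space_bracket[OF e(1) v(1)])
  moreover have "\<beta> + fscale (of_nat K) \<beta> = fscale (of_nat (Suc K)) \<beta>"
    by (simp add: fun_eq_iff fscale_def algebra_simps)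
  ultimately have ev: "bracket e v = 0" by simp
  obtain n where n: "fscale (of_nat K) \<beta> (coroot \<beta>) = of_nat n" "\<And>j. j \<le> n \<Longrightarrow> (bracket f ^^ j) v \<noteq> 0"
    using highest_weight_natural[OF b Kd e(1) f ef v ev] by blast
  have "of_nat n = (of_nat (2 * K) :: 'k)" using n(1) coroot_self[OF b] by (simp add: fscale_def mult.commute)
  then have n2: "n = 2 * K" by (simp only: of_nat_eq_iff)
  have "(bracket f ^^ (K - 1)) v \<in> root_space (fscale (of_nat K) \<beta> + fscale (of_nat (K - 1)) (- \<beta>))"
    by (rule root_space_funpow[OF f v(1)])
  moreover have "fscale (of_nat K) \<beta> + fscale (of_nat (K - 1)) (- \<beta>) = \<beta>"
    using K2 by (simp add: fun_eq_iff fscale_def of_nat_diff algebra_simps)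
  ultimately have "(bracket f ^^ (K - 1)) v \<in> root_space \<beta>" by simp
  then obtain c where "(bracket f ^^ (K - 1)) v = scale c e" using root_space_one_dim[OF b e] by blast
  then have 0: "bracket e ((bracket f ^^ (K - 1)) v) = 0" by (simp add: bracket_scale_right bracket_alternating)
  have hf: "bracket (coroot \<beta>) f = scale (- 2) f"
    using root_space_eigen[OF f coroot_T[OF b]] coroot_self[OF b] by simp
  obtain j where j: "K = Suc (Suc j)" using K2 by (metis Suc_le_D numeral_2_eq_2 add_2_eq_Suc le_Suc_ex)
  have m: "fscale (of_nat K) \<beta> (coroot \<beta>) = of_nat (2 * K)" using n(1) n2 by simp
  have "scale (of_nat (Suc j) * (of_nat (2 * K) - of_nat j)) ((bracket f ^^ j) v) = 0"
    using sl2_ladder(2)[OF hf ef root_space_eigen[OF v(1) coroot_T[OF b]] ev, of j] 0 j m by simp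
  moreover have "(of_nat (2 * K) - of_nat j :: 'k) \<noteq> 0"
  proof -
    have "2 * K \<noteq> j" using j by simp
    then have "(of_nat (2 * K) :: 'k) \<noteq> of_nat j" by (simp only: of_nat_eq_iff not_False_eq_True)
    then show ?thesis by simp
  qed
  moreover have "(bracket f ^^ j) v \<noteq> 0" using n(2) n2 j by simp
  ultimately show False by (simp del: of_nat_Suc)
qed

subsection \<open>Rationality and positivity\<close>

text \<open>Expanding \<open>(\<beta>, \<beta>) = \<kappa>(t\<^sub>\<beta>, t\<^sub>\<beta>)\<close> over the
  weights gives \<open>(\<beta>, \<beta>) = (\<beta>, \<beta>)\<^sup>2 M / 4\<close>, where
  \<open>M\<close> is a sum of squares of Cartan integers.\<close>

lemma form_root_self_positive:
  assumes b: "\<beta> \<in> roots"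
  shows "\<exists>r>0. form \<beta> \<beta> = of_rat r"
proof -
  define t where "t = representer \<beta>"
  have t: "represents t \<beta>" unfolding t_def by (rule representer[OF b])
  then have tT: "t \<in> T" by (simp add: represents_def)
  let ?q = "form \<beta> \<beta>"
  have q0: "?q \<noteq> 0" by (rule form_root_self_nonzero[OF b])
  \<comment> \<open>the weight \<open>0\<close> is not a root and contributes nothing\<close>
  define m where "m c = (if wt c = 0 then 0 else cart (wt c) \<beta>)" for c
  have w: "wt c t = of_int (m c) * ?q / 2" if c: "c \<in> wB" for c
  proof (cases "wt c = 0")
    case False
    then have r: "wt c \<in> roots" using wt_root[OF c] by simp
    have "2 / ?q * wt c t = of_int (m c)"
      using cart[OF r b] dual_scale[OF root_dual[OF r] tT] False by (simp add: coroot_def t_def m_def)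
    then show ?thesis using q0 by (simp add: field_simps)
  qed (simp add: m_def)
  have "?q = killing t t" by (simp add: form_def t_def)
  also have "\<dots> = (\<Sum>c\<in>wB. (of_int (m c * m c)) * (?q * ?q / 4))"
    unfolding killing_T[OF tT tT] by (intro sum.cong) (auto simp: w)
  also have "\<dots> = of_int (\<Sum>c\<in>wB. m c * m c) * (?q * ?q / 4)"
    by (simp add: sum_distrib_right)
  finally have eq: "?q = of_int (\<Sum>c\<in>wB. m c * m c) * (?q * ?q / 4)" .
  define M where "M = (\<Sum>c\<in>wB. m c * m c)"
  have "M \<ge> 0" unfolding M_def by (intro sum_nonneg) auto
  moreover have "M \<noteq> 0" using eq q0 by (auto simp: M_def[symmetric])
  ultimately have M: "M > 0" by simp
  have "of_int M * ?q = 4" using eq q0 by (simp add: M_def[symmetric] field_simps)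
  then have "?q = of_rat (4 / of_int M)" using M by (simp add: of_rat_divide field_simps)
  then show ?thesis using M by (intro exI[of _ "4 / of_int M"]) simp
qed

lemma form_commute: "form f g = form g f"
  by (simp add: form_def killing_commute)

lemma form_cart: "\<gamma> \<in> roots \<Longrightarrow> \<beta> \<in> roots \<Longrightarrow> form \<gamma> \<beta> = of_int (cart \<gamma> \<beta>) * form \<beta> \<beta> / 2"
  using cart[of \<gamma> \<beta>] root_coroot[of \<gamma> \<beta>] form_root_self_nonzero[of \<beta>] by (simp add: field_simps)

lemma cart_positive_commute:
  assumes "\<gamma> \<in> roots" "\<beta> \<in> roots" "cart \<gamma> \<beta> > 0"
  shows "cart \<beta> \<gamma> > 0"
proof -
  obtain r s where r: "r > 0" "form \<gamma> \<gamma> = of_rat r" and s: "s > 0" "form \<beta> \<beta> = of_rat s"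
    using form_root_self_positive assms by metis
  have "(of_rat (of_int (cart \<gamma> \<beta>) * s) :: 'k) = of_rat (of_int (cart \<beta> \<gamma>) * r)"
    using form_cart[OF assms(1,2)] form_cart[OF assms(2,1)] r s
    by (simp add: form_commute[of \<gamma> \<beta>] of_rat_mult)
  then have "of_int (cart \<gamma> \<beta>) * s = of_int (cart \<beta> \<gamma>) * r" by (simp only: of_rat_eq_iff)
  then show ?thesis using r(1) s(1) assms(3) by (metis mult_pos_pos of_int_0_less_iff zero_less_mult_pos2)
qed

end

section \<open>Simple roots, heights and the highest root\<close>

context cartan_simple_lie_algebra
begin

lemma root_sum:
  assumes g: "\<gamma> \<in> roots" and b: "\<beta> \<in> roots" and c: "cart \<gamma> \<beta> < 0" and ne: "\<gamma> + \<beta> \<noteq> 0"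
  shows "\<gamma> + \<beta> \<in> roots"
proof (rule ccontr)
  assume n: "\<gamma> + \<beta> \<notin> roots"
  obtain e v where e: "e \<in> root_space \<beta>" "e \<noteq> 0" and v: "v \<in> root_space \<gamma>" "v \<noteq> 0"
    using root_vector_exists g b by metis
  have "bracket e v \<in> root_space (\<beta> + \<gamma>)" by (rule root_space_bracket[OF e(1) v(1)])
  moreover have "root_space (\<gamma> + \<beta>) = {0}"
    by (rule not_root_space[OF dual_closed(1)[OF root_dual[OF g] root_dual[OF b]] ne n])
  ultimately have "bracket e v = 0" by (simp add: add.commute)
  then show False using negative_pairing_bracket[OF b g c e v] by simp
qed

lemma cart_minus_left: "\<gamma> \<in> roots \<Longrightarrow> \<beta> \<in> roots \<Longrightarrow> cart (- \<gamma>) \<beta> = - cart \<gamma> \<beta>"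
proof -
  assume g: "\<gamma> \<in> roots" and b: "\<beta> \<in> roots"
  have "of_int (cart (- \<gamma>) \<beta>) = (of_int (- cart \<gamma> \<beta>) :: 'k)"
    using cart[OF g b] cart[OF root_minus[OF g] b] by simp
  then show ?thesis by (simp only: of_int_eq_iff)
qed

lemma root_diff:
  assumes g: "\<gamma> \<in> roots" and b: "\<beta> \<in> roots" and c: "cart \<gamma> \<beta> > 0" and ne: "\<gamma> \<noteq> \<beta>"
  shows "\<gamma> - \<beta> \<in> roots"
  using root_sum[OF g root_minus[OF b]] c ne by (simp add: cart_minus_right[OF g b])

text \<open>If \<open>[e, u] = 0\<close>, then by invariance \<open>u\<close> is orthogonal to \<open>[e,
  v]\<close> for \<open>v\<close> in \<open>root_space (- \<gamma>)\<close>. But \<open>[e,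
  v]\<close> is nonzero and spans the line that pairs with \<open>u\<close>.\<close>

lemma positive_pairing_bracket:
  assumes g: "\<gamma> \<in> roots" and b: "\<beta> \<in> roots" and c: "cart \<gamma> \<beta> > 0" and d: "\<gamma> - \<beta> \<in> roots"
    and e: "e \<in> root_space \<beta>" "e \<noteq> 0" and u: "u \<in> root_space (\<gamma> - \<beta>)" "u \<noteq> 0"
  shows "bracket e u \<noteq> 0"
proof
  assume eu: "bracket e u = 0"
  obtain v where v: "v \<in> root_space (- \<gamma>)" "v \<noteq> 0" using root_vector_exists[OF root_minus[OF g]] by blast
  have w0: "bracket e v \<noteq> 0"
    using negative_pairing_bracket[OF b root_minus[OF g] _ e v] c by (simp add: cart_minus_left[OF g b])
  have "bracket e v \<in> root_space (\<beta> + - \<gamma>)" by (rule root_space_bracket[OF e(1) v(1)])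
  then have w: "bracket e v \<in> root_space (- (\<gamma> - \<beta>))" by simp
  obtain y where y: "y \<in> root_space (- (\<gamma> - \<beta>))" "killing u y = 1"
    using root_space_pairing[OF root_dual[OF d] u] by blast
  obtain k where "y = scale k (bracket e v)" using root_space_one_dim[OF root_minus[OF d] w w0 y(1)] by blast
  then have "killing u y = k * killing (bracket u e) v" by (simp add: killing_scale_right killing_invariant)
  also have "bracket u e = 0" using eu bracket_anti[of u e] by simp
  finally show False using y(2) by simp
qed

lemma cart_reflection:
  assumes g: "\<gamma> \<in> roots" and b: "\<beta> \<in> roots"
  shows "cart (\<gamma> - fscale (of_int (cart \<gamma> \<beta>)) \<beta>) \<beta> = - cart \<gamma> \<beta>"
proof -
  have "of_int (cart (\<gamma> - fscale (of_int (cart \<gamma> \<beta>)) \<beta>) \<beta>) = (of_int (- cart \<gamma> \<beta>) :: 'k)"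
    using cart[OF reflection_root[OF g b] b] cart[OF g b] coroot_self[OF b] by (simp add: fscale_def)
  then show ?thesis by (simp only: of_int_eq_iff)
qed

text \<open>The reflection in \<open>\<beta>\<close> permutes the set and changes the sign of each summand.\<close>

lemma sum_cart_reflection_closed:
  assumes G: "G \<subseteq> roots" and b: "\<beta> \<in> roots"
    and cl: "\<And>\<gamma>. \<gamma> \<in> G \<Longrightarrow> \<gamma> - fscale (of_int (cart \<gamma> \<beta>)) \<beta> \<in> G"
  shows "(\<Sum>\<gamma>\<in>G. cart \<gamma> \<beta>) = 0"
proof -
  define s where "s \<gamma> = \<gamma> - fscale (of_int (cart \<gamma> \<beta>)) \<beta>" for \<gamma>
  have cs: "cart (s \<gamma>) \<beta> = - cart \<gamma> \<beta>" if "\<gamma> \<in> G" for \<gamma>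
    using cart_reflection[of \<gamma>, OF _ b] G that by (auto simp: s_def)
  have inv: "s (s \<gamma>) = \<gamma>" if "\<gamma> \<in> G" for \<gamma>
  proof -
    have "s (s \<gamma>) = s \<gamma> - fscale (of_int (- cart \<gamma> \<beta>)) \<beta>"
      by (simp only: s_def[of "s \<gamma>"] cs[OF that])
    then show ?thesis by (simp add: s_def)
  qed
  have sG: "s \<gamma> \<in> G" if "\<gamma> \<in> G" for \<gamma> using cl[OF that] by (simp add: s_def)
  have "(\<Sum>\<gamma>\<in>G. cart \<gamma> \<beta>) = (\<Sum>\<gamma>\<in>G. - cart \<gamma> \<beta>)"
    by (rule sum.reindex_bij_witness[of _ s s]) (simp_all add: inv sG cs)
  then show ?thesis by (simp add: sum_negf)
qed

end

context based_simple_lie_algebra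
begin

lemma simple_root: "\<beta> \<in> simples \<Longrightarrow> \<beta> \<in> roots"
  using simple_system by (auto simp: simple_system_def)
lemma finite_simples: "finite simples"
  using finite_subset[of simples roots] simple_root finite_roots by blast
lemma simples_independent: "functional.independent simples"
  and simples_span: "functional.span simples = dual"
  using simple_system by (auto simp: simple_system_def)

text \<open>Integer combinations of simple roots, so that heights become coordinates.\<close>

definition comb :: "(('g \<Rightarrow> 'k) \<Rightarrow> int) \<Rightarrow> 'g \<Rightarrow> 'k" where
  "comb n = (\<Sum>\<beta>\<in>simples. fscale (of_int (n \<beta>)) \<beta>)"

lemma comb_add: "comb (\<lambda>\<beta>. n \<beta> + m \<beta>) = comb n + comb m"
  by (simp add: comb_def functional.scale_left_distrib sum.distrib)
lemma comb_minus: "comb (\<lambda>\<beta>. - n \<beta>) = - comb n"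
  by (simp add: comb_def sum_negf)
lemma comb_diff: "comb (\<lambda>\<beta>. n \<beta> - m \<beta>) = comb n - comb m"
  using comb_add[of n "\<lambda>\<beta>. - m \<beta>"] by (simp add: comb_minus)
lemma comb_scale: "comb (\<lambda>\<beta>. c * n \<beta>) = fscale (of_int c) (comb n)"
  by (simp add: comb_def functional.scale_sum_right)
lemma comb_apply: "comb n h = (\<Sum>\<beta>\<in>simples. of_int (n \<beta>) * \<beta> h)"
proof -
  have "(\<Sum>\<beta>\<in>A. fscale (of_int (n \<beta>)) \<beta>) h = (\<Sum>\<beta>\<in>A. of_int (n \<beta>) * \<beta> h)" for A :: "('g \<Rightarrow> 'k) set"
    by (induction A rule: infinite_finite_induct) (auto simp: fscale_def)
  then show ?thesis by (simp add: comb_def)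
qed

lemma comb_cong: "(\<And>\<beta>. \<beta> \<in> simples \<Longrightarrow> n \<beta> = m \<beta>) \<Longrightarrow> comb n = comb m"
  unfolding comb_def by (rule sum.cong) simp_all

lemma comb_inject:
  assumes "comb n = comb m" "\<beta> \<in> simples"
  shows "n \<beta> = m \<beta>"
proof -
  have "comb (\<lambda>\<beta>. n \<beta> - m \<beta>) = 0" using assms(1) by (simp add: comb_diff)
  then have "(\<Sum>\<beta>\<in>simples. fscale (of_int (n \<beta> - m \<beta>)) \<beta>) = 0" unfolding comb_def .
  from functional.independentD[OF simples_independent finite_simples subset_refl this assms(2)]
  show ?thesis by simp
qed

lemma ht_comb: "\<beta> \<in> simples \<Longrightarrow> ht \<beta> (comb n) = n \<beta>"
  unfolding ht_def
proof (rule the_equality)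
  show "\<exists>m. comb n = (\<Sum>\<beta>\<in>simples. fscale (of_int (m \<beta>)) \<beta>) \<and> n \<beta> = m \<beta>"
    by (auto simp: comb_def)
next
  fix k assume b: "\<beta> \<in> simples" and "\<exists>m. comb n = (\<Sum>\<beta>\<in>simples. fscale (of_int (m \<beta>)) \<beta>) \<and> k = m \<beta>"
  then obtain m where "comb n = comb m" "k = m \<beta>" unfolding comb_def by blast
  then show "k = n \<beta>" using comb_inject b by metis
qed

definition lattice :: "('g \<Rightarrow> 'k) set" where
  "lattice = range comb"

lemma comb_ht: "\<gamma> \<in> lattice \<Longrightarrow> comb (\<lambda>\<beta>. ht \<beta> \<gamma>) = \<gamma>"
proof -
  assume "\<gamma> \<in> lattice"
  then obtain n where n: "\<gamma> = comb n" by (auto simp: lattice_def)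
  have "comb (\<lambda>\<beta>. ht \<beta> (comb n)) = comb n" by (rule comb_cong) (rule ht_comb)
  then show ?thesis by (simp add: n)
qed

lemma lattice_add: "\<gamma> \<in> lattice \<Longrightarrow> \<delta> \<in> lattice \<Longrightarrow> \<gamma> + \<delta> \<in> lattice"
  and ht_add: "\<gamma> \<in> lattice \<Longrightarrow> \<delta> \<in> lattice \<Longrightarrow> \<beta> \<in> simples \<Longrightarrow> ht \<beta> (\<gamma> + \<delta>) = ht \<beta> \<gamma> + ht \<beta> \<delta>"
  and lattice_minus: "\<gamma> \<in> lattice \<Longrightarrow> - \<gamma> \<in> lattice"
  and ht_minus: "\<gamma> \<in> lattice \<Longrightarrow> \<beta> \<in> simples \<Longrightarrow> ht \<beta> (- \<gamma>) = - ht \<beta> \<gamma>"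
  and lattice_diff: "\<gamma> \<in> lattice \<Longrightarrow> \<delta> \<in> lattice \<Longrightarrow> \<gamma> - \<delta> \<in> lattice"
  and ht_diff: "\<gamma> \<in> lattice \<Longrightarrow> \<delta> \<in> lattice \<Longrightarrow> \<beta> \<in> simples \<Longrightarrow> ht \<beta> (\<gamma> - \<delta>) = ht \<beta> \<gamma> - ht \<beta> \<delta>"
  and lattice_scale: "\<gamma> \<in> lattice \<Longrightarrow> fscale (of_int c) \<gamma> \<in> lattice"
  and ht_scale: "\<gamma> \<in> lattice \<Longrightarrow> \<beta> \<in> simples \<Longrightarrow> ht \<beta> (fscale (of_int c) \<gamma>) = c * ht \<beta> \<gamma>"
  by (auto simp: lattice_def comb_add[symmetric] comb_minus[symmetric] comb_diff[symmetric]
      comb_scale[symmetric] ht_comb)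

lemma lattice_0: "0 \<in> lattice" and ht_0: "\<beta> \<in> simples \<Longrightarrow> ht \<beta> 0 = 0"
proof -
  have 0: "comb (\<lambda>_. 0) = 0" by (simp add: comb_def)
  then show "0 \<in> lattice" unfolding lattice_def by (metis rangeI)
  show "\<beta> \<in> simples \<Longrightarrow> ht \<beta> 0 = 0" using ht_comb[of \<beta> "\<lambda>_. 0"] by (simp add: 0)
qed

lemma lattice_eqI:
  assumes "\<gamma> \<in> lattice" "\<delta> \<in> lattice" "\<And>\<beta>. \<beta> \<in> simples \<Longrightarrow> ht \<beta> \<gamma> = ht \<beta> \<delta>"
  shows "\<gamma> = \<delta>"
proof -
  have "comb (\<lambda>\<beta>. ht \<beta> \<gamma>) = comb (\<lambda>\<beta>. ht \<beta> \<delta>)" by (rule comb_cong) (rule assms(3))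
  then show ?thesis by (simp only: comb_ht[OF assms(1)] comb_ht[OF assms(2)])
qed

lemma nonneg_comb_iff: "\<gamma> \<in> nonneg_comb simples \<longleftrightarrow> \<gamma> \<in> lattice \<and> (\<forall>\<beta>\<in>simples. 0 \<le> ht \<beta> \<gamma>)"
proof
  assume "\<gamma> \<in> nonneg_comb simples"
  then obtain n :: "('g \<Rightarrow> 'k) \<Rightarrow> nat" where "\<gamma> = comb (\<lambda>\<beta>. int (n \<beta>))"
    by (auto simp: nonneg_comb_def comb_def)
  then show "\<gamma> \<in> lattice \<and> (\<forall>\<beta>\<in>simples. 0 \<le> ht \<beta> \<gamma>)" by (auto simp: ht_comb lattice_def)
next
  assume a: "\<gamma> \<in> lattice \<and> (\<forall>\<beta>\<in>simples. 0 \<le> ht \<beta> \<gamma>)"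
  then have "\<gamma> = (\<Sum>\<beta>\<in>simples. fscale (of_nat (nat (ht \<beta> \<gamma>))) \<beta>)"
    using comb_ht[of \<gamma>] unfolding comb_def by (simp cong: sum.cong)
  then show "\<gamma> \<in> nonneg_comb simples" unfolding nonneg_comb_def by (auto intro!: exI[of _ "\<lambda>\<beta>. nat (ht \<beta> \<gamma>)"])
qed

lemma root_sign: "\<gamma> \<in> roots \<Longrightarrow> \<gamma> \<in> pos_roots \<or> - \<gamma> \<in> pos_roots"
  using simple_system root_minus by (auto simp: simple_system_def pos_roots_def)

lemma root_lattice: "\<gamma> \<in> roots \<Longrightarrow> \<gamma> \<in> lattice"
  using root_sign[of \<gamma>] lattice_minus[of "- \<gamma>"] by (auto simp: pos_roots_def nonneg_comb_iff)

lemma pos_root: "\<gamma> \<in> pos_roots \<Longrightarrow> \<gamma> \<in> roots" and pos_ht: "\<gamma> \<in> pos_roots \<Longrightarrow> \<beta> \<in> simples \<Longrightarrow> 0 \<le> ht \<beta> \<gamma>"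
  by (auto simp: pos_roots_def nonneg_comb_iff)

lemma pos_rootI:
  assumes "\<gamma> \<in> roots" "\<beta> \<in> simples" "ht \<beta> \<gamma> > 0"
  shows "\<gamma> \<in> pos_roots"
proof (rule ccontr)
  assume "\<gamma> \<notin> pos_roots"
  then have "- \<gamma> \<in> pos_roots" using root_sign assms(1) by blast
  from pos_ht[OF this assms(2)] show False using assms ht_minus[OF root_lattice] by simp
qed

lemma simple_comb: "\<alpha> \<in> simples \<Longrightarrow> comb (\<lambda>\<beta>. if \<beta> = \<alpha> then 1 else 0) = \<alpha>"
proof -
  assume a: "\<alpha> \<in> simples"
  have "comb (\<lambda>\<beta>. if \<beta> = \<alpha> then 1 else 0) = (\<Sum>\<beta>\<in>simples. if \<beta> = \<alpha> then \<beta> else 0)"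
    unfolding comb_def by (intro sum.cong) (auto simp: fscale_def zero_fun_def)
  then show ?thesis using a finite_simples by simp
qed

lemma ht_simple: "\<alpha> \<in> simples \<Longrightarrow> \<beta> \<in> simples \<Longrightarrow> ht \<beta> \<alpha> = (if \<beta> = \<alpha> then 1 else 0)"
  using ht_comb[of \<beta> "\<lambda>\<beta>. if \<beta> = \<alpha> then 1 else 0"] simple_comb[of \<alpha>] by simp

lemma simple_pos: "\<alpha> \<in> simples \<Longrightarrow> \<alpha> \<in> pos_roots"
  using pos_rootI[OF simple_root] ht_simple by fastforce

text \<open>Otherwise \<open>\<gamma>\<close> would be a multiple of \<open>\<alpha>\<close>.\<close>

lemma pos_other_ht:
  assumes g: "\<gamma> \<in> pos_roots" and a: "\<alpha> \<in> simples" and ne: "\<gamma> \<noteq> \<alpha>"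
  shows "\<exists>\<beta>\<in>simples. \<beta> \<noteq> \<alpha> \<and> ht \<beta> \<gamma> > 0"
proof (rule ccontr)
  assume "\<not> ?thesis"
  then have z: "ht \<beta> \<gamma> = 0" if "\<beta> \<in> simples" "\<beta> \<noteq> \<alpha>" for \<beta>
    using pos_ht[OF g that(1)] that by force
  note l = root_lattice[OF pos_root[OF g]] and la = root_lattice[OF simple_root[OF a]]
  have eq: "\<gamma> = fscale (of_int (ht \<alpha> \<gamma>)) \<alpha>"
    by (rule lattice_eqI[OF l lattice_scale[OF la]]) (use z a in \<open>auto simp: ht_scale[OF la] ht_simple\<close>)
  have "ht \<alpha> \<gamma> \<noteq> 0" using eq root_nonzero[OF pos_root[OF g]] by (auto simp: fscale_def zero_fun_def)
  moreover have "ht \<alpha> \<gamma> \<noteq> 1" using eq ne by (auto simp: fscale_def)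
  ultimately have "ht \<alpha> \<gamma> \<ge> 2" using pos_ht[OF g a] by linarith
  then have "2 \<le> nat (ht \<alpha> \<gamma>)" "(of_nat (nat (ht \<alpha> \<gamma>)) :: 'k) = of_int (ht \<alpha> \<gamma>)" by simp_all
  then show False using multiple_not_root[OF simple_root[OF a], of "nat (ht \<alpha> \<gamma>)"] eq pos_root[OF g] by simp
qed

lemma cart_comb:
  assumes "\<gamma> \<in> roots" "\<beta> \<in> roots"
  shows "cart \<gamma> \<beta> = (\<Sum>\<delta>\<in>simples. ht \<delta> \<gamma> * cart \<delta> \<beta>)"
proof -
  have "of_int (cart \<gamma> \<beta>) = comb (\<lambda>\<delta>. ht \<delta> \<gamma>) (coroot \<beta>)"
    using cart[OF assms] comb_ht[OF root_lattice[OF assms(1)]] by simp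
  also have "\<dots> = (\<Sum>\<delta>\<in>simples. of_int (ht \<delta> \<gamma> * cart \<delta> \<beta>))"
    unfolding comb_apply by (intro sum.cong) (auto simp: cart[OF simple_root assms(2)])
  also have "\<dots> = (of_int (\<Sum>\<delta>\<in>simples. ht \<delta> \<gamma> * cart \<delta> \<beta>) :: 'k)" by simp
  finally show ?thesis by (simp only: of_int_eq_iff)
qed

text \<open>In \<open>2 = \<langle>\<gamma>, \<gamma>\<rangle> = \<Sum> n\<^sub>\<beta> \<langle>\<beta>,
  \<gamma>\<rangle>\<close> some summand is positive; subtracting that \<open>\<beta>\<close> leaves
  a root, with another coordinate still positive.\<close>

lemma simple_descent:
  assumes g: "\<gamma> \<in> pos_roots" and ns: "\<gamma> \<notin> simples"
  shows "\<exists>\<beta>\<in>simples. cart \<gamma> \<beta> > 0 \<and> \<gamma> - \<beta> \<in> pos_roots"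
proof -
  have gr: "\<gamma> \<in> roots" by (rule pos_root[OF g])
  have "\<exists>\<beta>\<in>simples. ht \<beta> \<gamma> * cart \<beta> \<gamma> > 0"
  proof (rule ccontr)
    assume "\<not> ?thesis"
    then have "(\<Sum>\<beta>\<in>simples. ht \<beta> \<gamma> * cart \<beta> \<gamma>) \<le> 0" by (intro sum_nonpos) auto
    then show False using cart_comb[OF gr gr] cart_self[OF gr] by simp
  qed
  then obtain \<beta> where b: "\<beta> \<in> simples" "ht \<beta> \<gamma> * cart \<beta> \<gamma> > 0" by blast
  then have "cart \<beta> \<gamma> > 0" using pos_ht[OF g b(1)] by (simp add: zero_less_mult_iff)
  then have c: "cart \<gamma> \<beta> > 0" by (rule cart_positive_commute[OF simple_root[OF b(1)] gr])
  have ne: "\<gamma> \<noteq> \<beta>" using b ns by blast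
  have d: "\<gamma> - \<beta> \<in> roots" by (rule root_diff[OF gr simple_root[OF b(1)] c ne])
  obtain \<beta>' where b': "\<beta>' \<in> simples" "\<beta>' \<noteq> \<beta>" "ht \<beta>' \<gamma> > 0" using pos_other_ht[OF g b(1) ne] by blast
  have "ht \<beta>' (\<gamma> - \<beta>) > 0"
    using b' b(1) by (simp add: ht_diff root_lattice gr simple_root ht_simple)
  then show ?thesis using pos_rootI[OF d b'(1)] b(1) c by blast
qed

lemma simple_cart_nonpos:
  assumes "\<alpha> \<in> simples" "\<beta> \<in> simples" "\<alpha> \<noteq> \<beta>"
  shows "cart \<alpha> \<beta> \<le> 0"
proof (rule ccontr)
  assume "\<not> ?thesis"
  then have d: "\<alpha> - \<beta> \<in> roots" using root_diff assms simple_root by auto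
  have h: "ht \<alpha> (\<alpha> - \<beta>) = 1" "ht \<beta> (\<alpha> - \<beta>) = - 1"
    using assms by (auto simp: ht_diff root_lattice simple_root ht_simple)
  from pos_rootI[OF d assms(1)] h have "\<alpha> - \<beta> \<in> pos_roots" by simp
  from pos_ht[OF this assms(2)] show False using h by simp
qed

definition height :: "('g \<Rightarrow> 'k) \<Rightarrow> int" where
  "height \<gamma> = (\<Sum>\<beta>\<in>simples. ht \<beta> \<gamma>)"

lemma height_diff_simple: "\<gamma> \<in> lattice \<Longrightarrow> \<beta> \<in> simples \<Longrightarrow> height (\<gamma> - \<beta>) = height \<gamma> - 1"
proof -
  assume g: "\<gamma> \<in> lattice" and b: "\<beta> \<in> simples"
  have "height (\<gamma> - \<beta>) = (\<Sum>\<delta>\<in>simples. ht \<delta> \<gamma> - (if \<delta> = \<beta> then 1 else 0))"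
    unfolding height_def by (rule sum.cong) (simp_all add: ht_diff g b root_lattice simple_root ht_simple)
  then show ?thesis using finite_simples b by (simp add: height_def sum_subtractf)
qed

lemma height_add_simple: "\<gamma> \<in> lattice \<Longrightarrow> \<beta> \<in> simples \<Longrightarrow> height (\<gamma> + \<beta>) = height \<gamma> + 1"
  using height_diff_simple[of "\<gamma> + \<beta>" \<beta>] by (simp add: lattice_add root_lattice simple_root)

lemma height_nonneg: "\<gamma> \<in> pos_roots \<Longrightarrow> 0 \<le> height \<gamma>"
  unfolding height_def using pos_ht by (intro sum_nonneg) auto

lemma pos_root_induct [consumes 1, case_names simple add]:
  assumes g: "\<gamma> \<in> pos_roots"
    and s: "\<And>\<beta>. \<beta> \<in> simples \<Longrightarrow> P \<beta>"
    and a: "\<And>\<gamma> \<beta>. \<gamma> \<in> pos_roots \<Longrightarrow> \<beta> \<in> simples \<Longrightarrow> cart \<gamma> \<beta> > 0 \<Longrightarrow> \<gamma> - \<beta> \<in> pos_roots \<Longrightarrow> P (\<gamma> - \<beta>) \<Longrightarrow> P \<gamma>"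
  shows "P \<gamma>"
  using g
proof (induction "nat (height \<gamma>)" arbitrary: \<gamma> rule: less_induct)
  case less
  show ?case
  proof (cases "\<gamma> \<in> simples")
    case False
    then obtain \<beta> where b: "\<beta> \<in> simples" "cart \<gamma> \<beta> > 0" "\<gamma> - \<beta> \<in> pos_roots"
      using simple_descent[OF less.prems] by blast
    have "height (\<gamma> - \<beta>) = height \<gamma> - 1" by (rule height_diff_simple[OF root_lattice[OF pos_root[OF less.prems]] b(1)])
    then have "nat (height (\<gamma> - \<beta>)) < nat (height \<gamma>)" using height_nonneg[OF b(3)] by simp
    from less.hyps[OF this b(3)] show ?thesis using a[OF less.prems b] by blast
  qed (rule s)
qed

text \<open>By descent along simple roots, the brackets of simple root vectors reach every root space.\<close>

lemma root_spaces_generated: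
  assumes S: "subspace S" and br: "\<And>x y. x \<in> S \<Longrightarrow> y \<in> S \<Longrightarrow> bracket x y \<in> S" and TS: "T \<subseteq> S"
    and pos: "\<And>\<beta>. \<beta> \<in> simples \<Longrightarrow> root_space \<beta> \<subseteq> S" and neg: "\<And>\<beta>. \<beta> \<in> simples \<Longrightarrow> root_space (- \<beta>) \<subseteq> S"
  shows "S = UNIV"
proof -
  have step: "root_space \<gamma> \<subseteq> S"
    if g: "\<gamma> \<in> roots" and b: "\<beta> \<in> roots" and c: "cart \<gamma> \<beta> > 0" and d: "\<gamma> - \<beta> \<in> roots"
      and sb: "root_space \<beta> \<subseteq> S" and sd: "root_space (\<gamma> - \<beta>) \<subseteq> S" for \<gamma> \<beta>
  proof
    fix y assume y: "y \<in> root_space \<gamma>"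
    obtain e u where e: "e \<in> root_space \<beta>" "e \<noteq> 0" and u: "u \<in> root_space (\<gamma> - \<beta>)" "u \<noteq> 0"
      using root_vector_exists b d by metis
    have "bracket e u \<in> root_space (\<beta> + (\<gamma> - \<beta>))" by (rule root_space_bracket[OF e(1) u(1)])
    then have "bracket e u \<in> root_space \<gamma>" by simp
    then obtain k where "y = scale k (bracket e u)"
      using root_space_one_dim[OF g _ positive_pairing_bracket[OF g b c d e u] y] by blast
    moreover have "bracket e u \<in> S" using e u sb sd br by blast
    ultimately show "y \<in> S" using S subspace_scale by blast
  qed
  have P: "root_space \<gamma> \<subseteq> S \<and> root_space (- \<gamma>) \<subseteq> S" if "\<gamma> \<in> pos_roots" for \<gamma>
    using that
  proof (induction rule: pos_root_induct)
    case (simple \<beta>)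
    then show ?case using pos neg by blast
  next
    case (add \<gamma> \<beta>)
    note r = pos_root[OF add.hyps(1)] simple_root[OF add.hyps(2)] pos_root[OF add.hyps(4)]
    have "root_space \<gamma> \<subseteq> S" by (rule step[OF r(1,2) add.hyps(3) r(3)]) (use add.IH pos[OF add.hyps(2)] in blast)+
    moreover have "root_space (- \<gamma>) \<subseteq> S"
    proof (rule step[OF root_minus[OF r(1)] root_minus[OF r(2)]])
      show "cart (- \<gamma>) (- \<beta>) > 0"
        using add.hyps(3) by (simp add: cart_minus_left[OF r(1) root_minus[OF r(2)]] cart_minus_right[OF r(1,2)])
      have eq: "- \<gamma> - - \<beta> = - (\<gamma> - \<beta>)" by simp
      show "- \<gamma> - - \<beta> \<in> roots" unfolding eq by (rule root_minus[OF r(3)])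
      show "root_space (- \<gamma> - - \<beta>) \<subseteq> S" unfolding eq using add.IH by blast
    qed (rule neg[OF add.hyps(2)])
    ultimately show ?case by blast
  qed
  have "root_space \<gamma> \<subseteq> S" if "\<gamma> \<in> roots" for \<gamma>
    using root_sign[OF that] P[of \<gamma>] P[of "- \<gamma>"] by auto
  then have "span (T \<union> (\<Union>\<gamma>\<in>roots. root_space \<gamma>)) \<subseteq> S"
    using TS by (intro span_minimal S) auto
  then show ?thesis using root_decomposition by auto
qed

lemma lattice_dual: "\<gamma> \<in> lattice \<Longrightarrow> \<gamma> \<in> dual"
  unfolding lattice_def comb_def using root_dual[OF simple_root] by (auto intro!: dual_closed)

text \<open>The vectors obtained from \<open>v\<close> by lowering with negative simple root vectors.\<close>

inductive_set lowered :: "'g \<Rightarrow> 'g set" for v where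
  start: "v \<in> lowered v"
| lower: "x \<in> lowered v \<Longrightarrow> \<beta> \<in> simples \<Longrightarrow> f \<in> root_space (- \<beta>) \<Longrightarrow> bracket f x \<in> lowered v"

text \<open>The span \<open>M\<close> of the lowered vectors is stable under \<open>T\<close>, under the
  negative simple root spaces by construction, and under the positive ones because \<open>v\<close>
  is killed by them. These generate the algebra, so \<open>M\<close> is a nonzero ideal, that is,
  everything. All weights occurring in \<open>M\<close> are obtained from \<open>\<theta>\<close> by
  subtracting simple roots.\<close>

lemma highest_weight_root_dominates:
  assumes t: "\<theta> \<in> pos_roots" and v: "v \<in> root_space \<theta>" "v \<noteq> 0"
    and max: "\<And>\<beta> e. \<beta> \<in> simples \<Longrightarrow> e \<in> root_space \<beta> \<Longrightarrow> bracket e v = 0" and g: "\<gamma> \<in> roots"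
  shows "\<theta> - \<gamma> \<in> nonneg_comb simples"
proof -
  define P where "P = {\<mu>. \<theta> - \<mu> \<in> nonneg_comb simples}"
  have Pl: "\<mu> \<in> lattice" if "\<mu> \<in> P" for \<mu>
  proof -
    have "\<theta> - \<mu> \<in> lattice" using that by (auto simp: P_def nonneg_comb_iff)
    then have "\<theta> - (\<theta> - \<mu>) \<in> lattice" by (rule lattice_diff[OF root_lattice[OF pos_root[OF t]]])
    then show ?thesis by simp
  qed
  have wtx: "\<exists>\<mu>\<in>P. x \<in> root_space \<mu>" if "x \<in> lowered v" for x
    using that
  proof induction
    case start
    have "\<theta> \<in> P" by (auto simp: P_def nonneg_comb_iff lattice_0 ht_0)
    then show ?case using v by blast
  next
    case (lower x \<beta> f)
    then obtain \<mu> where m: "\<mu> \<in> P" "x \<in> root_space \<mu>" by blast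
    have "\<theta> - \<mu> + \<beta> \<in> nonneg_comb simples"
      using m(1) lower.hyps by (auto simp: P_def nonneg_comb_iff lattice_add ht_add root_lattice simple_root ht_simple)
    moreover have "\<theta> - (- \<beta> + \<mu>) = \<theta> - \<mu> + \<beta>" by simp
    ultimately have "- \<beta> + \<mu> \<in> P" unfolding P_def by (simp only: mem_Collect_eq)
    then show ?case using root_space_bracket[OF lower.hyps(3) m(2)] by blast
  qed
  define M where "M = span (lowered v)"
  have Ms: "subspace M" by (simp add: M_def)
  \<comment> \<open>the stabilizer of \<open>M\<close>, a subalgebra\<close>
  define S where "S = {x. \<forall>m\<in>M. bracket x m \<in> M}"
  have SI: "x \<in> S" if "\<And>m. m \<in> lowered v \<Longrightarrow> bracket x m \<in> M" for x
  proof -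
    have "bracket x m \<in> M" if "m \<in> span (lowered v)" for m
      using that
      by (induction rule: span_induct_alt)
        (use \<open>\<And>m. m \<in> lowered v \<Longrightarrow> bracket x m \<in> M\<close> in \<open>auto simp: bracket_add_right bracket_scale_right
          subspace_0[OF Ms] subspace_add[OF Ms] subspace_scale[OF Ms]\<close>)
    then show ?thesis by (simp add: S_def M_def)
  qed
  have TS: "T \<subseteq> S"
  proof
    fix h assume h: "h \<in> T"
    show "h \<in> S"
    proof (rule SI)
      fix m assume m: "m \<in> lowered v"
      then obtain \<mu> where "m \<in> root_space \<mu>" using wtx by blast
      then show "bracket h m \<in> M" using m h by (simp add: root_space_eigen M_def span_scale span_base)
    qed
  qed
  have neg: "root_space (- \<beta>) \<subseteq> S" if b: "\<beta> \<in> simples" for \<beta>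
    using b by (auto intro!: SI span_base lower simp: M_def)
  have pos: "root_space \<beta> \<subseteq> S" if b: "\<beta> \<in> simples" for \<beta>
  proof
    fix e assume e: "e \<in> root_space \<beta>"
    show "e \<in> S"
    proof (rule SI)
      fix m assume "m \<in> lowered v"
      then show "bracket e m \<in> M"
      proof induction
        case start
        have "bracket e v = 0" by (rule max[OF b e])
        then show ?case using subspace_0[OF Ms] by simp
      next
        case (lower x \<beta>' f)
        have "bracket (bracket e f) x \<in> M"
        proof (cases "\<beta>' = \<beta>")
          case True
          then have "bracket e f \<in> T" using root_space_bracket[OF e lower.hyps(3)] by (simp add: root_space_0)
          then have "bracket e f \<in> S" using TS by blast
          then show ?thesis using lower.hyps by (auto simp: S_def M_def span_base)
        next
          case False
          have nr: "\<beta> + - \<beta>' \<notin> roots"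
          proof
            assume r: "\<beta> + - \<beta>' \<in> roots"
            have h: "ht \<beta> (\<beta> - \<beta>') = 1" "ht \<beta>' (\<beta> - \<beta>') = - 1"
              using b lower.hyps(2) False by (auto simp: ht_diff root_lattice simple_root ht_simple)
            from pos_rootI[of "\<beta> - \<beta>'", OF _ b] h r have "\<beta> - \<beta>' \<in> pos_roots" by simp
            from pos_ht[OF this lower.hyps(2)] show False using h by simp
          qed
          have "\<beta> + - \<beta>' \<noteq> 0" using False by simp
          then have "root_space (\<beta> + - \<beta>') = {0}"
            using not_root_space[OF dual_closed(1)[OF root_dual dual_closed(3)[OF root_dual]] _ nr]
              simple_root[OF b] simple_root[OF lower.hyps(2)] by blast
          then have "bracket e f = 0" using root_space_bracket[OF e lower.hyps(3)] by blast
          then show ?thesis using subspace_0[OF Ms] by simp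
        qed
        moreover have "bracket f (bracket e x) \<in> M"
          using neg[OF lower.hyps(2)] lower.hyps(3) lower.IH by (auto simp: S_def)
        ultimately show ?case using bracket_derivation[of e f x] subspace_add[OF Ms] by simp
      qed
    qed
  qed
  have "S = UNIV"
  proof (rule root_spaces_generated[OF _ _ TS pos neg])
    show "subspace S"
      by (rule subspaceI) (auto simp: S_def bracket_add_left bracket_scale_left
          subspace_0[OF Ms] subspace_add[OF Ms] subspace_scale[OF Ms])
    show "bracket x y \<in> S" if "x \<in> S" "y \<in> S" for x y
      using that by (auto simp: S_def bracket_bracket_left subspace_diff[OF Ms])
  qed
  then have "lie_ideal M" using Ms by (auto simp: lie_ideal_def S_def)
  moreover have "v \<in> M" unfolding M_def by (rule span_base) (rule lowered.start)
  ultimately have MU: "M = UNIV" using ideal_trivial v(2) by blast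
  have "\<gamma> \<in> P"
  proof (rule ccontr)
    assume n: "\<gamma> \<notin> P"
    obtain y where y: "y \<in> root_space \<gamma>" "y \<noteq> 0" using root_vector_exists[OF g] by blast
    obtain z where z: "z \<in> root_space (- \<gamma>)" "killing y z = 1"
      using root_space_pairing[OF root_dual[OF g] y] by blast
    have "killing m z = 0" if "m \<in> span (lowered v)" for m
      using that
    proof (induction rule: span_induct_alt)
      case base
      then show ?case by simp
    next
      case (step c x w)
      obtain \<mu> where m: "\<mu> \<in> P" "x \<in> root_space \<mu>" using wtx[OF step.hyps(1)] by blast
      have "\<mu> + - \<gamma> \<noteq> 0" using m n by auto
      then have "killing x z = 0"
        by (rule killing_root_space_orthogonal[OF lattice_dual[OF Pl[OF m(1)]] dual_closed(3)[OF root_dual[OF g]] _ m(2) z(1)])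
      then show ?case using step by (simp add: killing_add_left killing_scale_left)
    qed
    then have "killing y z = 0" using MU by (simp add: M_def)
    then show False using z(2) by simp
  qed
  then show ?thesis by (simp add: P_def)
qed

lemma roots_nonempty: "roots \<noteq> {}"
proof
  assume "roots = {}"
  then have "span T = UNIV" using root_decomposition by simp
  then have "T = UNIV" using T_subspace span_eq_iff by metis
  then have "bracket x y = 0" for x y using T_abelian by blast
  then show False using non_abelian by blast
qed

lemma highest_root_unique:
  assumes "\<theta> \<in> roots" "\<And>\<gamma>. \<gamma> \<in> roots \<Longrightarrow> \<theta> - \<gamma> \<in> nonneg_comb simples"
  shows "highest_root = \<theta>"
  unfolding highest_root_def
proof (rule the_equality)
  fix \<theta>' assume t': "\<theta>' \<in> roots \<and> (\<forall>\<gamma>\<in>roots. \<theta>' - \<gamma> \<in> nonneg_comb simples)"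
  show "\<theta>' = \<theta>"
  proof (rule lattice_eqI)
    fix \<beta> assume b: "\<beta> \<in> simples"
    have "0 \<le> ht \<beta> (\<theta>' - \<theta>)" "0 \<le> ht \<beta> (\<theta> - \<theta>')" using t' assms b by (auto simp: nonneg_comb_iff)
    then show "ht \<beta> \<theta>' = ht \<beta> \<theta>" using t' assms b by (simp add: ht_diff root_lattice)
  qed (use t' assms root_lattice in auto)
qed (use assms in auto)

lemma maximal_is_highest:
  "\<theta> \<in> pos_roots \<Longrightarrow> v \<in> root_space \<theta> \<Longrightarrow> v \<noteq> 0 \<Longrightarrow>
    (\<And>\<beta> e. \<beta> \<in> simples \<Longrightarrow> e \<in> root_space \<beta> \<Longrightarrow> bracket e v = 0) \<Longrightarrow> highest_root = \<theta>"
  using highest_root_unique[OF pos_root] highest_weight_root_dominates by blast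

text \<open>A positive root of maximal height has a root vector that is killed by all simple root vectors.\<close>

lemma highest_root: "highest_root \<in> pos_roots" "\<And>\<gamma>. \<gamma> \<in> roots \<Longrightarrow> highest_root - \<gamma> \<in> nonneg_comb simples"
proof -
  have ne: "pos_roots \<noteq> {}" using roots_nonempty root_sign by blast
  have fin: "finite pos_roots" using finite_roots by (simp add: pos_roots_def)
  obtain \<theta> where t: "\<theta> \<in> pos_roots" "\<And>\<gamma>. \<gamma> \<in> pos_roots \<Longrightarrow> height \<gamma> \<le> height \<theta>"
  proof -
    have "Max (height ` pos_roots) \<in> height ` pos_roots" using fin ne by (intro Max_in) auto
    then obtain \<theta> where t: "\<theta> \<in> pos_roots" "Max (height ` pos_roots) = height \<theta>" by blast
    have "height \<gamma> \<le> height \<theta>" if "\<gamma> \<in> pos_roots" for \<gamma>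
      unfolding t(2)[symmetric] using fin that by (intro Max_ge) auto
    then show ?thesis using t that by blast
  qed
  have max: "\<theta> + \<beta> \<notin> roots" if b: "\<beta> \<in> simples" for \<beta>
  proof
    assume r: "\<theta> + \<beta> \<in> roots"
    note lt = root_lattice[OF pos_root[OF t(1)]]
    have "ht \<beta> (\<theta> + \<beta>) > 0"
      using pos_ht[OF t(1) b] b by (simp add: ht_add lt root_lattice simple_root ht_simple)
    then have "\<theta> + \<beta> \<in> pos_roots" by (rule pos_rootI[OF r b])
    from t(2)[OF this] show False using height_add_simple[OF lt b] by simp
  qed
  obtain v where v: "v \<in> root_space \<theta>" "v \<noteq> 0" using root_vector_exists[OF pos_root[OF t(1)]] by blast
  have hw: "bracket e v = 0" if b: "\<beta> \<in> simples" and e: "e \<in> root_space \<beta>" for \<beta> e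
  proof -
    have "ht \<beta> (\<theta> + \<beta>) = ht \<beta> \<theta> + 1"
      using b by (simp add: ht_add root_lattice pos_root[OF t(1)] simple_root ht_simple)
    then have "\<theta> + \<beta> \<noteq> 0" using pos_ht[OF t(1) b] ht_0[OF b] by auto
    then have "root_space (\<theta> + \<beta>) = {0}"
      using not_root_space[OF dual_closed(1)[OF root_dual root_dual]] max[OF b] pos_root[OF t(1)] simple_root[OF b] by blast
    then show ?thesis using root_space_bracket[OF e v(1)] by (simp add: add.commute)
  qed
  have "highest_root = \<theta>" by (rule maximal_is_highest[OF t(1) v hw])
  then show "highest_root \<in> pos_roots" "\<And>\<gamma>. \<gamma> \<in> roots \<Longrightarrow> highest_root - \<gamma> \<in> nonneg_comb simples"
    using t highest_weight_root_dominates[OF t(1) v hw] by auto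
qed

end

section \<open>The Casimir element\<close>

context lie_algebra
begin

lemma dual_bases_expand:
  assumes D: "dual_bases S n e e'" and s: "s \<in> S"
  shows "(\<Sum>j<n. scale (killing s (e' j)) (e j)) = s"
    and "(\<Sum>j<n. scale (killing (e j) s) (e' j)) = s"
proof -
  have k: "\<And>i j. i < n \<Longrightarrow> j < n \<Longrightarrow> killing (e i) (e' j) = (if i = j then 1 else 0)"
    and sp: "span (e ` {..<n}) = S" "span (e' ` {..<n}) = S"
    using D by (auto simp: dual_bases_def basis_of_def)
  have "s \<in> span (e ` {..<n})" using s sp by simp
  then show "(\<Sum>j<n. scale (killing s (e' j)) (e j)) = s"
  proof (induction rule: span_induct_alt)
    case (step c x y)
    then obtain i where i: "i < n" "x = e i" by blast
    have "(\<Sum>j<n. scale (killing (e i) (e' j)) (e j)) = (\<Sum>j<n. if i = j then e j else 0)"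
      by (rule sum.cong) (auto simp: k i)
    then have "(\<Sum>j<n. scale (killing x (e' j)) (e j)) = x" using i by simp
    then have "scale c (\<Sum>j<n. scale (killing x (e' j)) (e j)) = scale c x" by simp
    then show ?case using step.IH
      by (simp add: killing_add_left killing_scale_left scale_left_distrib sum.distrib scale_sum_right)
  qed simp
  have "s \<in> span (e' ` {..<n})" using s sp by simp
  then show "(\<Sum>j<n. scale (killing (e j) s) (e' j)) = s"
  proof (induction rule: span_induct_alt)
    case (step c x y)
    then obtain i where i: "i < n" "x = e' i" by blast
    have "(\<Sum>j<n. scale (killing (e j) (e' i)) (e' j)) = (\<Sum>j<n. if i = j then e' j else 0)"
      by (rule sum.cong) (auto simp: k i)
    then have "(\<Sum>j<n. scale (killing (e j) x) (e' j)) = x" using i by simp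
    then have "scale c (\<Sum>j<n. scale (killing (e j) x) (e' j)) = scale c x" by simp
    then show ?case using step.IH
      by (simp add: killing_add_right killing_scale_right scale_left_distrib sum.distrib scale_sum_right)
  qed simp
qed

lemma dual_bases_in:
  assumes "dual_bases S n e e'" "j < n"
  shows "e j \<in> S" "e' j \<in> S"
proof -
  have "span (e ` {..<n}) = S" "span (e' ` {..<n}) = S" using assms by (auto simp: dual_bases_def basis_of_def)
  then show "e j \<in> S" "e' j \<in> S" using assms(2) by (auto intro: span_base)
qed

text \<open>Expand \<open>e j\<close> in the basis \<open>f\<close> and reassemble the coefficients, which are
  those of \<open>f' i\<close> in the basis \<open>e'\<close>.\<close>

lemma dual_bases_sum_unique:
  assumes D: "dual_bases S n e e'" and F: "dual_bases S m f f'"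
  shows "(\<Sum>j<n. bracket (e' j) (bracket (e j) x)) = (\<Sum>i<m. bracket (f' i) (bracket (f i) x))"
proof -
  have "(\<Sum>j<n. bracket (e' j) (bracket (e j) x))
      = (\<Sum>j<n. bracket (e' j) (bracket (\<Sum>i<m. scale (killing (e j) (f' i)) (f i)) x))"
    using dual_bases_expand(1)[OF F] dual_bases_in(1)[OF D] by (intro sum.cong) auto
  also have "\<dots> = (\<Sum>j<n. \<Sum>i<m. scale (killing (e j) (f' i)) (bracket (e' j) (bracket (f i) x)))"
    by (simp add: bracket_sum_left bracket_sum_right bracket_scale_left bracket_scale_right)
  also have "\<dots> = (\<Sum>i<m. \<Sum>j<n. scale (killing (e j) (f' i)) (bracket (e' j) (bracket (f i) x)))"
    by (rule sum.swap)
  also have "\<dots> = (\<Sum>i<m. bracket (\<Sum>j<n. scale (killing (e j) (f' i)) (e' j)) (bracket (f i) x))"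
    by (simp add: bracket_sum_left bracket_scale_left)
  also have "\<dots> = (\<Sum>i<m. bracket (f' i) (bracket (f i) x))"
    using dual_bases_expand(2)[OF D] dual_bases_in(2)[OF F] by (intro sum.cong) auto
  finally show ?thesis .
qed

lemma casimir_dual_bases:
  assumes D: "dual_bases S n e e'"
  shows "casimir S = (\<lambda>x. \<Sum>j<n. bracket (e' j) (bracket (e j) x))"
  unfolding casimir_def
proof (rule the_equality)
  show "\<exists>m f f'. dual_bases S m f f' \<and>
      (\<lambda>x. \<Sum>j<n. bracket (e' j) (bracket (e j) x)) = (\<lambda>x. \<Sum>j<m. bracket (f' j) (bracket (f j) x))"
    using D by blast
next
  fix C assume "\<exists>m f f'. dual_bases S m f f' \<and> C = (\<lambda>x. \<Sum>j<m. bracket (f' j) (bracket (f j) x))"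
  then show "C = (\<lambda>x. \<Sum>j<n. bracket (e' j) (bracket (e j) x))"
    using dual_bases_sum_unique[OF D] by fastforce
qed

text \<open>The matrices of \<open>ad s\<close> in the bases \<open>e\<close> and \<open>e'\<close> are negative
  transposes of each other.\<close>

lemma casimir_commutes:
  assumes D: "dual_bases S n e e'" and s: "\<And>x. x \<in> S \<Longrightarrow> bracket s x \<in> S"
  shows "bracket s (casimir S x) = casimir S (bracket s x)"
proof -
  have kk: "killing (bracket s y) z = - killing y (bracket s z)" for y z
    using bracket_anti[of s y] by (simp add: killing_minus_left killing_invariant)
  have A: "(\<Sum>j<n. bracket (bracket s (e' j)) (bracket (e j) x))
      = (\<Sum>j<n. \<Sum>i<n. scale (killing (e i) (bracket s (e' j))) (bracket (e' i) (bracket (e j) x)))"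
  proof (rule sum.cong[OF refl])
    fix j assume "j \<in> {..<n}"
    then have "bracket s (e' j) = (\<Sum>i<n. scale (killing (e i) (bracket s (e' j))) (e' i))"
      using dual_bases_expand(2)[OF D s[OF dual_bases_in(2)[OF D]]] by simp
    then have "bracket (bracket s (e' j)) (bracket (e j) x)
        = bracket (\<Sum>i<n. scale (killing (e i) (bracket s (e' j))) (e' i)) (bracket (e j) x)" by (rule arg_cong)
    then show "bracket (bracket s (e' j)) (bracket (e j) x)
        = (\<Sum>i<n. scale (killing (e i) (bracket s (e' j))) (bracket (e' i) (bracket (e j) x)))"
      by (simp only: bracket_sum_left bracket_scale_left)
  qed
  have "(\<Sum>j<n. bracket (e' j) (bracket (bracket s (e j)) x))
      = (\<Sum>j<n. \<Sum>i<n. scale (killing (bracket s (e j)) (e' i)) (bracket (e' j) (bracket (e i) x)))"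
  proof (rule sum.cong[OF refl])
    fix j assume "j \<in> {..<n}"
    then have "bracket s (e j) = (\<Sum>i<n. scale (killing (bracket s (e j)) (e' i)) (e i))"
      using dual_bases_expand(1)[OF D s[OF dual_bases_in(1)[OF D]]] by simp
    then have "bracket (e' j) (bracket (bracket s (e j)) x)
        = bracket (e' j) (bracket (\<Sum>i<n. scale (killing (bracket s (e j)) (e' i)) (e i)) x)"
      by (rule arg_cong[of _ _ "\<lambda>y. bracket (e' j) (bracket y x)"])
    then show "bracket (e' j) (bracket (bracket s (e j)) x)
        = (\<Sum>i<n. scale (killing (bracket s (e j)) (e' i)) (bracket (e' j) (bracket (e i) x)))"
      by (simp only: bracket_sum_left bracket_scale_left bracket_sum_right bracket_scale_right)
  qed
  also have "\<dots> = (\<Sum>i<n. \<Sum>j<n. scale (killing (bracket s (e j)) (e' i)) (bracket (e' j) (bracket (e i) x)))"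
    by (rule sum.swap)
  also have "\<dots> = - (\<Sum>j<n. \<Sum>i<n. scale (killing (e i) (bracket s (e' j))) (bracket (e' i) (bracket (e j) x)))"
    by (simp add: kk sum_negf)
  finally have B: "(\<Sum>j<n. bracket (e' j) (bracket (bracket s (e j)) x))
      = - (\<Sum>j<n. bracket (bracket s (e' j)) (bracket (e j) x))" by (simp add: A)
  have "bracket s (casimir S x) = (\<Sum>j<n. bracket (bracket s (e' j)) (bracket (e j) x))
      + (\<Sum>j<n. bracket (e' j) (bracket (bracket s (e j)) x)) + casimir S (bracket s x)"
    by (simp add: casimir_dual_bases[OF D] bracket_sum_right bracket_derivation[of s] bracket_add_right sum.distrib add.assoc)
  then show ?thesis using B by simp
qed

lemma lin_casimir:
  assumes D: "dual_bases S n e e'"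
  shows "lin (casimir S)"
  unfolding casimir_dual_bases[OF D] Vector_Spaces.linear_iff
  by (simp add: vector_space_axioms bracket_add_right bracket_scale_right sum.distrib scale_sum_right)

text \<open>By invariance the left side is the trace of \<open>ad x ad y\<close> written out in the basis
  \<open>e'\<close> with coordinate functionals \<open>\<kappa>(e j, \<sqdot>)\<close>.\<close>

lemma killing_casimir_UNIV:
  assumes D: "dual_bases UNIV n e e'"
  shows "killing (casimir UNIV x) y = killing x y"
proof -
  have inj: "inj_on e' {..<n}" and B: "basis_of (e' ` {..<n}) UNIV"
    using D by (auto simp: dual_bases_def)
  have rep: "representation (e' ` {..<n}) z (e' i) = killing (e i) z" if i: "i < n" for z i
  proof -
    have "representation (e' ` {..<n}) z (e' i) = representation (e' ` {..<n}) (\<Sum>j<n. scale (killing (e j) z) (e' j)) (e' i)"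
      by (simp add: dual_bases_expand(2)[OF D])
    also have "\<dots> = (\<Sum>j<n. killing (e j) z * representation (e' ` {..<n}) (e' j) (e' i))"
      by (simp add: rep_sum[OF B] rep_scale[OF B])
    also have "\<dots> = (\<Sum>j<n. if j = i then killing (e j) z else 0)"
      by (rule sum.cong) (use i inj in \<open>auto simp: rep_basis[OF B] inj_on_def\<close>)
    also have "\<dots> = killing (e i) z" using i by simp
    finally show ?thesis .
  qed
  have "killing x y = (\<Sum>j<n. killing (e j) (bracket x (bracket y (e' j))))"
  proof -
    have "killing x y = (\<Sum>b\<in>e' ` {..<n}. representation (e' ` {..<n}) (bracket x (bracket y b)) b)"
      by (rule killing_basis[OF B])
    then show ?thesis by (simp add: sum.reindex[OF inj] rep)
  qed
  also have "\<dots> = (\<Sum>j<n. killing (bracket (e' j) (bracket (e j) x)) y)"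
  proof (rule sum.cong[OF refl])
    fix j
    have "killing (bracket (e' j) (bracket (e j) x)) y = - killing (bracket (bracket (e j) x) (e' j)) y"
      using bracket_anti[of "e' j" "bracket (e j) x"] by (simp add: killing_minus_left)
    also have "\<dots> = killing (bracket (e j) x) (bracket y (e' j))"
      using bracket_anti[of "e' j" y] by (simp add: killing_invariant[of "bracket (e j) x"] killing_minus_right)
    also have "\<dots> = killing (e j) (bracket x (bracket y (e' j)))" by (rule killing_invariant)
    finally show "killing (e j) (bracket x (bracket y (e' j))) = killing (bracket (e' j) (bracket (e j) x)) y" by simp
  qed
  also have "\<dots> = killing (casimir UNIV x) y" by (simp add: casimir_dual_bases[OF D] killing_sum_left)
  finally show ?thesis by simp
qed

lemma independent_dual_family:
  assumes I: "finite I" and k: "\<And>i j. i \<in> I \<Longrightarrow> j \<in> I \<Longrightarrow> killing (E i) (E' j) = (if i = j then 1 else 0)"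
  shows "inj_on E I" "independent (E ` I)"
proof -
  show inj: "inj_on E I"
  proof (rule inj_onI)
    fix i j assume ij: "i \<in> I" "j \<in> I" "E i = E j"
    then show "i = j" using k[OF ij(1) ij(1)] k[OF ij(2) ij(1)] by (metis zero_neq_one)
  qed
  show "independent (E ` I)"
  proof (rule independent_if_scalars_zero)
    fix u v assume s: "(\<Sum>x\<in>E ` I. scale (u x) x) = 0" and v: "v \<in> E ` I"
    obtain i where i: "i \<in> I" "v = E i" using v by blast
    have "0 = killing (\<Sum>x\<in>E ` I. scale (u x) x) (E' i)" by (simp add: s)
    also have "\<dots> = (\<Sum>j\<in>I. u (E j) * killing (E j) (E' i))"
      by (simp add: sum.reindex[OF inj] killing_sum_left killing_scale_left)
    also have "\<dots> = (\<Sum>j\<in>I. if j = i then u (E j) else 0)"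
      by (rule sum.cong) (auto simp: k i)
    also have "\<dots> = u v" using i I by simp
    finally show "u v = 0" by simp
  qed (use I in simp)
qed

lemma dual_bases_of_family:
  assumes I: "finite I" and k: "\<And>i j. i \<in> I \<Longrightarrow> j \<in> I \<Longrightarrow> killing (E i) (E' j) = (if i = j then 1 else 0)"
    and sp: "span (E ` I) = S" "span (E' ` I) = S"
  shows "\<exists>n e e'. dual_bases S n e e'" "casimir S x = (\<Sum>i\<in>I. bracket (E' i) (bracket (E i) x))"
proof -
  obtain \<phi> where phi: "bij_betw \<phi> {..<card I} I"
    using ex_bij_betw_nat_finite[OF I] by (auto simp: atLeast0LessThan)
  then have im: "\<phi> ` {..<card I} = I" and inj: "inj_on \<phi> {..<card I}" by (auto simp: bij_betw_def)
  have k': "killing (E' i) (E j) = (if i = j then 1 else 0)" if "i \<in> I" "j \<in> I" for i j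
    using k[OF that(2,1)] by (auto simp: killing_commute)
  have D: "dual_bases S (card I) (E \<circ> \<phi>) (E' \<circ> \<phi>)"
    unfolding dual_bases_def basis_of_def
  proof (intro conjI allI impI)
    show "inj_on (E \<circ> \<phi>) {..<card I}" "inj_on (E' \<circ> \<phi>) {..<card I}"
      using independent_dual_family(1)[OF I k] independent_dual_family(1)[OF I k'] inj im by (auto intro: comp_inj_on)
    show "independent ((E \<circ> \<phi>) ` {..<card I})" "independent ((E' \<circ> \<phi>) ` {..<card I})"
      by (simp_all only: image_comp[symmetric] im independent_dual_family(2)[OF I k] independent_dual_family(2)[OF I k'] not_False_eq_True)
    show "span ((E \<circ> \<phi>) ` {..<card I}) = S" "span ((E' \<circ> \<phi>) ` {..<card I}) = S"
      by (simp_all only: image_comp[symmetric] im sp)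
    fix i j assume ij: "i < card I" "j < card I"
    then have "\<phi> i \<in> I" "\<phi> j \<in> I" using im by auto
    then show "killing ((E \<circ> \<phi>) i) ((E' \<circ> \<phi>) j) = (if i = j then 1 else 0)"
      using k inj ij by (auto simp: inj_on_def)
  qed
  then show "\<exists>n e e'. dual_bases S n e e'" by blast
  show "casimir S x = (\<Sum>i\<in>I. bracket (E' i) (bracket (E i) x))"
    unfolding casimir_dual_bases[OF D] using sum.reindex_bij_betw[OF phi, of "\<lambda>i. bracket (E' i) (bracket (E i) x)"] by simp
qed

end

context cartan_simple_lie_algebra
begin

text \<open>A maximal orthonormal set spans \<open>T\<close>, because square roots are available.\<close>

lemma T_orthonormal_basis:
  "\<exists>Z. finite Z \<and> span Z = T \<and> (\<forall>x\<in>Z. \<forall>y\<in>Z. killing x y = (if x = y then 1 else 0))"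
proof -
  define on where "on Z \<longleftrightarrow> finite Z \<and> Z \<subseteq> T \<and> (\<forall>x\<in>Z. \<forall>y\<in>Z. killing x y = (if x = y then 1 else 0))" for Z
  have ind: "independent Z" if "on Z" for Z
    using independent_dual_family(2)[of Z "\<lambda>x. x" "\<lambda>x. x"] that by (auto simp: on_def)
  have "on {}" by (simp add: on_def)
  moreover have "card Z < Suc (card some_basis)" if "on Z" for Z
    using independent_card_le_dim[of Z UNIV] ind[OF that] by (auto simp: dim_UNIV)
  ultimately obtain Z where Z: "on Z" and max: "\<And>Q. on Q \<Longrightarrow> card Q \<le> card Z"
    using ex_has_greatest_nat[of on "{}" card] by blast
  have fin: "finite Z" and OT: "Z \<subseteq> T" and k: "\<And>x y. x \<in> Z \<Longrightarrow> y \<in> Z \<Longrightarrow> killing x y = (if x = y then 1 else 0)"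
    using Z by (auto simp: on_def)
  define p where "p t = t - (\<Sum>x\<in>Z. scale (killing t x) x)" for t
  have pT: "p t \<in> T" if "t \<in> T" for t
    unfolding p_def using that OT by (intro subspace_diff subspace_sum subspace_scale T_subspace) auto
  have pO: "killing (p t) y = 0" if "y \<in> Z" for t y
  proof -
    have "(\<Sum>x\<in>Z. killing t x * killing x y) = (\<Sum>x\<in>Z. if x = y then killing t x else 0)"
      by (rule sum.cong) (auto simp: k that)
    then show ?thesis using fin that by (simp add: p_def killing_diff_left killing_sum_left killing_scale_left)
  qed
  \<comment> \<open>an anisotropic vector orthogonal to the set could be normalised and added\<close>
  have iso: "killing w w = 0" if w: "w \<in> T" "\<And>y. y \<in> Z \<Longrightarrow> killing w y = 0" for w
  proof (rule ccontr)
    assume n: "killing w w \<noteq> 0"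
    obtain c where c: "c ^ 2 = inverse (killing w w)" using nth_root_exists[of 2 "inverse (killing w w)"] by auto
    have kc: "killing (scale c w) (scale c w) = 1"
      using n c by (simp add: killing_scale_left killing_scale_right power2_eq_square mult.assoc[symmetric])
    have kO: "killing (scale c w) y = 0" "killing y (scale c w) = 0" if "y \<in> Z" for y
      using w(2)[OF that] killing_commute[of y w] by (simp_all add: killing_scale_left killing_scale_right)
    have nO: "scale c w \<notin> Z" using kc kO by (metis zero_neq_one)
    have "on (insert (scale c w) Z)"
      using fin OT k kc kO nO w(1) by (auto simp: on_def subspace_scale[OF T_subspace])
    from max[OF this] show False using nO fin by simp
  qed
  have zero: "w = 0" if w: "w \<in> T" "\<And>y. y \<in> Z \<Longrightarrow> killing w y = 0" for w
  proof (rule killing_T_nondegenerate[OF w(1)])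
    fix t assume t: "t \<in> T"
    have "killing (w + p t) (w + p t) = 0"
      using w pT[OF t] pO by (intro iso) (auto simp: subspace_add[OF T_subspace] killing_add_left)
    moreover have "killing w w = 0" "killing (p t) (p t) = 0" using iso w pT[OF t] pO by auto
    moreover have "killing (w + p t) (w + p t) = killing w w + killing w (p t) + (killing (p t) w + killing (p t) (p t))"
      by (simp add: killing_add_left killing_add_right)
    moreover have "killing (p t) w = killing w (p t)" by (rule killing_commute)
    ultimately have "2 * killing w (p t) = 0" by simp
    then have "killing w (p t) = 0" by simp
    moreover have "killing w (\<Sum>x\<in>Z. scale (killing t x) x) = 0"
      using w(2) by (simp add: killing_sum_right killing_scale_right)
    ultimately show "killing w t = 0" by (simp add: p_def killing_diff_right)
  qed
  have "t \<in> span Z" if t: "t \<in> T" for t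
  proof -
    have "p t = 0" using zero pT[OF t] pO by blast
    then have "t = (\<Sum>x\<in>Z. scale (killing t x) x)" by (simp add: p_def)
    also have "\<dots> \<in> span Z" by (intro span_sum span_scale span_base)
    finally show ?thesis .
  qed
  then have "span Z = T" using span_minimal[OF OT T_subspace] by blast
  then show ?thesis using Z by (auto simp: on_def)
qed

text \<open>For a symmetric and closed set \<open>R\<close> of roots this is a reductive subalgebra. It covers
  both the whole algebra (all roots) and the part of degree zero (roots of
  \<open>\<alpha>\<close>-height zero).\<close>

definition Levi :: "('g \<Rightarrow> 'k) set \<Rightarrow> 'g set" where
  "Levi R = span (T \<union> (\<Union>\<gamma>\<in>R. root_space \<gamma>))"

lemma root_space_span: "\<gamma> \<in> roots \<Longrightarrow> x \<in> root_space \<gamma> \<Longrightarrow> x \<noteq> 0 \<Longrightarrow> root_space \<gamma> \<subseteq> span {x}"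
  using root_space_one_dim by (fastforce simp: span_singleton)

text \<open>Explicit dual bases: an orthonormal basis of \<open>T\<close> together with root vectors \<open>X
  \<gamma>\<close> on one side, and the opposite root vectors \<open>Y \<gamma>\<close> on the
  other.\<close>

lemma Levi_casimir:
  assumes R: "R \<subseteq> roots" and sym: "\<forall>\<gamma>\<in>R. - \<gamma> \<in> R"
  shows "\<exists>B X Y. (\<exists>n e e'. dual_bases (Levi R) n e e') \<and>
    finite B \<and> span B = T \<and> (\<forall>x\<in>B. \<forall>y\<in>B. killing x y = (if x = y then 1 else 0)) \<and>
    (\<forall>\<gamma>\<in>R. X \<gamma> \<in> root_space \<gamma>) \<and> (\<forall>\<gamma>\<in>R. Y \<gamma> \<in> root_space (- \<gamma>)) \<and>
    (\<forall>\<gamma>\<in>R. killing (X \<gamma>) (Y \<gamma>) = 1) \<and>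
    (\<forall>x. casimir (Levi R) x = (\<Sum>b\<in>B. bracket b (bracket b x)) + (\<Sum>\<gamma>\<in>R. bracket (Y \<gamma>) (bracket (X \<gamma>) x)))"
proof -
  obtain B where B: "finite B" "span B = T" "\<And>x y. x \<in> B \<Longrightarrow> y \<in> B \<Longrightarrow> killing x y = (if x = y then 1 else 0)"
    using T_orthonormal_basis by blast
  have BT: "b \<in> T" if "b \<in> B" for b using B(2) span_base[OF that] by simp
  have "\<exists>x y. x \<in> root_space \<gamma> \<and> y \<in> root_space (- \<gamma>) \<and> killing x y = 1" if "\<gamma> \<in> R" for \<gamma>
  proof -
    have g: "\<gamma> \<in> roots" using that R by blast
    obtain x where x: "x \<in> root_space \<gamma>" "x \<noteq> 0" using root_vector_exists[OF g] by blast
    show ?thesis using root_space_pairing[OF root_dual[OF g] x] x by blast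
  qed
  then obtain X Y where XY: "\<And>\<gamma>. \<gamma> \<in> R \<Longrightarrow> X \<gamma> \<in> root_space \<gamma>" "\<And>\<gamma>. \<gamma> \<in> R \<Longrightarrow> Y \<gamma> \<in> root_space (- \<gamma>)"
    "\<And>\<gamma>. \<gamma> \<in> R \<Longrightarrow> killing (X \<gamma>) (Y \<gamma>) = 1" by metis
  \<comment> \<open>a disjoint sum of index sets avoids comparing basis vectors of \<open>T\<close> with root vectors\<close>
  define I where "I = Inl ` B \<union> Inr ` R"
  define E where "E = case_sum (\<lambda>b. b) X"
  define E' where "E' = case_sum (\<lambda>b. b) Y"
  have finR: "finite R" using R finite_roots finite_subset by blast
  have fin: "finite I" using B(1) finR by (simp add: I_def)
  have kTR: "killing t z = 0" "killing z t = 0" if "t \<in> T" "\<gamma> \<in> roots" "z \<in> root_space \<gamma>" for t z \<gamma>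
    using killing_root_space_orthogonal[OF dual_closed(5) root_dual[OF that(2)] _ _ that(3), of t]
      root_nonzero[OF that(2)] that(1) root_space_0 killing_commute[of z t] by auto
  have k: "killing (E i) (E' j) = (if i = j then 1 else 0)" if "i \<in> I" "j \<in> I" for i j
  proof -
    have XYo: "killing (X \<gamma>) (Y \<delta>) = (if \<gamma> = \<delta> then 1 else 0)" if g: "\<gamma> \<in> R" "\<delta> \<in> R" for \<gamma> \<delta>
    proof (cases "\<gamma> = \<delta>")
      case False
      then have "\<gamma> + - \<delta> \<noteq> 0" by simp
      moreover have "\<gamma> \<in> dual" "- \<delta> \<in> dual" using g R root_dual dual_closed(3) by blast+
      ultimately show ?thesis using killing_root_space_orthogonal XY g False by auto
    qed (use XY g in simp)
    have 1: "killing b (Y \<gamma>) = 0" if "b \<in> B" "\<gamma> \<in> R" for b \<gamma>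
      using kTR(1)[OF BT[OF that(1)] _ XY(2)[OF that(2)]] root_minus that R by blast
    have 2: "killing (X \<gamma>) b = 0" if "b \<in> B" "\<gamma> \<in> R" for b \<gamma>
      using kTR(2)[OF BT[OF that(1)] _ XY(1)[OF that(2)]] that R by blast
    show ?thesis using that unfolding I_def E_def E'_def by (auto simp: B(3) XYo 1 2 split: if_splits)
  qed
  have EI: "E ` I = B \<union> X ` R" "E' ` I = B \<union> Y ` R"
    unfolding I_def E_def E'_def by (auto simp: image_Un image_image)
  have nz: "X \<gamma> \<noteq> 0" "Y \<gamma> \<noteq> 0" if "\<gamma> \<in> R" for \<gamma> using XY(3)[OF that] by auto
  have spE: "span (B \<union> X ` R) = Levi R"
  proof
    show "span (B \<union> X ` R) \<subseteq> Levi R"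
      unfolding Levi_def using BT XY by (intro span_mono) auto
    have "T \<subseteq> span (B \<union> X ` R)" using B(2) span_mono[of B "B \<union> X ` R"] by auto
    moreover have "root_space \<gamma> \<subseteq> span (B \<union> X ` R)" if "\<gamma> \<in> R" for \<gamma>
      using root_space_span[of \<gamma> "X \<gamma>"] XY(1)[OF that] nz(1)[OF that] that R span_mono[of "{X \<gamma>}" "B \<union> X ` R"] by blast
    ultimately show "Levi R \<subseteq> span (B \<union> X ` R)" unfolding Levi_def by (intro span_minimal) auto
  qed
  have spE': "span (B \<union> Y ` R) = Levi R"
  proof
    have "Y \<gamma> \<in> (\<Union>\<gamma>\<in>R. root_space \<gamma>)" if "\<gamma> \<in> R" for \<gamma> using XY(2)[OF that] bspec[OF sym that] by blast
    then show "span (B \<union> Y ` R) \<subseteq> Levi R"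
      unfolding Levi_def using BT by (intro span_mono) auto
    have "T \<subseteq> span (B \<union> Y ` R)" using B(2) span_mono[of B "B \<union> Y ` R"] by auto
    moreover have "root_space \<gamma> \<subseteq> span (B \<union> Y ` R)" if "\<gamma> \<in> R" for \<gamma>
    proof -
      have "Y (- \<gamma>) \<in> root_space \<gamma>" using XY(2)[OF bspec[OF sym that]] by simp
      then show ?thesis
        using root_space_span[of \<gamma> "Y (- \<gamma>)"] nz(2)[OF bspec[OF sym that]] that bspec[OF sym that] R
          span_mono[of "{Y (- \<gamma>)}" "B \<union> Y ` R"] by blast
    qed
    ultimately show "Levi R \<subseteq> span (B \<union> Y ` R)" unfolding Levi_def by (intro span_minimal) auto
  qed
  note D = dual_bases_of_family[OF fin k, of "Levi R", unfolded EI, OF _ _ spE spE']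
  have "casimir (Levi R) x = (\<Sum>b\<in>B. bracket b (bracket b x)) + (\<Sum>\<gamma>\<in>R. bracket (Y \<gamma>) (bracket (X \<gamma>) x))" for x
  proof -
    have "casimir (Levi R) x = (\<Sum>i\<in>I. bracket (E' i) (bracket (E i) x))" by (rule D(2))
    also have "\<dots> = (\<Sum>i\<in>Inl ` B. bracket (E' i) (bracket (E i) x)) + (\<Sum>i\<in>Inr ` R. bracket (E' i) (bracket (E i) x))"
      unfolding I_def using B(1) finR by (intro sum.union_disjoint) auto
    also have "\<dots> = (\<Sum>b\<in>B. bracket b (bracket b x)) + (\<Sum>\<gamma>\<in>R. bracket (Y \<gamma>) (bracket (X \<gamma>) x))"
      by (simp add: sum.reindex E_def E'_def)
    finally show ?thesis .
  qed
  then show ?thesis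
    by (intro exI[of _ B] exI[of _ X] exI[of _ Y] conjI ballI allI D(1) B XY)
qed

lemma sum_represents: "(\<And>\<gamma>. \<gamma> \<in> A \<Longrightarrow> represents (t \<gamma>) (f \<gamma>)) \<Longrightarrow> represents (\<Sum>\<gamma>\<in>A. t \<gamma>) (\<Sum>\<gamma>\<in>A. f \<gamma>)"
  by (induction A rule: infinite_finite_induct) (auto simp: represents_0 intro: represents_add)

text \<open>The part of the Casimir element in \<open>T\<close> contributes \<open>(\<mu>, \<mu>)\<close>. For
  \<open>\<gamma>\<close> in \<open>P\<close>, the summand of \<open>\<gamma>\<close> kills
  \<open>v\<close>; in that of \<open>- \<gamma>\<close> the two root vectors can be exchanged at
  the cost of their commutator \<open>t\<^sub>\<gamma>\<close>, which contributes \<open>(\<mu>,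
  \<gamma>)\<close>.\<close>

lemma Levi_casimir_extremal:
  assumes P: "P \<subseteq> roots" "\<And>\<gamma>. \<gamma> \<in> P \<Longrightarrow> - \<gamma> \<notin> P"
    and R: "R = P \<union> uminus ` P"
    and l: "\<mu> \<in> roots" and v: "v \<in> root_space \<mu>"
    and kill: "\<And>\<gamma> x. \<gamma> \<in> P \<Longrightarrow> x \<in> root_space \<gamma> \<Longrightarrow> bracket x v = 0"
  shows "casimir (Levi R) v = scale (form \<mu> \<mu> + (\<Sum>\<gamma>\<in>P. form \<mu> \<gamma>)) v"
proof -
  have Rr: "R \<subseteq> roots" using P(1) root_minus by (auto simp: R)
  have sym: "\<forall>\<gamma>\<in>R. - \<gamma> \<in> R" by (auto simp: R)
  obtain B X Y where B1: "finite B" "span B = T" and B2: "\<forall>x\<in>B. \<forall>y\<in>B. killing x y = (if x = y then 1 else 0)"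
    and XY: "\<forall>\<gamma>\<in>R. X \<gamma> \<in> root_space \<gamma>" "\<forall>\<gamma>\<in>R. Y \<gamma> \<in> root_space (- \<gamma>)" "\<forall>\<gamma>\<in>R. killing (X \<gamma>) (Y \<gamma>) = 1"
    and C: "\<forall>x. casimir (Levi R) x = (\<Sum>b\<in>B. bracket b (bracket b x)) + (\<Sum>\<gamma>\<in>R. bracket (Y \<gamma>) (bracket (X \<gamma>) x))"
    using Levi_casimir[OF Rr sym] by (elim exE conjE) (rule that)
  note B = B1 B2[rule_format] and X = XY(1)[rule_format] and Y = XY(2)[rule_format] and k = XY(3)[rule_format]
  have BT: "b \<in> T" if "b \<in> B" for b using B(2) span_base[OF that] by simp
  note t = representer[OF l]
  have tT: "representer \<mu> \<in> T" using t by (simp add: represents_def)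
  have "killing s u = (\<Sum>b\<in>B. killing s b * killing b u)" if "s \<in> span B" for s u
    using that
  proof (induction rule: span_induct_alt)
    case (step c x y)
    have "(\<Sum>b\<in>B. killing x b * killing b u) = (\<Sum>b\<in>B. if b = x then killing b u else 0)"
      by (rule sum.cong) (use B(3) step.hyps in auto)
    then have "(\<Sum>b\<in>B. killing x b * killing b u) = killing x u" using B(1) step.hyps by simp
    then have "c * killing x u = c * (\<Sum>b\<in>B. killing x b * killing b u)" by (simp only:)
    also have "\<dots> = (\<Sum>b\<in>B. c * (killing x b * killing b u))" by (rule sum_distrib_left)
    finally have "c * killing x u = (\<Sum>b\<in>B. c * (killing x b * killing b u))" .
    then show ?case using step.IH
      by (simp add: killing_add_left killing_scale_left distrib_right sum.distrib mult.assoc)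
  qed simp
  from this[of "representer \<mu>" "representer \<mu>"]
  have "form \<mu> \<mu> = (\<Sum>b\<in>B. killing (representer \<mu>) b * killing b (representer \<mu>))"
    using tT B(2) by (simp add: form_def)
  also have "\<dots> = (\<Sum>b\<in>B. \<mu> b * \<mu> b)"
  proof (rule sum.cong[OF refl])
    fix b assume "b \<in> B"
    then have "killing (representer \<mu>) b = \<mu> b" by (rule killing_representer[OF t BT])
    moreover from this have "killing b (representer \<mu>) = \<mu> b" using killing_commute by metis
    ultimately show "killing (representer \<mu>) b * killing b (representer \<mu>) = \<mu> b * \<mu> b" by simp
  qed
  finally have "form \<mu> \<mu> = (\<Sum>b\<in>B. \<mu> b * \<mu> b)" .
  then have 1: "(\<Sum>b\<in>B. bracket b (bracket b v)) = scale (form \<mu> \<mu>) v"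
    by (simp add: root_space_eigen[OF v BT] bracket_scale_right scale_sum_left)
  have fin: "finite P" using P(1) finite_roots finite_subset by blast
  have disj: "P \<inter> uminus ` P = {}" using P(2) by auto
  have a: "bracket (Y \<gamma>) (bracket (X \<gamma>) v) = 0" if "\<gamma> \<in> P" for \<gamma>
    using kill[OF that X] that by (simp add: R)
  have b: "bracket (Y (- \<gamma>)) (bracket (X (- \<gamma>)) v) = scale (form \<mu> \<gamma>) v" if g: "\<gamma> \<in> P" for \<gamma>
  proof -
    have gR: "- \<gamma> \<in> R" and gr: "\<gamma> \<in> roots" using g P(1) by (auto simp: R)
    have y: "Y (- \<gamma>) \<in> root_space \<gamma>" using Y[OF gR] by simp
    have "represents (bracket (Y (- \<gamma>)) (X (- \<gamma>))) \<gamma>"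
      using bracket_opposite_represents[OF root_dual[OF gr] y X[OF gR]] k[OF gR]
      by (simp add: killing_commute[of "Y (- \<gamma>)"] fscale_def)
    then have T: "bracket (Y (- \<gamma>)) (X (- \<gamma>)) \<in> T" and f: "form \<mu> \<gamma> = \<mu> (bracket (Y (- \<gamma>)) (X (- \<gamma>)))"
      using form_represents[OF t] by (auto simp: represents_def)
    have "bracket (Y (- \<gamma>)) (bracket (X (- \<gamma>)) v) = bracket (bracket (Y (- \<gamma>)) (X (- \<gamma>))) v"
      using bracket_derivation[of "Y (- \<gamma>)" "X (- \<gamma>)" v] kill[OF g y] by simp
    then show ?thesis using root_space_eigen[OF v T] f by simp
  qed
  have "(\<Sum>\<gamma>\<in>R. bracket (Y \<gamma>) (bracket (X \<gamma>) v))
      = (\<Sum>\<gamma>\<in>P. bracket (Y \<gamma>) (bracket (X \<gamma>) v)) + (\<Sum>\<gamma>\<in>uminus ` P. bracket (Y \<gamma>) (bracket (X \<gamma>) v))"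
    unfolding R using fin disj by (intro sum.union_disjoint) auto
  also have "(\<Sum>\<gamma>\<in>uminus ` P. bracket (Y \<gamma>) (bracket (X \<gamma>) v)) = (\<Sum>\<gamma>\<in>P. bracket (Y (- \<gamma>)) (bracket (X (- \<gamma>)) v))"
    by (subst sum.reindex) (auto simp: inj_on_def)
  finally have "(\<Sum>\<gamma>\<in>R. bracket (Y \<gamma>) (bracket (X \<gamma>) v)) = scale (\<Sum>\<gamma>\<in>P. form \<mu> \<gamma>) v"
    by (simp add: a b scale_sum_left)
  then show ?thesis using 1 C[rule_format, of v] by (simp add: scale_left_distrib)
qed

lemma Levi_roots: "Levi roots = UNIV"
  using root_decomposition by (simp add: Levi_def)

lemma casimir_UNIV: "casimir UNIV x = x"
proof -
  obtain n e e' where D: "dual_bases UNIV n e e'"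
  proof -
    have "\<forall>\<gamma>\<in>roots. - \<gamma> \<in> roots" using root_minus by blast
    from Levi_casimir[OF subset_refl this] show ?thesis
      unfolding Levi_roots by (elim exE conjE) (rule that)
  qed
  have "casimir UNIV x - x = 0"
    by (rule killing_nondegenerate) (simp add: killing_diff_left killing_casimir_UNIV[OF D])
  then show ?thesis by simp
qed

end

section \<open>The grading of a simple root\<close>

context based_simple_lie_algebra
begin

text \<open>Here the simple system is used: it spans the dual space, and roots are represented.\<close>

lemma dual_represented: "f \<in> dual \<Longrightarrow> represents (representer f) f"
proof -
  assume "f \<in> dual"
  then have "f \<in> functional.span simples" using simples_span by simp
  then have "\<exists>h. represents h f"
  proof (induction rule: functional.span_induct_alt)
    case base
    then show ?case using represents_0 by blast
  next
    case (step c x y)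
    then show ?case using represents_add represents_scale representer[OF simple_root] by metis
  qed
  then show ?thesis using representer_eqI by metis
qed

lemma simple_coroots_separate:
  assumes f: "f \<in> dual" and z: "\<And>\<beta>. \<beta> \<in> simples \<Longrightarrow> f (coroot \<beta>) = 0"
  shows "f = 0"
proof -
  define t where "t = representer f"
  have t: "represents t f" unfolding t_def by (rule dual_represented[OF f])
  then have tT: "t \<in> T" by (simp add: represents_def)
  have b0: "\<beta> t = 0" if b: "\<beta> \<in> simples" for \<beta>
  proof -
    note rb = representer[OF simple_root[OF b]]
    have "f (coroot \<beta>) = 2 / form \<beta> \<beta> * f (representer \<beta>)"
      using rb by (simp add: coroot_def dual_scale[OF f] represents_def)
    then have "f (representer \<beta>) = 0" using z[OF b] form_root_self_nonzero[OF simple_root[OF b]] by simp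
    moreover have "f (representer \<beta>) = killing t (representer \<beta>)" using t rb by (simp add: represents_def)
    moreover have "\<beta> t = killing (representer \<beta>) t" using rb tT by (simp add: represents_def)
    ultimately show ?thesis by (simp add: killing_commute)
  qed
  have g0: "g t = 0" if "g \<in> dual" for g
  proof -
    have "g \<in> functional.span simples" using that simples_span by simp
    then show ?thesis
      by (induction rule: functional.span_induct_alt) (auto simp: fscale_def b0)
  qed
  have "t = 0"
  proof (rule killing_T_nondegenerate[OF tT])
    fix h assume h: "h \<in> T"
    have "wt b t = 0" if "b \<in> wB" for b
      using g0[OF weight_dual[OF wt_supported wt_gws]] that by blast
    then show "killing t h = 0" by (simp add: killing_T[OF tT h])
  qed
  then have "f x = 0" for x
    using t dual_supported[OF f] by (cases "x \<in> T") (auto simp: represents_def supported_def)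
  then show ?thesis by (simp add: fun_eq_iff)
qed

definition upper :: "('g \<Rightarrow> 'k) \<Rightarrow> ('g \<Rightarrow> 'k) set" where
  "upper \<alpha> = {\<gamma> \<in> roots. ht \<alpha> \<gamma> \<ge> 1}"
definition level0 :: "('g \<Rightarrow> 'k) \<Rightarrow> ('g \<Rightarrow> 'k) set" where
  "level0 \<alpha> = {\<gamma> \<in> pos_roots. ht \<alpha> \<gamma> = 0}"

lemma finite_upper: "finite (upper \<alpha>)" and finite_level0: "finite (level0 \<alpha>)"
  using finite_roots by (auto simp: upper_def level0_def pos_roots_def)

lemma pos_roots_split:
  assumes a: "\<alpha> \<in> simples"
  shows "pos_roots = upper \<alpha> \<union> level0 \<alpha>" "upper \<alpha> \<inter> level0 \<alpha> = {}"
proof -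
  have "\<gamma> \<in> upper \<alpha> \<union> level0 \<alpha>" if "\<gamma> \<in> pos_roots" for \<gamma>
    using pos_ht[OF that a] that pos_root[OF that] by (auto simp: upper_def level0_def)
  moreover have "\<gamma> \<in> pos_roots" if "\<gamma> \<in> upper \<alpha>" for \<gamma>
    using that pos_rootI[OF _ a] by (auto simp: upper_def)
  ultimately show "pos_roots = upper \<alpha> \<union> level0 \<alpha>" by (auto simp: level0_def)
  show "upper \<alpha> \<inter> level0 \<alpha> = {}" by (auto simp: upper_def level0_def)
qed

lemma sum_split: "\<alpha> \<in> simples \<Longrightarrow> sum f pos_roots = sum f (upper \<alpha>) + sum f (level0 \<alpha>)"
  using pos_roots_split by (simp add: sum.union_disjoint finite_upper finite_level0)

lemma reflection_ht:
  assumes "\<gamma> \<in> roots" "\<beta> \<in> simples" "\<delta> \<in> simples" "\<delta> \<noteq> \<beta>"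
  shows "ht \<delta> (\<gamma> - fscale (of_int (cart \<gamma> \<beta>)) \<beta>) = ht \<delta> \<gamma>"
  using assms by (simp add: ht_diff ht_scale lattice_scale root_lattice simple_root ht_simple)

text \<open>The equality \<open>\<langle>2\<rho>, \<alpha>\<rangle> = 2\<close>: the reflection in
  \<open>\<alpha>\<close> permutes the positive roots other than \<open>\<alpha>\<close>.\<close>

lemma sum_pos_roots_cart:
  assumes a: "\<alpha> \<in> simples"
  shows "(\<Sum>\<gamma>\<in>pos_roots. cart \<gamma> \<alpha>) = 2"
proof -
  have fin: "finite pos_roots" using finite_roots by (simp add: pos_roots_def)
  have "(\<Sum>\<gamma>\<in>pos_roots - {\<alpha>}. cart \<gamma> \<alpha>) = 0"
  proof (rule sum_cart_reflection_closed[OF _ simple_root[OF a]])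
    show "pos_roots - {\<alpha>} \<subseteq> roots" using pos_root by blast
    fix \<gamma> assume g: "\<gamma> \<in> pos_roots - {\<alpha>}"
    then obtain \<beta> where b: "\<beta> \<in> simples" "\<beta> \<noteq> \<alpha>" "ht \<beta> \<gamma> > 0" using pos_other_ht[of \<gamma> \<alpha>] a by blast
    let ?s = "\<gamma> - fscale (of_int (cart \<gamma> \<alpha>)) \<alpha>"
    have gr: "\<gamma> \<in> roots" using g pos_root by blast
    have h: "ht \<beta> ?s > 0" using reflection_ht[OF gr a b(1,2)] b(3) by simp
    moreover have "ht \<beta> \<alpha> = 0" using ht_simple[OF a b(1)] b(2) by simp
    ultimately have "?s \<noteq> \<alpha>" by auto
    then show "?s \<in> pos_roots - {\<alpha>}" using pos_rootI[OF reflection_root[OF gr simple_root[OF a]] b(1) h] by simp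
  qed
  then show ?thesis
    using fin simple_pos[OF a] cart_self[OF simple_root[OF a]] by (simp add: sum.remove[of pos_roots \<alpha>])
qed

text \<open>Reflections in the simple roots other than \<open>\<alpha>\<close> preserve the
  \<open>\<alpha>\<close>-height.\<close>

lemma sum_upper_cart_other:
  assumes a: "\<alpha> \<in> simples" and b: "\<beta> \<in> simples" and ne: "\<beta> \<noteq> \<alpha>"
  shows "(\<Sum>\<gamma>\<in>upper \<alpha>. cart \<gamma> \<beta>) = 0"
  by (rule sum_cart_reflection_closed[OF _ simple_root[OF b]])
    (use reflection_ht[OF _ b a ne[symmetric]] reflection_root[OF _ simple_root[OF b]] in \<open>auto simp: upper_def\<close>)

text \<open>The coefficient of \<open>\<phi>\<^sub>\<alpha>\<close> in the sum of the roots of positive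
  \<open>\<alpha>\<close>-height.\<close>

definition q_int :: "('g \<Rightarrow> 'k) \<Rightarrow> int" where
  "q_int \<alpha> = (\<Sum>\<gamma>\<in>upper \<alpha>. cart \<gamma> \<alpha>)"

lemma sum_level0_cart: "\<alpha> \<in> simples \<Longrightarrow> (\<Sum>\<gamma>\<in>level0 \<alpha>. cart \<gamma> \<alpha>) = 2 - q_int \<alpha>"
  using sum_pos_roots_cart[of \<alpha>] sum_split[of \<alpha> "\<lambda>\<gamma>. cart \<gamma> \<alpha>"] by (simp add: q_int_def)

text \<open>Distinct simple roots have nonpositive Cartan integers, hence so has a root of
  \<open>\<alpha>\<close>-height zero with \<open>\<alpha>\<close>; subtracting their sum from
  \<open>\<langle>2\<rho>, \<alpha>\<rangle> = 2\<close> leaves something positive.\<close>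

lemma q_int_pos:
  assumes a: "\<alpha> \<in> simples"
  shows "q_int \<alpha> > 0"
proof -
  have "cart \<gamma> \<alpha> \<le> 0" if g: "\<gamma> \<in> level0 \<alpha>" for \<gamma>
  proof -
    have gp: "\<gamma> \<in> pos_roots" and g0: "ht \<alpha> \<gamma> = 0" using g by (auto simp: level0_def)
    have "ht \<delta> \<gamma> * cart \<delta> \<alpha> \<le> 0" if d: "\<delta> \<in> simples" for \<delta>
    proof (cases "\<delta> = \<alpha>")
      case False
      then show ?thesis
        using simple_cart_nonpos[OF d a] pos_ht[OF gp d] by (simp add: mult_nonneg_nonpos)
    qed (simp add: g0)
    then show ?thesis unfolding cart_comb[OF pos_root[OF gp] simple_root[OF a]] by (intro sum_nonpos)
  qed
  then have "(\<Sum>\<gamma>\<in>level0 \<alpha>. cart \<gamma> \<alpha>) \<le> 0" by (intro sum_nonpos)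
  then show ?thesis using sum_level0_cart[OF a] by simp
qed

lemma sum_apply: "(\<Sum>\<gamma>\<in>A. f \<gamma>) h = (\<Sum>\<gamma>\<in>A. f \<gamma> h)" for f :: "'x \<Rightarrow> 'g \<Rightarrow> 'k"
  by (induction A rule: infinite_finite_induct) auto

lemma upper_dual: "(\<Sum>\<gamma>\<in>upper \<alpha>. \<gamma>) \<in> dual"
  by (intro dual_closed(6)) (auto simp: upper_def root_dual)

lemma upper_coroot:
  assumes a: "\<alpha> \<in> simples" and b: "\<beta> \<in> simples"
  shows "(\<Sum>\<gamma>\<in>upper \<alpha>. \<gamma>) (coroot \<beta>) = (if \<beta> = \<alpha> then of_int (q_int \<alpha>) else 0)"
proof -
  have "(\<Sum>\<gamma>\<in>upper \<alpha>. \<gamma>) (coroot \<beta>) = (\<Sum>\<gamma>\<in>upper \<alpha>. of_int (cart \<gamma> \<beta>))"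
    unfolding sum_apply by (rule sum.cong) (auto simp: upper_def cart simple_root b)
  also have "\<dots> = of_int (\<Sum>\<gamma>\<in>upper \<alpha>. cart \<gamma> \<beta>)" by simp
  finally have "(\<Sum>\<gamma>\<in>upper \<alpha>. \<gamma>) (coroot \<beta>) = of_int (\<Sum>\<gamma>\<in>upper \<alpha>. cart \<gamma> \<beta>)" .
  then show ?thesis using sum_upper_cart_other[OF a b] by (cases "\<beta> = \<alpha>") (simp_all add: q_int_def)
qed

lemma fundamental_weight_upper:
  assumes a: "\<alpha> \<in> simples"
  shows "(\<Sum>\<gamma>\<in>upper \<alpha>. \<gamma>) = fscale (of_int (q_int \<alpha>)) (fundamental_weight \<alpha>)"
    and "fundamental_weight \<alpha> \<noteq> 0"
proof -
  define s where "s = (\<Sum>\<gamma>\<in>upper \<alpha>. \<gamma>)"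
  define \<phi> where "\<phi> = fscale (1 / of_int (q_int \<alpha>)) s"
  have Q0: "(of_int (q_int \<alpha>) :: 'k) \<noteq> 0" using q_int_pos[OF a] by simp
  have pd: "\<phi> \<in> dual" unfolding \<phi>_def s_def by (intro dual_closed(2) upper_dual)
  have pc: "\<phi> (coroot \<beta>) = (if \<beta> = \<alpha> then 1 else 0)" if "\<beta> \<in> simples" for \<beta>
    using upper_coroot[OF a that] Q0 by (simp add: \<phi>_def s_def fscale_def)
  have conv: "2 * form \<psi> \<beta> / form \<beta> \<beta> = \<psi> (coroot \<beta>)" if "\<psi> \<in> dual" "\<beta> \<in> simples" for \<psi> \<beta>
    using represents_coroot[OF dual_represented[OF that(1)] that(1) simple_root[OF that(2)]] by simp
  have fw: "fundamental_weight \<alpha> = \<phi>"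
    unfolding fundamental_weight_def
  proof (rule the_equality)
    show "\<phi> \<in> dual \<and> (\<forall>\<beta>\<in>simples. 2 * form \<phi> \<beta> / form \<beta> \<beta> = (if \<beta> = \<alpha> then 1 else 0))"
      using pd pc conv by simp
  next
    fix \<psi> assume p: "\<psi> \<in> dual \<and> (\<forall>\<beta>\<in>simples. 2 * form \<psi> \<beta> / form \<beta> \<beta> = (if \<beta> = \<alpha> then 1 else 0))"
    have "\<psi> - \<phi> = 0"
      using p pc conv by (intro simple_coroots_separate dual_closed(4) pd) auto
    then show "\<psi> = \<phi>" by simp
  qed
  have "s = fscale (of_int (q_int \<alpha>)) \<phi>" using Q0 by (simp add: \<phi>_def fscale_def)
  then show "(\<Sum>\<gamma>\<in>upper \<alpha>. \<gamma>) = fscale (of_int (q_int \<alpha>)) (fundamental_weight \<alpha>)" by (simp add: fw s_def)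
  show "fundamental_weight \<alpha> \<noteq> 0" using pc[OF a] fw by auto
qed

lemma q_number_eq:
  assumes a: "\<alpha> \<in> simples"
  shows "int (q_number \<alpha>) = q_int \<alpha>"
proof -
  have U: "(\<Union>i\<in>{1..}. roots_of_ht \<alpha> i) = upper \<alpha>" by (auto simp: roots_of_ht_def upper_def)
  have "q_number \<alpha> = nat (q_int \<alpha>)"
    unfolding q_number_def U
  proof (rule the_equality)
    show "0 < nat (q_int \<alpha>) \<and> (\<Sum>\<gamma>\<in>upper \<alpha>. \<gamma>) = fscale (of_nat (nat (q_int \<alpha>))) (fundamental_weight \<alpha>)"
      using q_int_pos[OF a] fundamental_weight_upper(1)[OF a] by simp
  next
    fix q assume q: "0 < q \<and> (\<Sum>\<gamma>\<in>upper \<alpha>. \<gamma>) = fscale (of_nat q) (fundamental_weight \<alpha>)"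
    obtain t where t: "fundamental_weight \<alpha> t \<noteq> 0" using fundamental_weight_upper(2)[OF a] by (auto simp: fun_eq_iff)
    have "fscale (of_nat q) (fundamental_weight \<alpha>) t = fscale (of_int (q_int \<alpha>)) (fundamental_weight \<alpha>) t"
      using q fundamental_weight_upper(1)[OF a] by metis
    then have "(of_int (int q) :: 'k) = of_int (q_int \<alpha>)" using t by (simp add: fscale_def)
    then have "int q = q_int \<alpha>" by (simp only: of_int_eq_iff)
    then show "q = nat (q_int \<alpha>)" by simp
  qed
  then show ?thesis using q_int_pos[OF a] by simp
qed

lemma pos_roots_antisymmetric:
  assumes g: "\<gamma> \<in> pos_roots"
  shows "- \<gamma> \<notin> pos_roots"
proof
  assume m: "- \<gamma> \<in> pos_roots"
  note l = root_lattice[OF pos_root[OF g]]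
  have "\<gamma> = 0"
  proof (rule lattice_eqI[OF l lattice_0])
    fix \<beta> assume "\<beta> \<in> simples"
    then show "ht \<beta> \<gamma> = ht \<beta> 0" using pos_ht[OF g, of \<beta>] pos_ht[OF m, of \<beta>] ht_minus[OF l, of \<beta>] ht_0[of \<beta>] by simp
  qed
  then show False using root_nonzero[OF pos_root[OF g]] by simp
qed

lemma highest_root_bracket:
  assumes g: "\<gamma> \<in> pos_roots" and x: "x \<in> root_space \<gamma>" and v: "v \<in> root_space highest_root"
  shows "bracket x v = 0"
proof -
  note tp = highest_root(1)
  note l = root_lattice[OF pos_root[OF tp]] root_lattice[OF pos_root[OF g]]
  obtain \<beta> where b: "\<beta> \<in> simples" "ht \<beta> \<gamma> > 0"
  proof (cases "\<gamma> \<in> simples")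
    case True
    then show ?thesis using that[of \<gamma>] ht_simple by simp
  next
    case False
    then obtain \<alpha> where a: "\<alpha> \<in> simples" using simple_descent[OF g] by blast
    then have "\<gamma> \<noteq> \<alpha>" using False by blast
    then show ?thesis using pos_other_ht[OF g a] that by blast
  qed
  have h: "ht \<beta> (\<gamma> + highest_root) > ht \<beta> highest_root" using b by (simp add: ht_add l)
  have "\<gamma> + highest_root \<notin> roots"
  proof
    assume r: "\<gamma> + highest_root \<in> roots"
    have "0 \<le> ht \<beta> (highest_root - (\<gamma> + highest_root))" using highest_root(2)[OF r] b(1) by (auto simp: nonneg_comb_iff)
    then show False using h b(1) by (simp add: ht_minus ht_add l)
  qed
  moreover have "\<gamma> + highest_root \<noteq> 0" using h pos_ht[OF tp b(1)] ht_0[OF b(1)] by auto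
  ultimately have "root_space (\<gamma> + highest_root) = {0}"
    using not_root_space[OF dual_closed(1)[OF root_dual root_dual]] pos_root g tp by blast
  then show ?thesis using root_space_bracket[OF x v] by simp
qed

text \<open>The Casimir element of the whole algebra acts as the identity, while on a highest root vector it
  acts as \<open>(\<theta>, \<theta>) + (\<theta>, 2\<rho>)\<close>.\<close>

lemma form_highest_root: "form highest_root highest_root + (\<Sum>\<gamma>\<in>pos_roots. form highest_root \<gamma>) = 1"
proof -
  let ?t = highest_root
  note tp = highest_root(1)
  obtain v where v: "v \<in> root_space ?t" "v \<noteq> 0" using root_vector_exists[OF pos_root[OF tp]] by blast
  have R: "roots = pos_roots \<union> uminus ` pos_roots"
    using root_sign pos_root root_minus by (force simp: image_iff)
  have kill: "bracket x v = 0" if g: "\<gamma> \<in> pos_roots" and x: "x \<in> root_space \<gamma>" for \<gamma> x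
    by (rule highest_root_bracket[OF g x v(1)])
  have "casimir (Levi roots) v = scale (form ?t ?t + (\<Sum>\<gamma>\<in>pos_roots. form ?t \<gamma>)) v"
    by (rule Levi_casimir_extremal[OF _ pos_roots_antisymmetric R pos_root[OF tp] v(1) kill]) (auto dest: pos_root)
  then have "scale (form ?t ?t + (\<Sum>\<gamma>\<in>pos_roots. form ?t \<gamma>)) v = scale 1 v"
    by (simp add: Levi_roots casimir_UNIV)
  then show ?thesis using v(2) by (simp only: scale_cancel_right) simp
qed

text \<open>The normalisation \<open>(\<theta>, \<theta>) = 1/h\<^sup>*\<close>.\<close>

lemma dual_coxeter_number_form: "dual_coxeter_number * form highest_root highest_root = 1"
proof -
  let ?t = highest_root
  have t: "?t \<in> roots" by (rule pos_root[OF highest_root(1)])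
  have "represents (scale (1 / 2) (\<Sum>\<gamma>\<in>pos_roots. representer \<gamma>)) weyl_vector"
    unfolding weyl_vector_def by (intro represents_scale sum_represents representer pos_root)
  then have "form weyl_vector ?t = weyl_vector (representer ?t)"
    by (rule form_represents[OF _ representer[OF t]])
  also have "\<dots> = (\<Sum>\<gamma>\<in>pos_roots. form ?t \<gamma>) / 2"
    unfolding weyl_vector_def fscale_def sum_apply
    using form_represents[OF representer[OF pos_root] representer[OF t]]
    by (simp add: form_commute[of _ ?t] cong: sum.cong)
  finally have "2 * form weyl_vector ?t = (\<Sum>\<gamma>\<in>pos_roots. form ?t \<gamma>)" by (simp add: mult.commute)
  then show ?thesis
    using form_highest_root form_root_self_nonzero[OF t] by (simp add: dual_coxeter_number_def field_simps)
qed

lemma Levi_graded_0: "graded_part \<alpha> 0 = Levi (roots_of_ht \<alpha> 0)"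
  by (simp add: graded_part_def Levi_def)

lemma roots_ht_0:
  assumes a: "\<alpha> \<in> simples"
  shows "roots_of_ht \<alpha> 0 = level0 \<alpha> \<union> uminus ` level0 \<alpha>"
proof
  show "roots_of_ht \<alpha> 0 \<subseteq> level0 \<alpha> \<union> uminus ` level0 \<alpha>"
  proof
    fix \<gamma> assume "\<gamma> \<in> roots_of_ht \<alpha> 0"
    then have g: "\<gamma> \<in> roots" "ht \<alpha> \<gamma> = 0" by (auto simp: roots_of_ht_def)
    have "ht \<alpha> (- \<gamma>) = 0" using ht_minus[OF root_lattice[OF g(1)] a] g(2) by simp
    then show "\<gamma> \<in> level0 \<alpha> \<union> uminus ` level0 \<alpha>"
      using root_sign[OF g(1)] g(2) image_eqI[of \<gamma> uminus "- \<gamma>" "level0 \<alpha>"] by (auto simp: level0_def)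
  qed
  show "level0 \<alpha> \<union> uminus ` level0 \<alpha> \<subseteq> roots_of_ht \<alpha> 0"
    using a by (auto simp: level0_def roots_of_ht_def pos_root root_minus ht_minus root_lattice)
qed


abbreviation Cas :: "('g \<Rightarrow> 'k) \<Rightarrow> 'g \<Rightarrow> 'g" where
  "Cas \<alpha> \<equiv> casimir (graded_part \<alpha> 0)"

lemma graded_0_dual_bases:
  assumes a: "\<alpha> \<in> simples"
  obtains n e e' where "dual_bases (graded_part \<alpha> 0) n e e'"
proof -
  have R: "roots_of_ht \<alpha> 0 \<subseteq> roots" by (auto simp: roots_of_ht_def)
  have "\<forall>\<gamma>\<in>roots_of_ht \<alpha> 0. - \<gamma> \<in> roots_of_ht \<alpha> 0"
    using a by (auto simp: roots_of_ht_def root_minus ht_minus root_lattice)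
  from Levi_casimir[OF R this] show ?thesis
    by (elim exE conjE) (rule that[unfolded Levi_graded_0])
qed

lemma T_graded_0: "T \<subseteq> graded_part \<alpha> 0"
  unfolding Levi_graded_0 Levi_def by (auto intro: span_base)

lemma root_space_graded_0: "\<gamma> \<in> roots_of_ht \<alpha> 0 \<Longrightarrow> root_space \<gamma> \<subseteq> graded_part \<alpha> 0"
  unfolding Levi_graded_0 Levi_def by (auto intro: span_base)

lemma root_space_sum_graded_0:
  assumes a: "\<alpha> \<in> simples" and g: "\<gamma> \<in> roots" "ht \<alpha> \<gamma> = 0" and d: "\<delta> \<in> roots" "ht \<alpha> \<delta> = 0"
  shows "root_space (\<gamma> + \<delta>) \<subseteq> graded_part \<alpha> 0"
proof (cases "\<gamma> + \<delta> \<in> roots")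
  case True
  then have "\<gamma> + \<delta> \<in> roots_of_ht \<alpha> 0" using a g d by (simp add: roots_of_ht_def ht_add root_lattice)
  then show ?thesis by (rule root_space_graded_0)
next
  case False
  show ?thesis
  proof (cases "\<gamma> + \<delta> = 0")
    case True
    then show ?thesis using root_space_0 T_graded_0 by metis
  next
    case ne: False
    then have "root_space (\<gamma> + \<delta>) = {0}"
      using not_root_space[OF dual_closed(1)[OF root_dual[OF g(1)] root_dual[OF d(1)]]] False by simp
    then show ?thesis by (simp add: graded_part_def span_zero)
  qed
qed

lemma graded_0_subalgebra:
  assumes a: "\<alpha> \<in> simples" and s: "s \<in> T \<or> (\<exists>\<gamma>\<in>roots_of_ht \<alpha> 0. s \<in> root_space \<gamma>)"
    and x: "x \<in> graded_part \<alpha> 0"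
  shows "bracket s x \<in> graded_part \<alpha> 0"
proof -
  let ?G = "graded_part \<alpha> 0"
  have G: "subspace ?G" by (simp add: graded_part_def)
  have gen: "bracket s z \<in> ?G" if zin: "z \<in> T \<union> (\<Union>\<gamma>\<in>roots_of_ht \<alpha> 0. root_space \<gamma>)" for z
  proof -
    have rs: "bracket t y \<in> ?G" if "t \<in> T" "\<gamma> \<in> roots_of_ht \<alpha> 0" "y \<in> root_space \<gamma>" for t \<gamma> y
      using root_space_eigen[OF that(3,1)] root_space_graded_0[OF that(2)] that(3) subspace_scale[OF G] by auto
    show ?thesis
    proof (cases "s \<in> T")
      case True
      then show ?thesis using zin rs T_abelian subspace_0[OF G] by auto
    next
      case False
      then obtain \<gamma> where g: "\<gamma> \<in> roots_of_ht \<alpha> 0" "s \<in> root_space \<gamma>" using s by blast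
      show ?thesis
      proof (cases "z \<in> T")
        case True
        then show ?thesis using rs[OF True g] bracket_anti[of s z] subspace_neg[OF G] by simp
      next
        case False
        then obtain \<delta> where d: "\<delta> \<in> roots_of_ht \<alpha> 0" "z \<in> root_space \<delta>" using zin by blast
        then show ?thesis
          using root_space_bracket[OF g(2) d(2)] root_space_sum_graded_0[OF a, of \<gamma> \<delta>] g d
          by (auto simp: roots_of_ht_def)
      qed
    qed
  qed
  have "x \<in> span (T \<union> (\<Union>\<gamma>\<in>roots_of_ht \<alpha> 0. root_space \<gamma>))" using x by (simp add: graded_part_def)
  then show ?thesis
  proof (induction rule: span_induct_alt)
    case (step c x y)
    then show ?case
      by (simp only: bracket_add_right bracket_scale_right subspace_add[OF G] subspace_scale[OF G] gen)
  qed (simp add: subspace_0[OF G])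
qed

lemma Cas_commutes:
  assumes a: "\<alpha> \<in> simples" and s: "s \<in> T \<or> (\<exists>\<gamma>\<in>roots_of_ht \<alpha> 0. s \<in> root_space \<gamma>)"
  shows "bracket s (Cas \<alpha> x) = Cas \<alpha> (bracket s x)"
proof -
  obtain n e e' where "dual_bases (graded_part \<alpha> 0) n e e'" by (rule graded_0_dual_bases[OF a])
  then show ?thesis by (rule casimir_commutes) (rule graded_0_subalgebra[OF a s])
qed

lemma lin_Cas: "\<alpha> \<in> simples \<Longrightarrow> lin (Cas \<alpha>)"
  using graded_0_dual_bases lin_casimir by metis

lemma Cas_scalar_of_vector:
  assumes a: "\<alpha> \<in> simples" and g: "\<gamma> \<in> roots" and v: "v \<in> root_space \<gamma>" "v \<noteq> 0" "Cas \<alpha> v = scale c v"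
    and x: "x \<in> root_space \<gamma>"
  shows "Cas \<alpha> x = scale c x"
proof -
  obtain k where "x = scale k v" using root_space_one_dim[OF g v(1,2) x] by blast
  then show ?thesis by (simp add: lin_scale[OF lin_Cas[OF a]] v(3) mult.commute)
qed

lemma Cas_on_root_space:
  assumes a: "\<alpha> \<in> simples" and g: "\<gamma> \<in> roots" and v: "v \<in> root_space \<gamma>"
  shows "\<exists>c. Cas \<alpha> v = scale c v"
proof (cases "v = 0")
  case True
  then show ?thesis by (simp add: lin_zero[OF lin_Cas[OF a]])
next
  case False
  have "Cas \<alpha> v \<in> root_space \<gamma>"
    unfolding root_space_def
    using Cas_commutes[OF a] root_space_eigen[OF v] by (auto simp: lin_scale[OF lin_Cas[OF a]])
  then show ?thesis using root_space_one_dim[OF g v False] by blast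
qed

text \<open>This is \<open>(\<theta>, q \<phi>\<^sub>\<alpha>) = d q (\<alpha>, \<alpha>)/2\<close>.\<close>

lemma form_highest_upper:
  assumes a: "\<alpha> \<in> simples"
  shows "(\<Sum>\<gamma>\<in>upper \<alpha>. form highest_root \<gamma>) = of_int (depth \<alpha>) * of_int (q_int \<alpha>) * form \<alpha> \<alpha> / 2"
proof -
  let ?t = highest_root
  have t: "?t \<in> roots" by (rule pos_root[OF highest_root(1)])
  have up: "\<gamma> \<in> roots" if "\<gamma> \<in> upper \<alpha>" for \<gamma> using that by (simp add: upper_def)
  have e: "form ?t \<gamma> = (\<Sum>\<beta>\<in>simples. of_int (ht \<beta> ?t) * form \<gamma> \<beta>)" if g: "\<gamma> \<in> upper \<alpha>" for \<gamma>
  proof -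
    have "form ?t \<gamma> = comb (\<lambda>\<beta>. ht \<beta> ?t) (representer \<gamma>)"
      using form_represents[OF representer[OF t] representer[OF up[OF g]]] comb_ht[OF root_lattice[OF t]] by simp
    also have "\<dots> = (\<Sum>\<beta>\<in>simples. of_int (ht \<beta> ?t) * form \<gamma> \<beta>)"
      unfolding comb_apply
      using form_represents[OF representer[OF simple_root] representer[OF up[OF g]]]
      by (intro sum.cong) (auto simp: form_commute[of \<gamma>])
    finally show ?thesis .
  qed
  have "(\<Sum>\<gamma>\<in>upper \<alpha>. form ?t \<gamma>) = (\<Sum>\<gamma>\<in>upper \<alpha>. \<Sum>\<beta>\<in>simples. of_int (ht \<beta> ?t) * form \<gamma> \<beta>)"
    by (rule sum.cong) (auto simp: e)
  also have "\<dots> = (\<Sum>\<beta>\<in>simples. of_int (ht \<beta> ?t) * (\<Sum>\<gamma>\<in>upper \<alpha>. form \<gamma> \<beta>))"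
    unfolding sum_distrib_left by (rule sum.swap)
  also have "\<dots> = (\<Sum>\<beta>\<in>simples. if \<beta> = \<alpha> then of_int (ht \<beta> ?t) * (of_int (q_int \<alpha>) * form \<alpha> \<alpha> / 2) else 0)"
  proof (rule sum.cong[OF refl])
    fix \<beta> assume b: "\<beta> \<in> simples"
    have "(\<Sum>\<gamma>\<in>upper \<alpha>. form \<gamma> \<beta>) = (\<Sum>\<gamma>\<in>upper \<alpha>. of_int (cart \<gamma> \<beta>) * (form \<beta> \<beta> / 2))"
      by (rule sum.cong) (auto simp: form_cart[OF up simple_root[OF b]])
    also have "\<dots> = of_int (\<Sum>\<gamma>\<in>upper \<alpha>. cart \<gamma> \<beta>) * (form \<beta> \<beta> / 2)"
      by (simp only: sum_distrib_right of_int_sum)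
    finally have "(\<Sum>\<gamma>\<in>upper \<alpha>. form \<gamma> \<beta>) = of_int (\<Sum>\<gamma>\<in>upper \<alpha>. cart \<gamma> \<beta>) * (form \<beta> \<beta> / 2)" .
    then show "of_int (ht \<beta> ?t) * (\<Sum>\<gamma>\<in>upper \<alpha>. form \<gamma> \<beta>)
        = (if \<beta> = \<alpha> then of_int (ht \<beta> ?t) * (of_int (q_int \<alpha>) * form \<alpha> \<alpha> / 2) else 0)"
      using sum_upper_cart_other[OF a b] by (cases "\<beta> = \<alpha>") (simp_all add: q_int_def)
  qed
  also have "\<dots> = of_int (depth \<alpha>) * of_int (q_int \<alpha>) * form \<alpha> \<alpha> / 2"
    using a finite_simples by (simp add: depth_def)
  finally show ?thesis .
qed

lemma level0_roots: "level0 \<alpha> \<subseteq> roots"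
  using pos_root by (auto simp: level0_def)

text \<open>The highest root vector is killed by the positive half of the roots of
  \<open>\<alpha>\<close>-height zero. Removing the roots of positive \<open>\<alpha>\<close>-height
  from the sum \<open>(\<theta>, \<theta>) + (\<theta>, 2\<rho>) = 1\<close> leaves the scalar.\<close>

lemma Cas_highest:
  assumes a: "\<alpha> \<in> simples" and v: "v \<in> root_space highest_root"
  shows "Cas \<alpha> v = scale (1 - of_int (depth \<alpha>) * of_int (q_int \<alpha>) * form \<alpha> \<alpha> / 2) v"
proof -
  have "Cas \<alpha> v = scale (form highest_root highest_root + (\<Sum>\<gamma>\<in>level0 \<alpha>. form highest_root \<gamma>)) v"
    unfolding Levi_graded_0
  proof (rule Levi_casimir_extremal[OF level0_roots _ roots_ht_0[OF a] pos_root[OF highest_root(1)] v])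
    show "- \<gamma> \<notin> level0 \<alpha>" if "\<gamma> \<in> level0 \<alpha>" for \<gamma>
      using that pos_roots_antisymmetric by (auto simp: level0_def)
    show "bracket x v = 0" if "\<gamma> \<in> level0 \<alpha>" "x \<in> root_space \<gamma>" for \<gamma> x
      using that highest_root_bracket[OF _ _ v] by (auto simp: level0_def)
  qed
  moreover have "form highest_root highest_root + (\<Sum>\<gamma>\<in>level0 \<alpha>. form highest_root \<gamma>)
      = 1 - (\<Sum>\<gamma>\<in>upper \<alpha>. form highest_root \<gamma>)"
    using form_highest_root sum_split[OF a, of "form highest_root"] by (simp add: algebra_simps)
  ultimately show ?thesis using form_highest_upper[OF a] by simp
qed

text \<open>The vector is a lowest weight vector of the degree-zero part, so the negative half of its roots
  plays the role of \<open>P\<close> in the extremal formula.\<close>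

lemma Cas_simple:
  assumes a: "\<alpha> \<in> simples" and v: "v \<in> root_space \<alpha>"
  shows "Cas \<alpha> v = scale (of_int (q_int \<alpha>) * form \<alpha> \<alpha> / 2) v"
proof -
  note ar = simple_root[OF a]
  have R: "roots_of_ht \<alpha> 0 = uminus ` level0 \<alpha> \<union> uminus ` (uminus ` level0 \<alpha>)"
    using roots_ht_0[OF a] by (simp add: image_image Un_commute)
  have "Cas \<alpha> v = scale (form \<alpha> \<alpha> + (\<Sum>\<gamma>\<in>uminus ` level0 \<alpha>. form \<alpha> \<gamma>)) v"
    unfolding Levi_graded_0
  proof (rule Levi_casimir_extremal[OF _ _ R ar v])
    show "uminus ` level0 \<alpha> \<subseteq> roots" using level0_roots root_minus by blast
    show "- \<gamma> \<notin> uminus ` level0 \<alpha>" if "\<gamma> \<in> uminus ` level0 \<alpha>" for \<gamma>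
      using that pos_roots_antisymmetric by (auto simp: level0_def)
    fix \<gamma> x assume "\<gamma> \<in> uminus ` level0 \<alpha>" and x: "x \<in> root_space \<gamma>"
    then obtain \<delta> where d: "\<delta> \<in> pos_roots" "ht \<alpha> \<delta> = 0" "\<gamma> = - \<delta>" by (auto simp: level0_def)
    have dr: "\<delta> \<in> roots" by (rule pos_root[OF d(1)])
    have "\<delta> \<noteq> \<alpha>" using d(2) ht_simple[OF a a] by auto
    then obtain \<beta> where b: "\<beta> \<in> simples" "\<beta> \<noteq> \<alpha>" "ht \<beta> \<delta> > 0" using pos_other_ht[OF d(1) a] by blast
    have h: "ht \<alpha> (\<alpha> - \<delta>) = 1" "ht \<beta> (\<alpha> - \<delta>) < 0"
      using a b d(2) by (auto simp: ht_diff root_lattice ar dr ht_simple)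
    have nr: "\<alpha> - \<delta> \<notin> roots"
    proof
      assume "\<alpha> - \<delta> \<in> roots"
      then have "\<alpha> - \<delta> \<in> pos_roots" by (rule pos_rootI[OF _ a]) (use h in simp)
      from pos_ht[OF this b(1)] show False using h(2) by simp
    qed
    have "\<alpha> - \<delta> \<noteq> 0" using h(1) ht_0[OF a] by auto
    then have "root_space (\<alpha> - \<delta>) = {0}"
      using not_root_space[OF dual_closed(4)[OF root_dual[OF ar] root_dual[OF dr]] _ nr] by simp
    moreover have "bracket x v \<in> root_space (- \<delta> + \<alpha>)" using root_space_bracket[OF x v] d(3) by simp
    moreover have "- \<delta> + \<alpha> = \<alpha> - \<delta>" by simp
    ultimately show "bracket x v = 0" by (metis singletonD)
  qed
  moreover have "(\<Sum>\<gamma>\<in>uminus ` level0 \<alpha>. form \<alpha> \<gamma>) = - (of_int (2 - q_int \<alpha>) * (form \<alpha> \<alpha> / 2))"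
  proof -
    have mr: "form \<alpha> (- \<gamma>) = - (of_int (cart \<gamma> \<alpha>) * (form \<alpha> \<alpha> / 2))" if g: "\<gamma> \<in> level0 \<alpha>" for \<gamma>
    proof -
      have gr: "\<gamma> \<in> roots" using g level0_roots by blast
      have "form \<alpha> (- \<gamma>) = form (- \<gamma>) \<alpha>" by (rule form_commute)
      then show ?thesis
        using form_cart[OF root_minus[OF gr] ar] cart_minus_left[OF gr ar] by simp
    qed
    have "(\<Sum>\<gamma>\<in>uminus ` level0 \<alpha>. form \<alpha> \<gamma>) = (\<Sum>\<gamma>\<in>level0 \<alpha>. form \<alpha> (- \<gamma>))"
      by (subst sum.reindex) (auto simp: inj_on_def)
    also have "\<dots> = - (of_int (\<Sum>\<gamma>\<in>level0 \<alpha>. cart \<gamma> \<alpha>) * (form \<alpha> \<alpha> / 2))"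
      by (simp only: mr of_int_sum sum_distrib_right sum_negf cong: sum.cong)
    finally show ?thesis by (simp only: sum_level0_cart[OF a])
  qed
  moreover have "form \<alpha> \<alpha> + - (of_int (2 - q_int \<alpha>) * (form \<alpha> \<alpha> / 2)) = of_int (q_int \<alpha>) * form \<alpha> \<alpha> / 2"
    by (simp add: algebra_simps diff_divide_distrib)
  ultimately show ?thesis by simp
qed

text \<open>By descent along simple roots. One of the two root vectors whose bracket gives \<open>x\<close> has
  degree zero, so the Casimir operator passes through to the other one: it is a root vector for
  \<open>\<gamma> - \<beta>\<close> if \<open>\<beta> \<noteq> \<alpha>\<close>, and for
  \<open>\<alpha>\<close> itself if \<open>\<beta> = \<alpha>\<close>.\<close>

lemma Cas_level_1:
  assumes a: "\<alpha> \<in> simples" and g: "\<gamma> \<in> pos_roots"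
  shows "ht \<alpha> \<gamma> = 1 \<Longrightarrow> x \<in> root_space \<gamma> \<Longrightarrow> Cas \<alpha> x = scale (of_int (q_int \<alpha>) * form \<alpha> \<alpha> / 2) x"
  using g
proof (induction arbitrary: x rule: pos_root_induct)
  case (simple \<beta>)
  then have "\<beta> = \<alpha>" using ht_simple[OF simple.hyps a] by (auto split: if_splits)
  then show ?case using Cas_simple[OF a] simple.prems by simp
next
  case (add \<gamma> \<beta>)
  let ?c = "of_int (q_int \<alpha>) * form \<alpha> \<alpha> / 2"
  note gr = pos_root[OF add.hyps(1)] and br = simple_root[OF add.hyps(2)] and dr = pos_root[OF add.hyps(4)]
  obtain e u where e: "e \<in> root_space \<beta>" "e \<noteq> 0" and u: "u \<in> root_space (\<gamma> - \<beta>)" "u \<noteq> 0"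
    using root_vector_exists br dr by metis
  have h: "ht \<alpha> (\<gamma> - \<beta>) = 1 - ht \<alpha> \<beta>" using add.prems(1) by (simp add: ht_diff root_lattice gr br a)
  have "bracket e u \<in> root_space (\<beta> + (\<gamma> - \<beta>))" by (rule root_space_bracket[OF e(1) u(1)])
  then have w: "bracket e u \<in> root_space \<gamma>" by simp
  have w0: "bracket e u \<noteq> 0" by (rule positive_pairing_bracket[OF gr br add.hyps(3) dr e u])
  have "Cas \<alpha> (bracket e u) = scale ?c (bracket e u)"
  proof (cases "\<beta> = \<alpha>")
    case True
    then have "\<gamma> - \<beta> \<in> roots_of_ht \<alpha> 0" using h ht_simple[OF a a] dr by (simp add: roots_of_ht_def)
    then have "Cas \<alpha> (bracket u e) = bracket u (Cas \<alpha> e)" using Cas_commutes[OF a] u(1) by metis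
    also have "\<dots> = scale ?c (bracket u e)" using Cas_simple[OF a] e(1) True by (simp add: bracket_scale_right)
    finally have "Cas \<alpha> (scale (- 1) (bracket u e)) = scale ?c (scale (- 1) (bracket u e))"
      by (simp only: lin_scale[OF lin_Cas[OF a]] scale_scale mult.commute)
    then show ?thesis using bracket_anti[of e u] by simp
  next
    case False
    then have b0: "ht \<alpha> \<beta> = 0" using ht_simple[OF add.hyps(2) a] by simp
    then have "\<beta> \<in> roots_of_ht \<alpha> 0" using br by (simp add: roots_of_ht_def)
    then have "Cas \<alpha> (bracket e u) = bracket e (Cas \<alpha> u)" using Cas_commutes[OF a] e(1) by metis
    also have "Cas \<alpha> u = scale ?c u"
    proof (rule add.IH)
      show "ht \<alpha> (\<gamma> - \<beta>) = 1" using h b0 by simp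
      show "u \<in> root_space (\<gamma> - \<beta>)" by (rule u(1))
    qed
    finally show ?thesis by (simp add: bracket_scale_right)
  qed
  then show ?case by (rule Cas_scalar_of_vector[OF a gr w w0 _ add.prems(2)])
qed

lemma ht_le_depth: "\<alpha> \<in> simples \<Longrightarrow> \<gamma> \<in> roots \<Longrightarrow> ht \<alpha> \<gamma> \<le> depth \<alpha>"
  using highest_root(2)[of \<gamma>] ht_diff[OF root_lattice[OF pos_root[OF highest_root(1)]] root_lattice, of \<gamma> \<alpha>]
  by (force simp: nonneg_comb_iff depth_def)

lemma depth_pos: "\<alpha> \<in> simples \<Longrightarrow> depth \<alpha> \<ge> 1"
  using ht_le_depth[OF _ simple_root, of \<alpha> \<alpha>] ht_simple[of \<alpha> \<alpha>] by simp

text \<open>A root vector that is killed by all simple root vectors belongs to the highest root. Any other one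
  in the top degree is therefore moved by some simple root vector \<open>e\<close>, necessarily of
  degree zero, to a root vector of greater height with the same Casimir eigenvalue.\<close>

lemma Cas_level_depth:
  assumes a: "\<alpha> \<in> simples" and v: "\<And>x. x \<in> root_space highest_root \<Longrightarrow> Cas \<alpha> x = scale c x"
  shows "\<gamma> \<in> roots \<Longrightarrow> ht \<alpha> \<gamma> = depth \<alpha> \<Longrightarrow> x \<in> root_space \<gamma> \<Longrightarrow> Cas \<alpha> x = scale c x"
proof (induction "nat (height highest_root - height \<gamma>)" arbitrary: \<gamma> x rule: less_induct)
  case less
  note gr = less.prems(1)
  have gp: "\<gamma> \<in> pos_roots" by (rule pos_rootI[OF gr a]) (use less.prems depth_pos[OF a] in simp)
  obtain u where u: "u \<in> root_space \<gamma>" "u \<noteq> 0" using root_vector_exists[OF gr] by blast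
  show ?case
  proof (cases "\<gamma> = highest_root")
    case True
    then show ?thesis using v less.prems by simp
  next
    case False
    then obtain \<beta> e where b: "\<beta> \<in> simples" and e: "e \<in> root_space \<beta>" and eu: "bracket e u \<noteq> 0"
      using maximal_is_highest[OF gp u] by blast
    note br = simple_root[OF b]
    have w: "bracket e u \<in> root_space (\<gamma> + \<beta>)" using root_space_bracket[OF e u(1)] by (simp add: add.commute)
    have hb: "ht \<beta> (\<gamma> + \<beta>) = ht \<beta> \<gamma> + 1" using b by (simp add: ht_add root_lattice gr br ht_simple)
    then have "\<gamma> + \<beta> \<noteq> 0" using pos_ht[OF gp b] ht_0[OF b] by auto
    then have sr: "\<gamma> + \<beta> \<in> roots"
      using not_root_space[OF dual_closed(1)[OF root_dual[OF gr] root_dual[OF br]]] w eu by auto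
    have ne: "\<beta> \<noteq> \<alpha>" using ht_le_depth[OF a sr] hb less.prems(2) by auto
    then have b0: "ht \<alpha> \<beta> = 0" using ht_simple[OF b a] by simp
    then have hs: "ht \<alpha> (\<gamma> + \<beta>) = depth \<alpha>" using less.prems(2) a by (simp add: ht_add root_lattice gr br)
    have "0 \<le> height (highest_root - (\<gamma> + \<beta>))"
      unfolding height_def using highest_root(2)[OF sr] by (intro sum_nonneg) (auto simp: nonneg_comb_iff)
    then have "height (\<gamma> + \<beta>) \<le> height highest_root"
      by (simp add: height_def ht_diff root_lattice[OF sr] root_lattice[OF pos_root[OF highest_root(1)]] sum_subtractf)
    moreover have "height (\<gamma> + \<beta>) = height \<gamma> + 1" by (rule height_add_simple[OF root_lattice[OF gr] b])
    ultimately have "nat (height highest_root - height (\<gamma> + \<beta>)) < nat (height highest_root - height \<gamma>)" by simp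
    from less.hyps[OF this sr hs w] have 1: "Cas \<alpha> (bracket e u) = scale c (bracket e u)" .
    obtain c' where c': "Cas \<alpha> u = scale c' u" using Cas_on_root_space[OF a gr u(1)] by blast
    have "\<beta> \<in> roots_of_ht \<alpha> 0" using br b0 by (simp add: roots_of_ht_def)
    then have "bracket e (Cas \<alpha> u) = Cas \<alpha> (bracket e u)" using Cas_commutes[OF a] e by metis
    then have "scale c' (bracket e u) = scale c (bracket e u)" using 1 c' by (simp add: bracket_scale_right)
    then have "c' = c" using eu by simp
    then show ?thesis using Cas_scalar_of_vector[OF a gr u c'] less.prems(3) by simp
  qed
qed

lemma casimir_scalar_eqI:
  assumes a: "\<alpha> \<in> simples" and i: "i \<noteq> 0" and g: "\<gamma> \<in> roots_of_ht \<alpha> i"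
    and c: "\<And>\<gamma> x. \<gamma> \<in> roots_of_ht \<alpha> i \<Longrightarrow> x \<in> root_space \<gamma> \<Longrightarrow> Cas \<alpha> x = scale c x"
  shows "casimir_scalar \<alpha> i = c"
  unfolding casimir_scalar_def
proof (rule the_equality)
  have "Cas \<alpha> x = scale c x" if "x \<in> span (\<Union>\<gamma>\<in>roots_of_ht \<alpha> i. root_space \<gamma>)" for x
    using that
  proof (induction rule: span_induct_alt)
    case base
    then show ?case by (simp add: lin_zero[OF lin_Cas[OF a]])
  next
    case (step k x y)
    have "Cas \<alpha> x = scale c x" using c step.hyps by blast
    then show ?case using step.IH
      by (simp add: lin_add[OF lin_Cas[OF a]] lin_scale[OF lin_Cas[OF a]] scale_right_distrib mult.commute)
  qed
  then show "\<forall>x\<in>graded_part \<alpha> i. Cas \<alpha> x = scale c x" using i by (simp add: graded_part_def)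
next
  fix c' assume c': "\<forall>x\<in>graded_part \<alpha> i. Cas \<alpha> x = scale c' x"
  obtain v where v: "v \<in> root_space \<gamma>" "v \<noteq> 0" using root_vector_exists[of \<gamma>] g by (auto simp: roots_of_ht_def)
  have "v \<in> graded_part \<alpha> i" unfolding graded_part_def using v g by (auto intro!: span_base)
  then have "scale c' v = scale c v" using c' c[OF g v(1)] by simp
  then show "c' = c" using v(2) by simp
qed

lemma casimir_scalars:
  assumes a: "\<alpha> \<in> simples"
  shows "casimir_scalar \<alpha> 1 = of_nat (q_number \<alpha>) / (2 * dual_coxeter_number * length_ratio \<alpha>)"
    and "casimir_scalar \<alpha> (depth \<alpha>)
      = 1 - of_int (depth \<alpha>) * of_nat (q_number \<alpha>) / (2 * dual_coxeter_number * length_ratio \<alpha>)"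
proof -
  have "2 * dual_coxeter_number * length_ratio \<alpha> = 2 / form \<alpha> \<alpha>"
    using dual_coxeter_number_form by (simp add: length_ratio_def)
  moreover have "(of_nat (q_number \<alpha>) :: 'k) = of_int (q_int \<alpha>)" by (simp only: q_number_eq[OF a, symmetric] of_int_of_nat_eq)
  ultimately have q: "of_nat (q_number \<alpha>) / (2 * dual_coxeter_number * length_ratio \<alpha>) = of_int (q_int \<alpha>) * form \<alpha> \<alpha> / 2"
    by simp
  have 1: "casimir_scalar \<alpha> 1 = of_int (q_int \<alpha>) * form \<alpha> \<alpha> / 2"
  proof (rule casimir_scalar_eqI[OF a])
    show "\<alpha> \<in> roots_of_ht \<alpha> 1" using simple_root[OF a] ht_simple[OF a a] by (simp add: roots_of_ht_def)
    show "Cas \<alpha> x = scale (of_int (q_int \<alpha>) * form \<alpha> \<alpha> / 2) x" if "\<gamma> \<in> roots_of_ht \<alpha> 1" "x \<in> root_space \<gamma>" for \<gamma> x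
      using Cas_level_1[OF a, of \<gamma> x] pos_rootI[of \<gamma>, OF _ a] that by (simp add: roots_of_ht_def)
  qed simp
  have 2: "casimir_scalar \<alpha> (depth \<alpha>) = 1 - of_int (depth \<alpha>) * of_int (q_int \<alpha>) * form \<alpha> \<alpha> / 2"
  proof (rule casimir_scalar_eqI[OF a])
    show "depth \<alpha> \<noteq> 0" using depth_pos[OF a] by simp
    show "highest_root \<in> roots_of_ht \<alpha> (depth \<alpha>)" using pos_root[OF highest_root(1)] by (simp add: roots_of_ht_def depth_def)
    show "Cas \<alpha> x = scale (1 - of_int (depth \<alpha>) * of_int (q_int \<alpha>) * form \<alpha> \<alpha> / 2) x"
      if "\<gamma> \<in> roots_of_ht \<alpha> (depth \<alpha>)" "x \<in> root_space \<gamma>" for \<gamma> x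
      using Cas_level_depth[OF a Cas_highest[OF a], of \<gamma> x] that by (simp add: roots_of_ht_def)
  qed
  show "casimir_scalar \<alpha> 1 = of_nat (q_number \<alpha>) / (2 * dual_coxeter_number * length_ratio \<alpha>)"
    by (simp only: 1 q)
  have "of_int (depth \<alpha>) * of_nat (q_number \<alpha>) / (2 * dual_coxeter_number * length_ratio \<alpha>)
      = of_int (depth \<alpha>) * (of_int (q_int \<alpha>) * form \<alpha> \<alpha> / 2)"
    by (simp only: times_divide_eq_right[symmetric] q)
  then show "casimir_scalar \<alpha> (depth \<alpha>)
      = 1 - of_int (depth \<alpha>) * of_nat (q_number \<alpha>) / (2 * dual_coxeter_number * length_ratio \<alpha>)"
    by (simp add: 2 mult.assoc)
qed

end

section \<open>The eigenvalues\<close>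

theorem theorem3p1:
  fixes scale :: "'k::{alg_closed_field, field_char_0} \<Rightarrow> 'g::ab_group_add \<Rightarrow> 'g"
    and bracket :: "'g \<Rightarrow> 'g \<Rightarrow> 'g"
    and T :: "'g set"
    and simples :: "('g \<Rightarrow> 'k) set"
    and \<alpha> :: "'g \<Rightarrow> 'k"
    and d :: int and q :: nat and h r :: 'k
  assumes "based_simple_lie_algebra scale bracket T simples"
    and "\<alpha> \<in> simples"
    and "d = based_simple_lie_algebra.depth scale bracket T simples \<alpha>"
    and "q = based_simple_lie_algebra.q_number scale bracket T simples \<alpha>"
    and "h = based_simple_lie_algebra.dual_coxeter_number scale bracket T simples"
    and "r = based_simple_lie_algebra.length_ratio scale bracket T simples \<alpha>"
  shows "based_simple_lie_algebra.casimir_scalar scale bracket T simples \<alpha> 1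
           = of_nat q / (2 * h * r)
       \<and> based_simple_lie_algebra.casimir_scalar scale bracket T simples \<alpha> d
           = 1 - of_int d * of_nat q / (2 * h * r)"
proof -
  interpret based_simple_lie_algebra scale bracket T simples by (rule assms(1))
  show ?thesis unfolding assms(3-6) using casimir_scalars[OF assms(2)] by blast
qed

end
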